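(* There is an absolute constant $c$ such that for every prime $p$ and any integers $r>s>1$ we have $$N_p(r,s)\leqslant c\,\frac{rs}{\log p}+4.$$
   Context: For a prime $p$ and positive integers $r,s$, $N_p(r,s)$ denotes the number of solutions $(x,y)\in\mathbb{F}_p^*\times\mathbb{F}_p^*$ of the system $x^r=y^r+1$, $x^s=y^s+1$, $x=y+1$; equivalently, it counts common zeros $y$ in $\mathbb{F}_p$ of the polynomials $F_r(Y)=(Y+1)^r-Y^r-1$ and $F_s(Y)=(Y+1)^s-Y^s-1$ subject to $y\neq 0$, $y+1\neq 0$. *)

theory Defs
  imports Complex_Main "HOL-Number_Theory.Residues"
begin

text \<open>The library's ring of residues modulo \<open>p\<close>, whose carrier is \<open>{0..p-1}\<close>;
  for prime \<open>p\<close> it is the field with \<open>p\<close> elements.\<close>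

abbreviation Fp :: "nat \<Rightarrow> int ring" where
  "Fp p \<equiv> residue_ring (int p)"

definition N_sol :: "nat \<Rightarrow> nat \<Rightarrow> nat \<Rightarrow> nat" where
  "N_sol p r s = card {(x, y). x \<in> Units (Fp p) \<and> y \<in> Units (Fp p) \<and>
     x [^]\<^bsub>Fp p\<^esub> r = y [^]\<^bsub>Fp p\<^esub> r \<oplus>\<^bsub>Fp p\<^esub> \<one>\<^bsub>Fp p\<^esub> \<and>
     x [^]\<^bsub>Fp p\<^esub> s = y [^]\<^bsub>Fp p\<^esub> s \<oplus>\<^bsub>Fp p\<^esub> \<one>\<^bsub>Fp p\<^esub> \<and>
     x = y \<oplus>\<^bsub>Fp p\<^esub> \<one>\<^bsub>Fp p\<^esub>}"

end

theory Submission
  imports Defs "Subresultants.Subresultant_Gcd" "Berlekamp_Zassenhaus.Factor_Bound"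
begin

text \<open>The point is that \<open>F_r\<close> and \<open>F_s\<close> have no common complex root besides \<open>0\<close>, \<open>-1\<close> and the primitive cube
  roots of unity, unless \<open>s\<close> is so small that \<open>F_s\<close> accounts for at most four solutions modulo \<open>p\<close>. Let \<open>y\<close> be
  such a common root and \<open>x = 1 + y\<close>. The form \<open>xy (x^2 - xy + y^2)\<close> bounds the height of the point
  \<open>(x : y : 1)\<close> from below by \<open>ln (27/4) / 10\<close>. On the other hand \<open>(x^s, y^s, 1)\<close> and \<open>(x^r, y^r, 1)\<close> lie on the same
  line; Pade relations between \<open>x^s\<close> and \<open>y^s\<close> yield for every \<open>k\<close> two independent linear relations with small
  coefficients between \<open>x^r\<close>, \<open>y^r\<close> and 1, and thereby an upper bound for the height. The two bounds are
  incompatible for \<open>s \<ge> 11\<close>; for \<open>s = 6, 8, 9, 10\<close> the lower bound improves because \<open>x\<close> and \<open>y\<close> are not units.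

  Hence, after removal of the exceptional factors of \<open>F_s\<close>, its resultant with \<open>F_r\<close> is a nonzero integer of
  size \<open>exp (O(r s))\<close>. Each further common root modulo \<open>p\<close> contributes a factor \<open>p\<close> to the resultant, so there are
  \<open>O(r s / ln p)\<close> of them.\<close>

section \<open>Determinants of evaluation matrices\<close>

text \<open>The threshold \<open>s = 10\<close> is where two occurrences of 27/4 meet. The Pade
  relations have size \<open>(3 * k) choose k\<close>, which grows like (27/4)^k, so for
  \<open>k\<close> near \<open>r / (2 * s)\<close> they bound the height by about ln (27/4) / s as
  \<open>k\<close> grows. The auxiliary form bounds it from below by ln (27/4) / 10. Hence
  \<open>s = 11\<close> already leaves only finitely many \<open>k\<close> to settle numerically,
  while \<open>s = 10\<close> needs some extra gain.

  The obstacle is bounded \<open>r / s\<close>. The Pade bound carries the factor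
  \<open>min (3ks - r) (2r - 3ks)\<close>, which is negative for \<open>r\<close> below
  \<open>3s/2\<close> and vanishes at \<open>r = 3s\<close> both for \<open>k = 1\<close> and for
  \<open>k = 2\<close>. There the exponents \<open>s\<close> and \<open>r\<close> are compared
  directly, or a special cubic relation is used. In addition, for moderate \<open>r\<close> the
  triangle with sides 1, |y|, |1 + y| cannot be very thin, which raises the lower bound.

  The 4 of the theorem comes from \<open>s <= 5\<close> and \<open>s = 7\<close>, where for
  \<open>p > s\<close> degree considerations leave at most four solutions; in the main case the
  primitive cube roots of unity cost only 2.\<close>

definition coeff_mat :: "nat \<Rightarrow> (nat \<Rightarrow> 'a::comm_ring_1 poly) \<Rightarrow> 'a mat" where
  "coeff_mat n P = mat n n (\<lambda>(i, c). coeff (P i) (n - 1 - c))"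

text \<open>Powers descend with the row index to match the descending degrees in the columns of
  \<open>coeff_mat\<close>, an order shared with the Sylvester matrix.\<close>

definition vander :: "nat \<Rightarrow> (nat \<Rightarrow> 'a::comm_ring_1) \<Rightarrow> 'a mat" where
  "vander d y = mat d d (\<lambda>(m, c). y c ^ (d - 1 - m))"

lemma poly_eq_sum_reversed:
  fixes p :: "'a::comm_ring_1 poly"
  assumes "degree p < n"
  shows "poly p x = (\<Sum>j<n. coeff p (n - 1 - j) * x ^ (n - 1 - j))"
proof -
  have "poly p x = (\<Sum>i\<le>degree p. coeff p i * x ^ i)" by (rule poly_altdef)
  also have "\<dots> = (\<Sum>i<n. coeff p i * x ^ i)"
    by (rule sum.mono_neutral_left) (use assms in \<open>auto simp: coeff_eq_0\<close>)
  also have "\<dots> = (\<Sum>j<n. coeff p (n - 1 - j) * x ^ (n - 1 - j))"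
    by (subst sum.nat_diff_reindex[symmetric]) simp
  finally show ?thesis .
qed

text \<open>The transition matrix has unit columns followed by evaluation columns; it is block
  triangular with a Vandermonde block.\<close>

lemma det_coeff_mat_mult_vander:
  fixes P :: "nat \<Rightarrow> 'a::idom poly"
  assumes deg: "\<And>i. i < n \<Longrightarrow> degree (P i) < n" and d: "d \<le> n"
  shows "det (coeff_mat n P) * det (vander d y) =
    det (mat n n (\<lambda>(i, c). if c < n - d then coeff (P i) (n - 1 - c) else poly (P i) (y (c - (n - d)))))"
proof -
  define V where "V = mat n n (\<lambda>(m, c). if c < n - d then (if m = c then 1 else 0)
      else y (c - (n - d)) ^ (n - 1 - m) :: 'a)"
  define X where "X = mat (n - d) d (\<lambda>(m, c). y c ^ (n - 1 - m))"
  have V: "V = four_block_mat (1\<^sub>m (n - d)) X (0\<^sub>m d (n - d)) (vander d y)"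
    by (rule eq_matI)
       (use d in \<open>auto simp: V_def X_def vander_def four_block_mat_def Let_def intro!: arg_cong2[where f = "(^)"]\<close>)
  then have detV: "det V = det (vander d y)"
    using det_four_block_mat_lower_left_zero[of "1\<^sub>m (n - d)" "n - d" X d "0\<^sub>m d (n - d)" "vander d y"]
    by (simp add: X_def vander_def)
  have VC: "V \<in> carrier_mat n n" by (simp add: V_def)
  have SC: "coeff_mat n P \<in> carrier_mat n n" by (simp add: coeff_mat_def)
  have "coeff_mat n P * V = mat n n (\<lambda>(i, c). if c < n - d then coeff (P i) (n - 1 - c) else poly (P i) (y (c - (n - d))))"
  proof (rule eq_matI, goal_cases)
    case (1 i j)
    then have ij: "i < n" "j < n" by auto
    have "(coeff_mat n P * V) $$ (i, j) = (\<Sum>m<n. coeff (P i) (n - 1 - m) * V $$ (m, j))"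
      using ij by (simp add: scalar_prod_def coeff_mat_def V_def lessThan_atLeast0)
    also have "\<dots> = (if j < n - d then coeff (P i) (n - 1 - j) else poly (P i) (y (j - (n - d))))"
    proof (cases "j < n - d")
      case True
      have "(\<Sum>m<n. coeff (P i) (n - 1 - m) * V $$ (m, j)) = (\<Sum>m<n. if m = j then coeff (P i) (n - 1 - m) else 0)"
        by (rule sum.cong) (use ij True in \<open>auto simp: V_def\<close>)
      then show ?thesis using True ij by (simp add: sum.delta)
    next
      case False
      have "(\<Sum>m<n. coeff (P i) (n - 1 - m) * V $$ (m, j)) =
          (\<Sum>m<n. coeff (P i) (n - 1 - m) * y (j - (n - d)) ^ (n - 1 - m))"
        by (rule sum.cong) (use ij False in \<open>auto simp: V_def\<close>)
      also have "\<dots> = poly (P i) (y (j - (n - d)))"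
        using poly_eq_sum_reversed[OF deg[OF ij(1)]] by simp
      finally show ?thesis using False by simp
    qed
    finally show ?case using ij by simp
  qed (auto simp: coeff_mat_def V_def)
  then show ?thesis using det_mult[OF SC VC] detV by simp
qed

text \<open>The transition formula is applied to the products of X - y_l over l > i. Their
  coefficient matrix is upper unitriangular, and their evaluation matrix is lower triangular with
  the stated diagonal.\<close>

lemma det_vander:
  fixes y :: "nat \<Rightarrow> 'a::idom"
  shows "det (vander d y) = (\<Prod>i<d. \<Prod>l\<in>{i<..<d}. y i - y l)"
proof -
  define P where "P i = (\<Prod>l\<in>{i<..<d}. [:- y l, 1:])" for i
  have monic: "lead_coeff (P i) = 1" for i unfolding P_def lead_coeff_prod by simp
  have dP: "degree (P i) = d - 1 - i" if "i < d" for i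
    unfolding P_def by (subst degree_prod_eq_sum_degree) (use that in auto)
  have "det (coeff_mat d P) = 1"
  proof -
    have ut: "upper_triangular (coeff_mat d P)"
    proof (rule upper_triangularI)
      fix i j assume "j < i" "i < dim_row (coeff_mat d P)"
      then show "coeff_mat d P $$ (i, j) = 0"
        by (auto simp: coeff_mat_def dP intro!: coeff_eq_0)
    qed
    have "coeff_mat d P $$ (i, i) = 1" if "i < d" for i
      using monic[of i] that by (simp add: coeff_mat_def dP)
    then have "prod_list (diag_mat (coeff_mat d P)) = 1"
      unfolding diag_mat_def
      by - (rule prod_list_neutral, auto simp: coeff_mat_def)
    then show ?thesis using det_upper_triangular[OF ut, of d] by (simp add: coeff_mat_def)
  qed
  moreover have "det (coeff_mat d P) * det (vander d y) = det (mat d d (\<lambda>(i, c). poly (P i) (y c)))"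
    using det_coeff_mat_mult_vander[of d P d y] dP by simp
  moreover have "det (mat d d (\<lambda>(i, c). poly (P i) (y c))) = (\<Prod>i<d. \<Prod>l\<in>{i<..<d}. y i - y l)"
  proof -
    define L where "L = mat d d (\<lambda>(i, c). poly (P i) (y c))"
    have "det L = prod_list (diag_mat L)"
    proof (rule det_lower_triangular)
      fix i j assume "i < j" "j < d"
      then show "L $$ (i, j) = 0" by (auto simp: L_def P_def poly_prod intro!: prod_zero)
    qed (auto simp: L_def)
    also have "\<dots> = (\<Prod>i<d. \<Prod>l\<in>{i<..<d}. y i - y l)"
      unfolding diag_mat_def L_def P_def poly_prod
      by (simp add: prod.list_conv_set_nth lessThan_atLeast0)
    finally show ?thesis unfolding L_def .
  qed
  ultimately show ?thesis by simp
qed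

lemma det_vander_nonzero:
  fixes y :: "nat \<Rightarrow> 'a::idom"
  assumes "inj_on y {..<d}"
  shows "det (vander d y) \<noteq> 0"
  unfolding det_vander using assms by (fastforce simp: inj_on_def)

text \<open>The product of row sums expands over all maps of the index set to itself, and the
  Leibniz formula uses only the permutations among them. Permutations are restricted because
  \<open>PiE\<close> consists of extensional functions.\<close>

lemma det_norm_le_prod_sum:
  fixes A :: "int mat"
  assumes A: "A \<in> carrier_mat n n"
  shows "\<bar>det A\<bar> \<le> (\<Prod>i<n. \<Sum>j<n. \<bar>A $$ (i, j)\<bar>)"
proof -
  let ?r = "\<lambda>p. restrict p {..<n}"
  have "\<bar>det A\<bar> \<le> (\<Sum>p | p permutes {0..<n}. \<bar>signof p * (\<Prod>i = 0..<n. A $$ (i, p i))\<bar>)"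
    unfolding det_def'[OF A] by (rule sum_abs)
  also have "\<dots> = (\<Sum>p | p permutes {0..<n}. \<Prod>i<n. \<bar>A $$ (i, p i)\<bar>)"
    by (rule sum.cong) (auto simp: abs_mult abs_prod lessThan_atLeast0 sign_def)
  also have "\<dots> = (\<Sum>g\<in>?r ` {p. p permutes {0..<n}}. \<Prod>i<n. \<bar>A $$ (i, g i)\<bar>)"
  proof (subst sum.reindex)
    show "inj_on ?r {p. p permutes {0..<n}}"
    proof (rule inj_onI, rule ext)
      fix p q x assume pq: "p \<in> {p. p permutes {0..<n}}" "q \<in> {p. p permutes {0..<n}}" "?r p = ?r q"
      show "p x = q x"
      proof (cases "x < n")
        case True then show ?thesis using fun_cong[OF pq(3), of x] by simp
      next
        case False then show ?thesis using pq(1,2) by (auto simp: permutes_def)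
      qed
    qed
  qed (auto intro!: sum.cong prod.cong)
  also have "\<dots> \<le> (\<Sum>g\<in>PiE {..<n} (\<lambda>_. {..<n}). \<Prod>i<n. \<bar>A $$ (i, g i)\<bar>)"
  proof (rule sum_mono2)
    show "?r ` {p. p permutes {0..<n}} \<subseteq> PiE {..<n} (\<lambda>_. {..<n})"
      using permutes_in_image[of _ "{0..<n}"] by fastforce
  qed (auto intro!: finite_PiE prod_nonneg)
  also have "\<dots> = (\<Prod>i<n. \<Sum>j<n. \<bar>A $$ (i, j)\<bar>)"
    by (rule prod_sum_PiE[symmetric]) auto
  finally show ?thesis .
qed

text \<open>Reindexed by columns, every Leibniz term has one factor from each of the last
  \<open>N\<close> columns.\<close>

lemma power_dvd_det_of_dvd_cols:
  fixes A :: "int mat"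
  assumes A: "A \<in> carrier_mat n n" and N: "N \<le> n"
    and dvd: "\<And>i c. i < n \<Longrightarrow> n - N \<le> c \<Longrightarrow> c < n \<Longrightarrow> p dvd A $$ (i, c)"
  shows "p ^ N dvd det A"
  unfolding det_def'[OF A]
proof (rule dvd_sum, rule dvd_mult)
  fix \<pi> assume "\<pi> \<in> {\<pi>. \<pi> permutes {0..<n}}"
  then have perm: "\<pi> permutes {0..<n}" by simp
  have bij: "bij_betw \<pi> {0..<n} {0..<n}" using perm permutes_imp_bij by blast
  have inv: "Hilbert_Choice.inv \<pi> c < n" if "c < n" for c
    using permutes_in_image[OF permutes_inv[OF perm], of c] that by simp
  have "(\<Prod>i = 0..<n. A $$ (i, \<pi> i)) = (\<Prod>c = 0..<n. A $$ (Hilbert_Choice.inv \<pi> c, c))"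
    using prod.reindex_bij_betw[OF bij, of "\<lambda>c. A $$ (Hilbert_Choice.inv \<pi> c, c)"] permutes_inverses[OF perm] by simp
  moreover have "(\<Prod>c\<in>{n - N..<n}. p) dvd (\<Prod>c\<in>{n - N..<n}. A $$ (Hilbert_Choice.inv \<pi> c, c))"
    by (rule prod_dvd_prod) (use dvd inv in auto)
  moreover have "(\<Prod>c\<in>{n - N..<n}. A $$ (Hilbert_Choice.inv \<pi> c, c)) dvd (\<Prod>c = 0..<n. A $$ (Hilbert_Choice.inv \<pi> c, c))"
    by (rule prod_dvd_prod_subset) auto
  ultimately show "p ^ N dvd (\<Prod>i = 0..<n. A $$ (i, \<pi> i))"
    using N by (simp) (meson dvd_trans)
qed

lemma cong_det:
  fixes A B :: "int mat"
  assumes A: "A \<in> carrier_mat n n" and B: "B \<in> carrier_mat n n"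
    and "\<And>i c. i < n \<Longrightarrow> c < n \<Longrightarrow> [A $$ (i, c) = B $$ (i, c)] (mod p)"
  shows "[det A = det B] (mod p)"
  unfolding det_def'[OF A] det_def'[OF B]
proof (rule cong_sum, rule cong_mult)
  fix \<pi> assume "\<pi> \<in> {\<pi>. \<pi> permutes {0..<n}}"
  then have perm: "\<pi> permutes {0..<n}" by simp
  show "[(\<Prod>i = 0..<n. A $$ (i, \<pi> i)) = (\<Prod>i = 0..<n. B $$ (i, \<pi> i))] (mod p)"
    by (rule cong_prod) (use assms(3) permutes_in_image[OF perm] in auto)
qed auto

section \<open>The product formula for an algebraic number\<close>

lemma det_mult_cols:
  fixes f :: "nat \<Rightarrow> nat \<Rightarrow> 'a::idom"
  shows "det (mat d d (\<lambda>(l, c). g c * f l c)) = (\<Prod>c<d. g c) * det (mat d d (\<lambda>(l, c). f l c))"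
proof -
  define B where "B = mat d d (\<lambda>(i, c). if i = c then g c else 0)"
  have "det B = prod_list (diag_mat B)"
    by (rule det_upper_triangular[of _ d]) (auto simp: B_def)
  also have "\<dots> = (\<Prod>c<d. g c)"
    unfolding diag_mat_def B_def by (simp add: prod.list_conv_set_nth lessThan_atLeast0)
  finally have B: "det B = (\<Prod>c<d. g c)" .
  have "mat d d (\<lambda>(l, c). g c * f l c) = mat d d (\<lambda>(l, c). f l c) * B"
  proof (rule eq_matI, goal_cases)
    case (1 i j)
    then have "(mat d d (\<lambda>(l, c). f l c) * B) $$ (i, j) = (\<Sum>k<d. f i k * (if k = j then g j else 0))"
      by (simp add: scalar_prod_def B_def lessThan_atLeast0)
    also have "\<dots> = (\<Sum>k<d. if k = j then f i k * g j else 0)"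
      by (rule sum.cong) auto
    also have "\<dots> = f i j * g j" using 1 by (simp add: B_def)
    finally show ?case using 1 by (simp add: B_def mult.commute)
  qed (auto simp: B_def)
  then have "det (mat d d (\<lambda>(l, c). g c * f l c)) = det (mat d d (\<lambda>(l, c). f l c)) * det B"
    using det_mult[of "mat d d (\<lambda>(l, c). f l c)" d B] by (simp add: B_def)
  then show ?thesis using B by (simp add: mult.commute)
qed

text \<open>The first \<open>M\<close> rows span the multiples of \<open>G\<close> of degree below
  \<open>M + degree G\<close>, so the determinant of the whole family measures the
  \<open>h l\<close> in the quotient modulo \<open>G\<close>.\<close>

definition shift_rows :: "nat \<Rightarrow> int poly \<Rightarrow> (nat \<Rightarrow> int poly) \<Rightarrow> nat \<Rightarrow> int poly" where
  "shift_rows M G h i = (if i < M then monom 1 (M - 1 - i) * G else h (i - M))"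

lemma degree_shift_rows:
  assumes "G \<noteq> 0" "degree G = d" "\<And>l. l < d \<Longrightarrow> degree (h l) < M + d" "i < M + d"
  shows "degree (shift_rows M G h i) < M + d"
  using assms by (auto simp: shift_rows_def degree_mult_eq degree_monom_eq)

text \<open>Evaluation at the roots annihilates the shifts of \<open>G\<close>. What remains is
  block triangular: one block is triangular with the leading coefficient of \<open>G\<close> on the
  diagonal, the other holds the values of the \<open>h l\<close>.\<close>

lemma det_shift_rows:
  fixes G :: "int poly" and ys :: "nat \<Rightarrow> complex"
  assumes d: "degree G = d" and G0: "G \<noteq> 0"
    and root: "\<And>c. c < d \<Longrightarrow> poly (of_int_poly G) (ys c) = 0"
    and h: "\<And>l. l < d \<Longrightarrow> degree (h l) < M + d"
  shows "of_int (det (coeff_mat (M + d) (shift_rows M G h))) * det (vander d ys) =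
    of_int (lead_coeff G) ^ M * det (mat d d (\<lambda>(l, c). poly (of_int_poly (h l)) (ys c)))"
proof -
  define P where "P = (\<lambda>i. of_int_poly (shift_rows M G h i) :: complex poly)"
  let ?n = "M + d"
  have "of_int (det (coeff_mat ?n (shift_rows M G h))) = det (map_mat of_int (coeff_mat ?n (shift_rows M G h)) :: complex mat)"
    by (rule of_int_hom.hom_det[symmetric])
  also have "map_mat of_int (coeff_mat ?n (shift_rows M G h)) = coeff_mat ?n P"
    by (rule eq_matI) (auto simp: coeff_mat_def P_def)
  finally have 1: "of_int (det (coeff_mat ?n (shift_rows M G h))) * det (vander d ys) = det (coeff_mat ?n P) * det (vander d ys)"
    by simp
  have "det (coeff_mat ?n P) * det (vander d ys) =
    det (mat ?n ?n (\<lambda>(i, c). if c < M then coeff (P i) (?n - 1 - c) else poly (P i) (ys (c - M))))"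
  proof -
    have "degree (P i) < ?n" if "i < ?n" for i
      using degree_shift_rows[of G d h M i] G0 d h that by (simp add: P_def)
    from det_coeff_mat_mult_vander[of ?n P d ys, OF this] show ?thesis by (simp only: add_diff_cancel_right' le_add2 simp_thms)
  qed
  moreover define T where "T = mat M M (\<lambda>(i, c). coeff (P i) (?n - 1 - c))"
  define X where "X = mat d M (\<lambda>(i, c). coeff (P (M + i)) (?n - 1 - c))"
  define W where "W = mat d d (\<lambda>(l, c). poly (of_int_poly (h l)) (ys c))"
  have coeffP: "coeff (P i) (?n - 1 - c) = (if M - 1 - i \<le> ?n - 1 - c then of_int (coeff G (?n - 1 - c - (M - 1 - i))) else 0)"
    if "i < M" "c < M" for i c
    using that by (simp add: P_def shift_rows_def coeff_monom_mult)
  have "mat ?n ?n (\<lambda>(i, c). if c < M then coeff (P i) (?n - 1 - c) else poly (P i) (ys (c - M))) =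
      four_block_mat T (0\<^sub>m M d) X W"
  proof (rule eq_matI, goal_cases)
    case (1 i j)
    then have ij: "i < M + d" "j < M + d" by (auto simp: T_def W_def)
    have z: "poly (P i) (ys (j - M)) = 0" if "i < M" "\<not> j < M"
      using root[of "j - M"] that ij by (simp add: P_def shift_rows_def of_int_poly_hom.hom_mult)
    have w: "poly (P i) (ys (j - M)) = poly (of_int_poly (h (i - M))) (ys (j - M))" if "\<not> i < M"
      using that by (simp add: P_def shift_rows_def)
    show ?case using ij z w by (auto simp: T_def X_def W_def)
  qed (auto simp: T_def W_def)
  moreover have "det (four_block_mat T (0\<^sub>m M d) X W) = det T * det W"
    by (rule det_four_block_mat_upper_right_zero) (auto simp: T_def X_def W_def)
  moreover have "det T = of_int (lead_coeff G) ^ M"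
  proof -
    have "upper_triangular T"
    proof (rule upper_triangularI)
      fix i j assume "j < i" "i < dim_row T"
      then have "i < M" "j < M" "j < i" by (auto simp: T_def)
      moreover from this have "T $$ (i, j) = coeff (P i) (?n - 1 - j)" by (simp add: T_def)
      ultimately show "T $$ (i, j) = 0"
        using d by (simp only: coeffP) (auto intro!: coeff_eq_0)
    qed
    then have "det T = prod_list (diag_mat T)" by (rule det_upper_triangular[of _ M]) (simp add: T_def)
    also have "\<dots> = (\<Prod>i<M. coeff (P i) (?n - 1 - i))"
      unfolding diag_mat_def by (simp add: prod.list_conv_set_nth lessThan_atLeast0 T_def)
    also have "\<dots> = (\<Prod>i<M. of_int (lead_coeff G))"
      by (rule prod.cong) (use d in \<open>simp_all only: coeffP lessThan_iff, auto\<close>)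
    finally show ?thesis by simp
  qed
  ultimately show ?thesis using 1 by (simp add: W_def)
qed

text \<open>The integers \<open>m\<close> with \<open>q * m\<close> integral form an ideal. By
  hypothesis no prime divides all of its elements, so its least positive element is 1.\<close>

lemma int_if_locally_integral:
  fixes q :: complex
  assumes "\<And>p::int. prime p \<Longrightarrow> \<exists>m::int. \<not> p dvd m \<and> q * of_int m \<in> \<int>"
  shows "q \<in> \<int>"
proof -
  \<comment> \<open>The hypothesis at 2 serves only to supply some nonzero denominator.\<close>
  have "prime (2::int)" by simp
  from assms[OF this] obtain m0 :: int where m0: "\<not> 2 dvd m0" "q * of_int m0 \<in> \<int>" by blast
  define S where "S = (\<lambda>n::nat. n > 0 \<and> q * of_nat n \<in> \<int>)"
  have "S (nat \<bar>m0\<bar>)"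
  proof -
    have "(of_nat (nat \<bar>m0\<bar>) :: complex) = of_int \<bar>m0\<bar>" by simp
    moreover have "q * of_int \<bar>m0\<bar> \<in> \<int>" using m0(2) by (cases "m0 \<ge> 0") (simp_all add: abs_if)
    moreover have "m0 \<noteq> 0" using m0(1) by auto
    ultimately show ?thesis unfolding S_def by simp
  qed
  then have least: "S (LEAST n. S n)" by (rule LeastI)
  define n where "n = (LEAST n. S n)"
  have n: "n > 0" "q * of_nat n \<in> \<int>" using least unfolding S_def n_def by auto
  have dvd: "int n dvd m" if "q * of_int m \<in> \<int>" for m :: int
  proof -
    let ?r = "nat (m mod int n)"
    have "int ?r = m - int n * (m div int n)" using n(1) by (simp add: minus_mult_div_eq_mod)
    then have "(of_int (int ?r) :: complex) = of_int m - of_nat n * of_int (m div int n)"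
      by (metis of_int_diff of_int_mult of_int_of_nat_eq)
    then have "(of_nat ?r :: complex) = of_int m - of_nat n * of_int (m div int n)"
      by (simp only: of_int_of_nat_eq)
    then have "q * of_nat ?r = q * of_int m - q * of_nat n * of_int (m div int n)"
      by (simp only: right_diff_distrib mult.assoc)
    then have "q * of_nat ?r \<in> \<int>" using that n(2) by (metis Ints_diff Ints_mult Ints_of_int)
    moreover have "?r < n" using n(1) by (simp add: nat_less_iff)
    ultimately have "?r = 0" using not_less_Least[of ?r S] unfolding S_def n_def by auto
    then have "m mod int n \<le> 0" by simp
    moreover have "m mod int n \<ge> 0" using n(1) by simp
    ultimately show ?thesis by (simp add: dvd_eq_mod_eq_0)
  qed
  have "n = 1"
  proof (rule ccontr)
    assume "n \<noteq> 1"
    then obtain p :: nat where p: "prime p" "p dvd n" using prime_factor_nat by blast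
    then have "prime (int p)" by simp
    from assms[OF this] obtain m :: int where "\<not> int p dvd m" "q * of_int m \<in> \<int>" by blast
    then show False using dvd[of m] p(2) by (meson dvd_trans int_dvd_int_iff)
  qed
  then show ?thesis using n by simp
qed

text \<open>Modulo \<open>p\<close> the polynomial \<open>G\<close> has some degree
  \<open>a\<close>, so its \<open>M\<close> shifts have the leading degrees
  \<open>a, ..., a + M - 1\<close>. The monomials are chosen in the degrees missed, namely those
  below \<open>a\<close> and those from \<open>a + M\<close> on. Sorted by degree, the matrix is
  triangular modulo \<open>p\<close> with diagonal entries 1 and \<open>coeff G a\<close>.\<close>

lemma exists_minor_not_dvd:
  fixes G :: "int poly" and p :: int
  assumes d: "degree G = d" and G0: "G \<noteq> 0" and p: "prime p" and content: "content G = 1"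
  shows "\<exists>J. (\<forall>l<d. J l < M + d) \<and>
    \<not> p dvd det (coeff_mat (M + d) (shift_rows M G (\<lambda>l. monom 1 (J l))))"
proof -
  have ex: "\<exists>a. \<not> p dvd coeff G a"
  proof (rule ccontr)
    assume "\<not> ?thesis"
    then have "[:p:] dvd G" by (simp add: const_poly_dvd_iff)
    then have "p dvd content G" by (simp add: const_poly_dvd_iff_dvd_content)
    then show False using content p by (metis not_prime_unit)
  qed
  have bound: "a \<le> d" if "\<not> p dvd coeff G a" for a
  proof (rule ccontr)
    assume "\<not> a \<le> d"
    then have "coeff G a = 0" using d by (intro coeff_eq_0) simp
    then show False using that by simp
  qed
  define a where "a = (GREATEST a. \<not> p dvd coeff G a)"
  have a: "\<not> p dvd coeff G a" unfolding a_def
    using ex bound by (elim exE) (rule GreatestI_nat[where b = d], auto)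
  have above: "p dvd coeff G b" if "a < b" for b
    using Greatest_le_nat[of "\<lambda>a. \<not> p dvd coeff G a" b d] bound that unfolding a_def by force
  have ad: "a \<le> d" using bound[OF a] .
  define n where "n = M + d"
  define J where "J l = (if l < d - a then n - 1 - l else d - 1 - l)" for l
  define A where "A = coeff_mat n (shift_rows M G (\<lambda>l. monom 1 (J l)))"
  \<comment> \<open>Sorting the rows by descending degree: monomials of high degree, then the shifts
    of \<open>G\<close>, then monomials of low degree.\<close>
  define \<tau> where "\<tau> i = (if i < d - a then M + i else if i < d - a + M then i - (d - a) else i)" for i
  have "inj_on \<tau> {0..<n}"
    by (rule inj_onI) (use ad in \<open>auto simp: \<tau>_def n_def split: if_splits\<close>)
  moreover have "\<tau> ` {0..<n} \<subseteq> {0..<n}" using ad by (auto simp: \<tau>_def n_def)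
  ultimately have "bij_betw \<tau> {0..<n} {0..<n}"
    by (simp add: bij_betw_def endo_inj_surj)
  moreover have "\<tau> i = i" if "i \<notin> {0..<n}" for i using that ad by (auto simp: \<tau>_def n_def)
  ultimately have perm: "\<tau> permutes {0..<n}" by (intro bij_imp_permutes) auto
  have A: "A \<in> carrier_mat n n" by (simp add: A_def coeff_mat_def)
  define B where "B = mat n n (\<lambda>(i, c). A $$ (\<tau> i, c))"
  define T where "T = mat n n (\<lambda>(i, c). if c < i then 0 else B $$ (i, c))"
  have B: "det B = signof \<tau> * det A" unfolding B_def by (rule det_permute_rows[OF A perm])
  have entry: "B $$ (i, c) = (if i < d - a \<or> d - a + M \<le> i then (if i = c then 1 else 0)
     else if d + M - 1 - c \<ge> d - a + M - 1 - i then coeff G (d + M - 1 - c - (d - a + M - 1 - i)) else 0)"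
    if "i < n" "c < n" for i c
  proof -
    have "\<tau> i < n" using permutes_in_image[OF perm, of i] that by simp
    then have "B $$ (i, c) = coeff (shift_rows M G (\<lambda>l. monom 1 (J l)) (\<tau> i)) (n - 1 - c)"
      using that by (simp add: B_def A_def coeff_mat_def)
    also have "\<dots> = (if i < d - a \<or> d - a + M \<le> i then (if i = c then 1 else 0)
     else if d + M - 1 - c \<ge> d - a + M - 1 - i then coeff G (d + M - 1 - c - (d - a + M - 1 - i)) else 0)"
    proof -
      consider "i < d - a" | "d - a \<le> i" "i < d - a + M" | "d - a + M \<le> i" by linarith
      then show ?thesis
      proof cases
        case 1
        then show ?thesis using that ad by (auto simp: shift_rows_def \<tau>_def J_def n_def)
      next
        case 2
        then have "M - 1 - \<tau> i = d - a + M - 1 - i" "\<tau> i < M" "n - 1 - c = d + M - 1 - c"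
          using ad by (auto simp: \<tau>_def n_def)
        then show ?thesis using 2 by (simp add: shift_rows_def coeff_monom_mult)
      next
        case 3
        then have "\<tau> i = i" "\<not> i < M" unfolding \<tau>_def by auto
        moreover have "\<not> i - M < d - a" "d - 1 - (i - M) = n - 1 - i"
          using 3 that ad unfolding n_def by linarith+
        then have "J (i - M) = n - 1 - i" unfolding J_def by simp
        moreover have "(n - 1 - i = n - 1 - c) = (i = c)" using that unfolding n_def by linarith
        ultimately have "\<tau> i = i" "\<not> i < M" "J (i - M) = n - 1 - i" "(n - 1 - i = n - 1 - c) = (i = c)"
          by blast+
        then show ?thesis using 3 by (simp add: shift_rows_def)
      qed
    qed
    finally show ?thesis .
  qed
  have "[det B = det T] (mod p)"
  proof (rule cong_det)
    fix i c assume ic: "i < n" "c < n"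
    show "[B $$ (i, c) = T $$ (i, c)] (mod p)"
    proof (cases "c < i")
      case True
      then have "p dvd B $$ (i, c)" using entry[OF ic] ic ad above by (auto simp: n_def)
      then show ?thesis using True ic by (simp add: T_def cong_0_iff)
    qed (use ic in \<open>simp add: T_def\<close>)
  qed (auto simp: B_def T_def)
  moreover have "det T = (\<Prod>i<n. B $$ (i, i))"
  proof -
    have "det T = prod_list (diag_mat T)"
      by (rule det_upper_triangular[of _ n]) (auto simp: T_def)
    then show ?thesis
      unfolding diag_mat_def by (simp add: T_def prod.list_conv_set_nth lessThan_atLeast0)
  qed
  moreover have "\<not> p dvd (\<Prod>i<n. B $$ (i, i))"
  proof
    assume "p dvd (\<Prod>i<n. B $$ (i, i))"
    then obtain i where i: "i < n" "p dvd B $$ (i, i)" using p prime_dvd_prod_iff[of "{..<n}" p] by auto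
    have "B $$ (i, i) = 1 \<or> B $$ (i, i) = coeff G a"
      using entry[OF i(1) i(1)] i(1) ad by (auto simp: n_def)
    then show False using i a p not_prime_unit[of p] by auto
  qed
  ultimately have "\<not> p dvd det A"
    using B by (metis cong_dvd_iff dvd_mult)
  moreover have "J l < M + d" if "l < d" for l using that by (auto simp: J_def n_def)
  ultimately show ?thesis unfolding A_def n_def by blast
qed

text \<open>The product formula with a denominator saved at every prime: if multiplication by \<open>lam\<close> maps the
  classes of \<open>1, Y, \<dots>, Y^(L+d-1)\<close> modulo \<open>G\<close> to classes represented in degree below \<open>M + d\<close>, then
  \<open>lc(G)^(M-L) * N(lam)\<close> is an integer. Cramer's rule gives this up to division by the maximal minors
  of the shifts of \<open>G\<close>, which have no common prime factor as \<open>G\<close> is primitive.\<close>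

lemma norm_integral:
  fixes G :: "int poly" and ys lam :: "nat \<Rightarrow> complex"
  assumes d: "degree G = d" and G0: "G \<noteq> 0" and content: "content G = 1"
    and root: "\<And>c. c < d \<Longrightarrow> poly (of_int_poly G) (ys c) = 0" and inj: "inj_on ys {..<d}"
    and h: "\<And>j. j < L + d \<Longrightarrow> degree (h j) < M + d"
    and vals: "\<And>j c. j < L + d \<Longrightarrow> c < d \<Longrightarrow> poly (of_int_poly (h j)) (ys c) = lam c * ys c ^ j"
  shows "\<exists>u::int. of_int (lead_coeff G) ^ M * (\<Prod>c<d. lam c) = of_int u * of_int (lead_coeff G) ^ L"
proof -
  define D where "D = (of_int (lead_coeff G) :: complex)"
  have D0: "D \<noteq> 0" using G0 by (simp add: D_def)
  define q where "q = D ^ M * (\<Prod>c<d. lam c) / D ^ L"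
  have "q \<in> \<int>"
  proof (rule int_if_locally_integral)
    fix p :: int assume "prime p"
    from exists_minor_not_dvd[OF d G0 this content] obtain J where
      J: "\<And>l. l < d \<Longrightarrow> J l < L + d" and
      nd: "\<not> p dvd det (coeff_mat (L + d) (shift_rows L G (\<lambda>l. monom 1 (J l))))" (is "\<not> p dvd ?m") by blast
    define E where "E = det (coeff_mat (M + d) (shift_rows M G (\<lambda>l. h (J l))))"
    define Z where "Z = det (mat d d (\<lambda>(l, c). ys c ^ J l))"
    define V where "V = det (vander d ys)"
    have "of_int E * V = D ^ M * det (mat d d (\<lambda>(l, c). poly (of_int_poly (h (J l))) (ys c)))"
      unfolding E_def V_def D_def by (rule det_shift_rows[OF d G0 root]) (use h J in auto)
    also have "mat d d (\<lambda>(l, c). poly (of_int_poly (h (J l))) (ys c)) = mat d d (\<lambda>(l, c). lam c * ys c ^ J l)"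
      by (rule cong_mat) (use vals J in auto)
    also have "det \<dots> = (\<Prod>c<d. lam c) * Z" unfolding Z_def by (rule det_mult_cols)
    finally have E: "of_int E * V = D ^ M * (\<Prod>c<d. lam c) * Z" by simp
    have "of_int ?m * V = D ^ L * det (mat d d (\<lambda>(l, c). poly (of_int_poly (monom 1 (J l))) (ys c)))"
      unfolding V_def D_def by (rule det_shift_rows[OF d G0 root]) (use J in \<open>auto simp: degree_monom_eq\<close>)
    also have "mat d d (\<lambda>(l, c). poly (of_int_poly (monom 1 (J l))) (ys c)) = mat d d (\<lambda>(l, c). ys c ^ J l)"
      by (rule cong_mat) (auto simp: map_poly_monom poly_monom)
    finally have m: "of_int ?m * V = D ^ L * Z" unfolding Z_def .
    have V0: "V \<noteq> 0" unfolding V_def by (rule det_vander_nonzero[OF inj])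
    \<comment> \<open>\<open>Z\<close> may vanish, so it is eliminated by substitution; only
      \<open>V\<close> is cancelled.\<close>
    have "q * of_int ?m * V = q * D ^ L * Z" using m by (simp add: algebra_simps)
    also have "\<dots> = of_int E * V" using E D0 by (simp add: q_def)
    finally have "q * of_int ?m = of_int E" using V0 by simp
    then show "\<exists>m::int. \<not> p dvd m \<and> q * of_int m \<in> \<int>" using nd by auto
  qed
  then obtain u :: int where "q = of_int u" by (elim Ints_cases)
  then have "D ^ M * (\<Prod>c<d. lam c) = of_int u * D ^ L" using D0 by (simp add: q_def field_simps)
  then show ?thesis unfolding D_def by blast
qed

text \<open>The trivial bound would have 1 on the left. The power \<open>m\<close> is gained because
  the class of \<open>lam * Y^j\<close> has the representative \<open>mu * Y^(j - m)\<close> once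
  \<open>j >= m\<close>: then \<open>2m + d\<close> classes fit into degrees below
  \<open>N + m + d\<close>, so \<open>norm_integral\<close> applies with \<open>L = 2m\<close> and
  \<open>M = N + m\<close>. A nonzero integer has absolute value at least 1.\<close>

lemma norm_ge:
  fixes G lam mu :: "int poly" and ys :: "nat \<Rightarrow> complex"
  assumes G0: "G \<noteq> 0" and content: "content G = 1" and d: "degree G = d" "d > 0"
    and root: "\<And>c. c < d \<Longrightarrow> poly (of_int_poly G) (ys c) = 0" and inj: "inj_on ys {..<d}"
    and lam: "degree lam \<le> N" and mu: "degree mu \<le> N"
    and vals: "\<And>c. c < d \<Longrightarrow> poly (of_int_poly mu) (ys c) = poly (of_int_poly lam) (ys c) * ys c ^ m"
    and nz: "\<And>c. c < d \<Longrightarrow> poly (of_int_poly lam) (ys c) \<noteq> 0"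
  shows "\<bar>real_of_int (lead_coeff G)\<bar> ^ m \<le> \<bar>real_of_int (lead_coeff G)\<bar> ^ N * (\<Prod>c<d. cmod (poly (of_int_poly lam) (ys c)))"
proof (cases "m = 0")
  case True
  define h where "h j = lam * monom 1 j" for j
  have "\<exists>u::int. of_int (lead_coeff G) ^ N * (\<Prod>c<d. poly (of_int_poly lam) (ys c)) = of_int u * of_int (lead_coeff G) ^ 0"
  proof (rule norm_integral[OF d(1) G0 content root inj, where h = h])
    fix j assume "j < 0 + d"
    moreover have "degree (h j) \<le> N + j"
      unfolding h_def by (rule order_trans[OF degree_mult_le]) (use lam in \<open>simp add: degree_monom_eq\<close>)
    ultimately show "degree (h j) < N + d" by simp
  qed (auto simp: h_def of_int_poly_hom.hom_mult map_poly_monom poly_monom)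
  then obtain u :: int where u: "of_int (lead_coeff G) ^ N * (\<Prod>c<d. poly (of_int_poly lam) (ys c)) = of_int u" by auto
  then have "u \<noteq> 0" using nz G0 by auto
  then have "1 \<le> \<bar>u\<bar>" by simp
  then have "1 \<le> cmod (of_int u)" by (simp add: norm_of_int)
  also have "\<dots> = \<bar>real_of_int (lead_coeff G)\<bar> ^ N * (\<Prod>c<d. cmod (poly (of_int_poly lam) (ys c)))"
    unfolding u[symmetric] by (simp add: norm_mult norm_power prod_norm[symmetric])
  finally show ?thesis using True by simp
next
  case False
  define h where "h j = (if j < m then lam * monom 1 j else mu * monom 1 (j - m))" for j
  let ?D = "of_int (lead_coeff G)"
  have "\<exists>u::int. ?D ^ (N + m) * (\<Prod>c<d. poly (of_int_poly lam) (ys c)) = of_int u * ?D ^ (m + m)"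
  proof (rule norm_integral[OF d(1) G0 content root inj, where h = h])
    fix j assume j: "j < m + m + d"
    have "degree (lam * monom 1 j) \<le> N + j"
      by (rule order_trans[OF degree_mult_le]) (use lam in \<open>simp add: degree_monom_eq\<close>)
    moreover have "degree (mu * monom 1 (j - m)) \<le> N + (j - m)"
      by (rule order_trans[OF degree_mult_le]) (use mu in \<open>simp add: degree_monom_eq\<close>)
    ultimately show "degree (h j) < N + m + d" using j d(2) False by (auto simp: h_def)
  qed (auto simp: h_def of_int_poly_hom.hom_mult map_poly_monom poly_monom vals power_add[symmetric])
  then obtain u :: int where u: "?D ^ (N + m) * (\<Prod>c<d. poly (of_int_poly lam) (ys c)) = of_int u * ?D ^ (m + m)" by blast
  have "?D \<noteq> (0::complex)" using G0 by simp
  then have u': "?D ^ N * (\<Prod>c<d. poly (of_int_poly lam) (ys c)) = of_int u * ?D ^ m"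
    using u by (simp add: power_add)
  then have "u \<noteq> 0" using nz G0 by auto
  then have "1 \<le> \<bar>u\<bar>" by simp
  then have "1 \<le> cmod (of_int u)" by (simp add: norm_of_int)
  then have "cmod ?D ^ m \<le> cmod (of_int u * ?D ^ m)"
    by (simp add: norm_mult norm_power mult_le_cancel_right1)
  also have "\<dots> = cmod ?D ^ N * (\<Prod>c<d. cmod (poly (of_int_poly lam) (ys c)))"
    unfolding u'[symmetric] by (simp add: norm_mult norm_power prod_norm[symmetric])
  finally show ?thesis by simp
qed

lemma irreducible_int_poly_content:
  fixes G :: "int poly"
  assumes "irreducible G" "degree G > 0"
  shows "content G = 1"
proof -
  have "G = [:content G:] * primitive_part G" by simp
  from irreducibleD[OF assms(1) this] consider "is_unit [:content G:]" | "is_unit (primitive_part G)" by blast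
  then show ?thesis
  proof cases
    case 1
    then have "is_unit (content G)" by (simp add: is_unit_const_poly_iff)
    then show ?thesis by (metis is_unit_normalize normalize_content)
  next
    case 2
    then have "degree (primitive_part G) = 0" unfolding is_unit_poly_iff by (metis degree_pCons_0)
    then show ?thesis using assms(2) by simp
  qed
qed

text \<open>The resultant carries coprimality from the integers to the complex numbers: a gcd of
  degree 0 makes it nonzero, a common complex root makes it zero.\<close>

lemma irreducible_int_poly_dvd:
  fixes G f :: "int poly" and y :: complex
  assumes irr: "irreducible G" and G: "poly (of_int_poly G) y = 0" and f: "poly (of_int_poly f) y = 0"
    and deg: "degree G > 0"
  shows "G dvd f"
proof (rule ccontr)
  assume nd: "\<not> G dvd f"
  have "degree (gcd G f) = 0"
  proof -
    obtain k where k: "G = gcd G f * k" using gcd_dvd1 by blast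
    from irreducibleD[OF irr k] consider "is_unit (gcd G f)" | "is_unit k" by blast
    then show ?thesis
    proof cases
      case 1 then show ?thesis by (auto simp: is_unit_poly_iff)
    next
      case 2
      then have "G dvd gcd G f" using k by (metis dvd_refl mult_unit_dvd_iff)
      then show ?thesis using nd by (meson dvd_trans gcd_dvd2)
    qed
  qed
  then have "resultant G f \<noteq> 0" by (simp add: resultant_0_gcd)
  then have "resultant (of_int_poly G :: complex poly) (of_int_poly f) \<noteq> 0"
    by (simp add: of_int_hom.resultant_hom)
  then have "degree (gcd (of_int_poly G :: complex poly) (of_int_poly f)) = 0"
    by (simp add: resultant_0_gcd)
  moreover have "[:- y, 1:] dvd gcd (of_int_poly G) (of_int_poly f)"
    using G f by (simp add: poly_eq_0_iff_dvd)
  moreover have "gcd (of_int_poly G :: complex poly) (of_int_poly f) \<noteq> 0" using deg by auto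
  ultimately show False by (metis dvd_imp_degree_le degree_linear_power power_one_right not_one_le_zero)
qed

section \<open>The height of the points (1 + y : y : 1) for the roots y of an irreducible
  polynomial\<close>

lemma cross_product_parallel:
  fixes a b c a' b' c' X Y :: "'a::comm_ring_1"
  assumes "X * a + Y * b + c = 0" "X * a' + Y * b' + c' = 0"
  shows "b * c' - c * b' = (a * b' - b * a') * X" "c * a' - a * c' = (a * b' - b * a') * Y"
proof -
  have c: "c = - (X * a + Y * b)" "c' = - (X * a' + Y * b')"
    using assms by (metis add.inverse_unique minus_minus)+
  show "b * c' - c * b' = (a * b' - b * a') * X" "c * a' - a * c' = (a * b' - b * a') * Y"
    unfolding c by (simp_all add: algebra_simps)
qed

text \<open>The contribution of one complex embedding to the height of
  \<open>(1 + y : y : 1)\<close>, before taking logarithms. As 1, \<open>y\<close> and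
  \<open>-(1 + y)\<close> sum to 0, the three moduli are the sides of a triangle, which is used
  throughout.\<close>

definition tri_max :: "complex \<Rightarrow> real" where
  "tri_max y = max 1 (max (cmod y) (cmod (1 + y)))"

definition tri_min :: "complex \<Rightarrow> real" where
  "tri_min y = min 1 (min (cmod y) (cmod (1 + y)))"

lemma tri_max_ge: "1 \<le> tri_max y" "cmod y \<le> tri_max y" "cmod (1 + y) \<le> tri_max y"
  by (auto simp: tri_max_def)

lemma tri_max_cases: "tri_max y = 1 \<or> tri_max y = cmod y \<or> tri_max y = cmod (1 + y)"
  unfolding tri_max_def by linarith

lemma tri_max_pos: "0 < tri_max y" using tri_max_ge(1)[of y] by linarith

text \<open>The conjugates are enumerated because they index matrix columns and products. Later
  hypotheses speak of \<open>ys 0\<close> only; by irreducibility, polynomial identities there hold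
  at all conjugates.\<close>

locale irreducible_roots =
  fixes G :: "int poly" and ys :: "nat \<Rightarrow> complex"
  assumes irr: "irreducible G" and deg_pos: "degree G > 0"
    and inj: "inj_on ys {..<degree G}"
    and range: "ys ` {..<degree G} = {z. poly (of_int_poly G) z = 0}"

text \<open>Enumerating exactly \<open>degree G\<close> roots requires simple roots; at a double
  root \<open>G\<close> would divide its own derivative.\<close>

lemma ex_irreducible_roots:
  assumes irr: "irreducible G" and deg: "degree G > 0"
  shows "\<exists>ys. irreducible_roots G ys"
proof -
  let ?G = "of_int_poly G :: complex poly"
  have "rsquarefree ?G"
    unfolding rsquarefree_roots
  proof (intro allI notI, elim conjE)
    fix a assume a: "poly ?G a = 0" "poly (pderiv ?G) a = 0"
    have "poly (of_int_poly (pderiv G)) a = 0"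
      using a(2) by (simp add: of_int_hom.map_poly_pderiv)
    from irreducible_int_poly_dvd[OF irr a(1) this deg] have "G dvd pderiv G" .
    moreover have "pderiv G \<noteq> 0" using deg by (simp add: pderiv_eq_0_iff)
    ultimately have "degree G \<le> degree (pderiv G)" by (rule dvd_imp_degree_le)
    then show False using deg by (simp add: degree_pderiv)
  qed
  then have "card {z. poly ?G z = 0} = degree ?G"
    using rsquarefree_card_degree[of ?G] deg by fastforce
  moreover have "finite {z. poly ?G z = 0}" using deg by (intro poly_roots_finite) auto
  ultimately obtain ys where "bij_betw ys {0..<degree G} {z. poly ?G z = 0}"
    using ex_bij_betw_nat_finite[of "{z. poly ?G z = 0}"] by auto
  then have "irreducible_roots G ys"
    using irr deg by unfold_locales (auto simp: bij_betw_def lessThan_atLeast0)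
  then show ?thesis by blast
qed

context irreducible_roots
begin

abbreviation d where "d \<equiv> degree G"

lemma G0: "G \<noteq> 0" using deg_pos by auto

lemma root: "c < d \<Longrightarrow> poly (of_int_poly G) (ys c) = 0"
  using range by auto

lemma root_transfer:
  assumes "c < d" "c' < d" "poly (of_int_poly f) (ys c) = 0"
  shows "poly (of_int_poly f) (ys c') = 0"
proof -
  have "G dvd f" by (rule irreducible_int_poly_dvd[OF irr root[OF assms(1)] assms(3) deg_pos])
  then obtain k where "f = G * k" by (elim dvdE)
  then show ?thesis using root[OF assms(2)] by (simp add: of_int_poly_hom.hom_mult)
qed

lemma factorization:
  "(of_int_poly G :: complex poly) = smult (of_int (lead_coeff G)) (\<Prod>c<d. [:- ys c, 1:])"
proof (rule poly_eqI_degree_lead_coeff)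
  let ?Q = "(\<Prod>c<d. [:- ys c, 1:])"
  have dQ: "degree ?Q = d" by (subst degree_prod_eq_sum_degree) auto
  have lQ: "lead_coeff ?Q = 1" by (simp add: lead_coeff_prod)
  show "degree (of_int_poly G :: complex poly) \<le> d" by simp
  show "degree (smult (of_int (lead_coeff G)) ?Q) \<le> d" using dQ by simp
  show "coeff (of_int_poly G) d = coeff (smult (of_int (lead_coeff G)) ?Q) d"
    using dQ lQ by simp
  show "card (ys ` {..<d}) \<ge> d" using card_image[OF inj] by simp
  show "poly (of_int_poly G) z = poly (smult (of_int (lead_coeff G)) ?Q) z" if "z \<in> ys ` {..<d}" for z
    using that root by (auto simp: poly_prod intro!: prod_zero)
qed

lemma norm_prod_diff:
  "\<bar>real_of_int (lead_coeff G)\<bar> * (\<Prod>c<d. cmod (of_int z - ys c)) = \<bar>real_of_int (poly G z)\<bar>"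
proof -
  have "of_int (poly G z) = of_int (lead_coeff G) * (\<Prod>c<d. of_int z - ys c)"
    using arg_cong[OF factorization, of "\<lambda>p. poly p (of_int z)"] by (simp add: poly_prod)
  then have "cmod (of_int (poly G z)) = \<bar>real_of_int (lead_coeff G)\<bar> * (\<Prod>c<d. cmod (of_int z - ys c))"
    by (simp add: norm_mult prod_norm[symmetric])
  then show ?thesis by simp
qed

lemma norm_ge_root:
  fixes lam mu :: "int poly"
  assumes "degree lam \<le> N" "degree mu \<le> N"
    and "\<And>c. c < d \<Longrightarrow> poly (of_int_poly mu) (ys c) = poly (of_int_poly lam) (ys c) * ys c ^ m"
    and "c < d" "poly (of_int_poly lam) (ys c) \<noteq> 0"
  shows "\<bar>real_of_int (lead_coeff G)\<bar> ^ m \<le> \<bar>real_of_int (lead_coeff G)\<bar> ^ N * (\<Prod>c<d. cmod (poly (of_int_poly lam) (ys c)))"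
  by (rule norm_ge[OF G0 irreducible_int_poly_content[OF irr deg_pos] refl deg_pos root inj assms(1-3)])
     (use root_transfer assms(4,5) in blast)+

text \<open>This is the absolute logarithmic Weil height of \<open>(1 + y : y : 1)\<close>. As
  \<open>G\<close> is primitive, the leading coefficient collects the finite places, where
  \<open>1 + y\<close> never exceeds the maximum of 1 and \<open>y\<close>.\<close>

definition ht :: real where
  "ht = (ln \<bar>real_of_int (lead_coeff G)\<bar> + (\<Sum>c<d. ln (tri_max (ys c)))) / d"

lemma d_ht: "d * ht = ln \<bar>real_of_int (lead_coeff G)\<bar> + (\<Sum>c<d. ln (tri_max (ys c)))"
  using deg_pos by (simp add: ht_def)

lemma abs_lead_ge1: "1 \<le> \<bar>real_of_int (lead_coeff G)\<bar>"
proof -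
  have "lead_coeff G \<noteq> 0" using G0 by simp
  then have "1 \<le> \<bar>lead_coeff G\<bar>" by linarith
  then show ?thesis by linarith
qed

lemma ht_nonneg: "0 \<le> ht"
  unfolding ht_def using abs_lead_ge1 tri_max_ge(1) by (intro divide_nonneg_nonneg add_nonneg_nonneg sum_nonneg ln_ge_zero) auto

text \<open>Two integral relations orthogonal to the vector \<open>((1+y)^m, y^m, 1)\<close> determine it projectively
  through their cross product; the product formula then bounds its height.\<close>

lemma ht_bound_of_relations:
  fixes a b c a' b' c' :: "int poly" and \<kappa> :: real
  defines "ev \<equiv> (\<lambda>p i. poly (of_int_poly p) (ys i) :: complex)"
  assumes deg: "degree a \<le> N1" "degree b \<le> N1" "degree c \<le> N1" "degree a' \<le> N2" "degree b' \<le> N2" "degree c' \<le> N2"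
    and rel: "\<And>i. i < d \<Longrightarrow> (1 + ys i) ^ m * ev a i + ys i ^ m * ev b i + ev c i = 0"
    and rel': "\<And>i. i < d \<Longrightarrow> (1 + ys i) ^ m * ev a' i + ys i ^ m * ev b' i + ev c' i = 0"
    and bound: "\<And>i. i < d \<Longrightarrow> cmod (ev b i * ev c' i - ev c i * ev b' i) \<le> \<kappa> * tri_max (ys i) ^ (N1 + N2)"
      "\<And>i. i < d \<Longrightarrow> cmod (ev c i * ev a' i - ev a i * ev c' i) \<le> \<kappa> * tri_max (ys i) ^ (N1 + N2)"
      "\<And>i. i < d \<Longrightarrow> cmod (ev a i * ev b' i - ev b i * ev a' i) \<le> \<kappa> * tri_max (ys i) ^ (N1 + N2)"
    and \<kappa>: "\<kappa> > 0"
    and nz: "i0 < d" "ev a i0 * ev b' i0 \<noteq> ev b i0 * ev a' i0"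
  shows "(real m - real (N1 + N2)) * ht \<le> ln \<kappa>"
proof -
  define lam where "lam = a * b' - b * a'"
  define mu where "mu = c * a' - a * c'"
  let ?N = "N1 + N2"
  let ?D = "\<bar>real_of_int (lead_coeff G)\<bar>"
  have ev_lam: "poly (of_int_poly lam) (ys i) = ev a i * ev b' i - ev b i * ev a' i" for i
    by (simp add: lam_def ev_def of_int_poly_hom.hom_minus of_int_poly_hom.hom_mult)
  have ev_mu: "poly (of_int_poly mu) (ys i) = ev c i * ev a' i - ev a i * ev c' i" for i
    by (simp add: mu_def ev_def of_int_poly_hom.hom_minus of_int_poly_hom.hom_mult)
  have dm: "degree (p * p') \<le> ?N" if "degree p \<le> N1" "degree p' \<le> N2" for p p' :: "int poly"
    using degree_mult_le[of p p'] that by linarith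
  have dl: "degree lam \<le> ?N" unfolding lam_def by (intro degree_diff_le dm deg)
  have dmu: "degree mu \<le> ?N" unfolding mu_def by (intro degree_diff_le dm deg)
  have y: "poly (of_int_poly mu) (ys i) = poly (of_int_poly lam) (ys i) * ys i ^ m" if "i < d" for i
    unfolding ev_lam ev_mu by (rule cross_product_parallel(2)[OF rel[OF that] rel'[OF that]])
  have x: "ev b i * ev c' i - ev c i * ev b' i = poly (of_int_poly lam) (ys i) * (1 + ys i) ^ m" if "i < d" for i
    unfolding ev_lam by (rule cross_product_parallel(1)[OF rel[OF that] rel'[OF that]])
  have nz_all: "poly (of_int_poly lam) (ys i) \<noteq> 0" if "i < d" for i
    using root_transfer[OF that nz(1), of lam] nz(2) ev_lam by auto
  have le: "?D ^ m \<le> ?D ^ ?N * (\<Prod>c<d. cmod (poly (of_int_poly lam) (ys c)))"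
    by (rule norm_ge_root[OF dl dmu y nz(1) nz_all[OF nz(1)]])
  have each: "ln (cmod (poly (of_int_poly lam) (ys i))) \<le> ln \<kappa> + (real ?N - real m) * ln (tri_max (ys i))"
    if "i < d" for i
  proof -
    let ?l = "cmod (poly (of_int_poly lam) (ys i))" and ?M = "tri_max (ys i)"
    \<comment> \<open>The maximum is attained at one of the three coordinates. \<open>lam\<close>
      times the \<open>m\<close>-th power of that coordinate is an entry of the cross product, and
      the bound for this entry applies.\<close>
    consider "?M = 1" | "?M = cmod (ys i)" | "?M = cmod (1 + ys i)" using tri_max_cases by blast
    then have "?l * ?M ^ m \<le> \<kappa> * ?M ^ ?N"
    proof cases
      case 1 then show ?thesis using bound(3)[OF that] by (simp add: ev_lam)
    next
      case 2 then show ?thesis using bound(2)[OF that] unfolding ev_mu[symmetric] y[OF that]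
        by (simp add: norm_mult norm_power)
    next
      case 3 then show ?thesis using bound(1)[OF that] unfolding x[OF that]
        by (simp add: norm_mult norm_power)
    qed
    moreover have "0 < ?l" using nz_all[OF that] by simp
    ultimately have "ln (?l * ?M ^ m) \<le> ln (\<kappa> * ?M ^ ?N)"
      using tri_max_pos[of "ys i"] \<kappa> by (subst ln_le_cancel_iff) auto
    then have "ln ?l + m * ln ?M \<le> ln \<kappa> + ?N * ln ?M"
      using \<open>0 < ?l\<close> tri_max_pos[of "ys i"] \<kappa> by (simp add: ln_mult ln_realpow)
    then show ?thesis by (simp add: algebra_simps)
  qed
  have "0 < ?D" using abs_lead_ge1 by linarith
  moreover define P where "P = (\<Prod>c<d. cmod (poly (of_int_poly lam) (ys c)))"
  moreover have "0 < P" unfolding P_def using nz_all by (intro prod_pos) auto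
  ultimately have "ln (?D ^ m) \<le> ln (?D ^ ?N * P)"
    using le by (subst ln_le_cancel_iff) auto
  then have "m * ln ?D \<le> ?N * ln ?D + ln P"
    using \<open>0 < ?D\<close> \<open>0 < P\<close> by (simp add: ln_mult ln_realpow)
  then have "m * ln ?D \<le> ?N * ln ?D + ln (\<Prod>c<d. cmod (poly (of_int_poly lam) (ys c)))"
    unfolding P_def .
  also have "ln (\<Prod>c<d. cmod (poly (of_int_poly lam) (ys c))) = (\<Sum>c<d. ln (cmod (poly (of_int_poly lam) (ys c))))"
    using nz_all by (intro ln_prod) auto
  also have "\<dots> \<le> (\<Sum>c<d. ln \<kappa> + (real ?N - real m) * ln (tri_max (ys c)))"
    by (rule sum_mono) (use each in auto)
  also have "\<dots> = d * ln \<kappa> + (real ?N - real m) * (\<Sum>c<d. ln (tri_max (ys c)))"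
    by (simp add: sum.distrib sum_distrib_left)
  finally have "(real m - real ?N) * (d * ht) \<le> d * ln \<kappa>"
    unfolding d_ht by (simp add: algebra_simps)
  then have "d * ((real m - real ?N) * ht) \<le> d * ln \<kappa>" by (simp add: algebra_simps)
  then show ?thesis using deg_pos by simp
qed

end

section \<open>Lower bounds for the height\<close>

text \<open>For \<open>u + v + w = 0\<close> the quantity \<open>u^2 + uw + w^2\<close> is minus the second elementary symmetric
  function. With \<open>c = 2 Re (u cnj w)\<close> the claim becomes \<open>(c + |u|^2) (c + |w|^2) \<le> 0\<close>.\<close>

lemma norm_quadratic_form_le:
  fixes u w :: complex
  assumes "cmod w \<le> cmod u" "cmod w \<le> cmod (u + w)" "cmod (u + w) \<le> cmod u"
  shows "cmod (u\<^sup>2 + u * w + w\<^sup>2) \<le> (cmod u)\<^sup>2 - (cmod w)\<^sup>2"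
proof -
  define a where "a = (cmod u)\<^sup>2"
  define b where "b = (cmod w)\<^sup>2"
  define c where "c = 2 * (Re u * Re w + Im u * Im w)"
  have ab: "b \<le> a" unfolding a_def b_def using assms(1) by (simp add: power_mono)
  have uw: "(cmod (u + w))\<^sup>2 = a + b + c"
    unfolding a_def b_def c_def cmod_power2 by (simp add: power2_eq_square algebra_simps)
  have "b \<le> (cmod (u + w))\<^sup>2" unfolding b_def using assms(2) by (simp add: power_mono)
  then have c1: "0 \<le> c + a" unfolding uw by simp
  have "(cmod (u + w))\<^sup>2 \<le> a" unfolding a_def using assms(3) by (simp add: power_mono)
  then have c2: "c + b \<le> 0" unfolding uw by simp
  have "(cmod (u\<^sup>2 + u * w + w\<^sup>2))\<^sup>2 = a\<^sup>2 - a * b + b\<^sup>2 + c * (a + b) + c\<^sup>2"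
    unfolding a_def b_def c_def cmod_power2
    by (simp add: power2_eq_square algebra_simps)
  also have "\<dots> = (a - b)\<^sup>2 + (c + a) * (c + b)" by (simp add: power2_eq_square algebra_simps)
  also have "\<dots> \<le> (a - b)\<^sup>2" using mult_nonneg_nonpos[OF c1 c2] by simp
  finally have "cmod (u\<^sup>2 + u * w + w\<^sup>2) \<le> a - b"
    by (rule power2_le_imp_le) (use ab in simp)
  then show ?thesis unfolding a_def b_def .
qed

lemma tri_min_nonneg: "0 \<le> tri_min y" by (simp add: tri_min_def)

lemma tri_min_le_max: "tri_min y \<le> tri_max y" unfolding tri_min_def tri_max_def by linarith

lemma tri_cases:
  obtains "tri_min y = 1" "tri_max y = cmod y" | "tri_min y = 1" "tri_max y = cmod (1 + y)"
    | "tri_min y = cmod y" "tri_max y = 1" | "tri_min y = cmod y" "tri_max y = cmod (1 + y)"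
    | "tri_min y = cmod (1 + y)" "tri_max y = 1" | "tri_min y = cmod (1 + y)" "tri_max y = cmod y"
proof (cases "tri_min y = tri_max y")
  case True
  then have "cmod y = 1" "cmod (1 + y) = 1" unfolding tri_min_def tri_max_def by linarith+
  then show ?thesis using that(1) by (simp add: tri_min_def tri_max_def)
next
  case False
  then show ?thesis using that unfolding tri_min_def tri_max_def by argo
qed

lemma tri_between:
  "tri_min y \<le> 1" "tri_min y \<le> cmod y" "tri_min y \<le> cmod (1 + y)"
  "1 \<le> tri_max y" "cmod y \<le> tri_max y" "cmod (1 + y) \<le> tri_max y"
  by (auto simp: tri_min_def tri_max_def)

lemma norm_esym2_le:
  fixes u v w :: complex
  assumes "u + v + w = 0" "cmod w \<le> cmod v" "cmod v \<le> cmod u"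
  shows "cmod (u * v + v * w + w * u) \<le> (cmod u)\<^sup>2 - (cmod w)\<^sup>2"
proof -
  have v: "v = - (u + w)" using assms(1) by (simp add: eq_neg_iff_add_eq_0 algebra_simps)
  have "u * v + v * w + w * u = - (u\<^sup>2 + u * w + w\<^sup>2)"
    unfolding v by (simp add: power2_eq_square algebra_simps)
  moreover have "cmod v = cmod (u + w)" unfolding v by (rule norm_minus_cancel)
  ultimately show ?thesis using norm_quadratic_form_le[of w u] assms(2,3)
    by (simp only: norm_minus_cancel)
qed

text \<open>The form is, up to sign, the second elementary symmetric function of 1, \<open>y\<close>
  and \<open>-(1 + y)\<close>. By symmetry the six cases merely sort the sides.\<close>

lemma norm_cyclotomic3_le: "cmod (y\<^sup>2 + y + 1) \<le> (tri_max y)\<^sup>2 - (tri_min y)\<^sup>2"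
proof -
  have *: "cmod (y\<^sup>2 + y + 1) \<le> (cmod u)\<^sup>2 - (cmod w)\<^sup>2"
    if "u * v + v * w + w * u = - (y\<^sup>2 + y + 1)" "u + v + w = 0" "cmod w \<le> cmod v" "cmod v \<le> cmod u" for u v w
    using norm_esym2_le[OF that(2-4)] unfolding that(1) norm_minus_cancel .
  show ?thesis
  proof (cases rule: tri_cases[of y])
    case 1 then show ?thesis using *[of "- y" "1 + y" "- 1"] tri_between[of y] by (simp add: power2_eq_square algebra_simps)
  next
    case 2 then show ?thesis using *[of "1 + y" "- y" "- 1"] tri_between[of y] by (simp add: power2_eq_square algebra_simps)
  next
    case 3 then show ?thesis using *[of "- 1" "1 + y" "- y"] tri_between[of y] by (simp add: power2_eq_square algebra_simps)
  next
    case 4 then show ?thesis using *[of "1 + y" "- 1" "- y"] tri_between[of y] by (simp add: power2_eq_square algebra_simps)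
  next
    case 5 then show ?thesis using *[of "- 1" "- y" "1 + y"] tri_between[of y] by (simp add: power2_eq_square algebra_simps)
  next
    case 6 then show ?thesis using *[of "- y" "- 1" "1 + y"] tri_between[of y] by (simp add: power2_eq_square algebra_simps)
  qed
qed

lemma norm_triple_product_le: "cmod y * cmod (1 + y) \<le> tri_min y * (tri_max y)\<^sup>2"
proof -
  have "x * z \<le> min 1 (min x z) * (max 1 (max x z))\<^sup>2" if "0 \<le> x" "0 \<le> z" for x z :: real
  proof -
    have *: "p * q * r \<le> p * (max p (max q r))\<^sup>2" if "0 \<le> p" "0 \<le> q" "0 \<le> r" for p q r :: real
    proof -
      have "q \<le> max p (max q r)" "r \<le> max p (max q r)" by auto
      then have "q * r \<le> (max p (max q r)) * (max p (max q r))" using that by (intro mult_mono) linarith+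
      then show ?thesis using that by (simp add: power2_eq_square mult.assoc mult_left_mono)
    qed
    consider "min 1 (min x z) = 1" | "min 1 (min x z) = x" | "min 1 (min x z) = z" by linarith
    then show ?thesis
    proof cases
      case 1 then show ?thesis using *[of 1 x z] that by simp
    next
      case 2 then show ?thesis using *[of x 1 z] that by (simp add: max.left_commute)
    next
      case 3 then show ?thesis using *[of z 1 x] that by (simp add: max.left_commute max.commute mult.commute)
    qed
  qed
  then show ?thesis by (simp add: tri_min_def tri_max_def)
qed

text \<open>The constant is the maximum of \<open>t (1 - t^2)\<close>, attained at \<open>t = 1 / sqrt 3\<close>.\<close>

lemma norm_height_form_le:
  "(cmod y * cmod (1 + y) * cmod (y\<^sup>2 + y + 1))\<^sup>2 \<le> 4/27 * tri_max y ^ 10"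
proof -
  define m where "m = tri_min y"
  define M where "M = tri_max y"
  have m: "0 \<le> m" "m \<le> M" and M: "0 < M"
    using tri_min_nonneg tri_min_le_max tri_max_pos by (auto simp: m_def M_def)
  have "cmod y * cmod (1 + y) * cmod (y\<^sup>2 + y + 1) \<le> (m * M\<^sup>2) * (M\<^sup>2 - m\<^sup>2)"
    unfolding m_def M_def
    by (rule mult_mono[OF norm_triple_product_le norm_cyclotomic3_le]) (auto simp: tri_min_nonneg)
  then have "(cmod y * cmod (1 + y) * cmod (y\<^sup>2 + y + 1))\<^sup>2 \<le> ((m * M\<^sup>2) * (M\<^sup>2 - m\<^sup>2))\<^sup>2"
    by (intro power_mono) auto
  also have "\<dots> = M^4 * (m\<^sup>2 * (M\<^sup>2 - m\<^sup>2)\<^sup>2)" by (simp add: power_mult_distrib)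
  \<comment> \<open>With \<open>t = m^2\<close>, the polynomial \<open>t (M^2 - t)^2\<close> has its
    maximum \<open>4/27 * M^6\<close> at \<open>t = M^2/3\<close>; the difference therefore has a
    double zero there.\<close>
  also have "m\<^sup>2 * (M\<^sup>2 - m\<^sup>2)\<^sup>2 = 4/27 * M^6 - (m\<^sup>2 - M\<^sup>2/3)\<^sup>2 * (4/3 * M\<^sup>2 - m\<^sup>2)"
    by (simp add: power2_eq_square field_simps eval_nat_numeral)
  also have "M^4 * \<dots> \<le> M^4 * (4/27 * M^6)"
  proof -
    have "m\<^sup>2 \<le> M\<^sup>2" using m by (simp add: power_mono)
    moreover have "0 \<le> M\<^sup>2" by simp
    ultimately have "0 \<le> 4/3 * M\<^sup>2 - m\<^sup>2" by linarith
    then have "0 \<le> (m\<^sup>2 - M\<^sup>2/3)\<^sup>2 * (4/3 * M\<^sup>2 - m\<^sup>2)" by simp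
    then show ?thesis by (intro mult_left_mono) auto
  qed
  also have "\<dots> = 4/27 * M^10" by (simp add: power_add[symmetric])
  finally show ?thesis unfolding M_def .
qed

lemma ln_prod_norm:
  assumes "\<And>c. c < n \<Longrightarrow> f c \<noteq> 0"
  shows "ln (\<Prod>c<n. cmod (f c)) = (\<Sum>c<(n::nat). ln (cmod (f c)))"
  by (rule ln_prod) (use assms in auto)

context irreducible_roots
begin

text \<open>\<open>1/10 * ln (27/4)\<close> is the infimum of the height on the line \<open>x - y = 1\<close> that the auxiliary
  form \<open>xy (x^2 - xy + y^2)\<close> yields; the last summand measures the failure of \<open>y\<close> and \<open>1 + y\<close> to be units.\<close>

lemma ht_ge:
  assumes y0: "ys 0 \<noteq> 0" "1 + ys 0 \<noteq> 0" "(ys 0)\<^sup>2 + ys 0 + 1 \<noteq> 0"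
  shows "ln (27/4) / 10 + ln \<bar>real_of_int (lead_coeff G * poly G 0 * poly G (-1))\<bar> / (5 * d) \<le> ht"
proof -
  let ?D = "\<bar>real_of_int (lead_coeff G)\<bar>"
  define q :: "int poly" where "q = [:1, 1, 1:]"
  have evq: "poly (of_int_poly q) z = z\<^sup>2 + z + 1" for z :: complex
    by (simp add: q_def algebra_simps power2_eq_square)
  have i0: "0 < d" by (rule deg_pos)
  have q: "?D ^ 0 \<le> ?D ^ 2 * (\<Prod>c<d. cmod (poly (of_int_poly q) (ys c)))"
  proof (rule norm_ge_root[where mu = q and c = 0])
    show "poly (of_int_poly q) (ys 0) \<noteq> 0" using y0 by (simp only: evq not_False_eq_True)
  qed (use i0 in \<open>simp_all add: q_def\<close>)
  have nz: "ys c \<noteq> 0" "1 + ys c \<noteq> 0" "(ys c)\<^sup>2 + ys c + 1 \<noteq> 0" if "c < d" for c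
  proof -
    show "ys c \<noteq> 0" using root_transfer[OF that i0, of "[:0,1:]"] y0 by auto
    show "1 + ys c \<noteq> 0" using root_transfer[OF that i0, of "[:1,1:]"] y0 by auto
    show "(ys c)\<^sup>2 + ys c + 1 \<noteq> 0" using root_transfer[OF that i0, of q] y0 unfolding evq by blast
  qed
  have D: "?D > 0" using abs_lead_ge1 by linarith
  \<comment> \<open>The norms of \<open>y\<close> and \<open>1 + y\<close> are kept exactly, as
    values of \<open>G\<close> at 0 and -1 divided by the leading coefficient. This produces the
    last summand of the claim.\<close>
  have P1: "?D * (\<Prod>c<d. cmod (ys c)) = \<bar>real_of_int (poly G 0)\<bar>"
    using norm_prod_diff[of 0] by simp
  have "cmod (of_int (- 1) - ys c) = cmod (1 + ys c)" for c
  proof -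
    have "of_int (- 1) - ys c = - (1 + ys c)" by simp
    then show ?thesis by (metis norm_minus_cancel)
  qed
  then have P2: "?D * (\<Prod>c<d. cmod (1 + ys c)) = \<bar>real_of_int (poly G (-1))\<bar>"
    using norm_prod_diff[of "-1"] by simp
  have pos: "0 < (\<Prod>c<d. cmod (ys c))" "0 < (\<Prod>c<d. cmod (1 + ys c))"
     "0 < (\<Prod>c<d. cmod ((ys c)\<^sup>2 + ys c + 1))"
    using nz by (auto intro!: prod_pos)
  have l1: "ln \<bar>real_of_int (poly G 0)\<bar> = ln ?D + (\<Sum>c<d. ln (cmod (ys c)))"
    unfolding P1[symmetric] ln_mult_pos[OF D pos(1)] by (simp only: ln_prod_norm[OF nz(1)])
  have l2: "ln \<bar>real_of_int (poly G (-1))\<bar> = ln ?D + (\<Sum>c<d. ln (cmod (1 + ys c)))"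
    unfolding P2[symmetric] ln_mult_pos[OF D pos(2)] by (simp only: ln_prod_norm[OF nz(2)])
  have "ln 1 \<le> ln (?D ^ 2 * (\<Prod>c<d. cmod ((ys c)\<^sup>2 + ys c + 1)))"
    using q unfolding evq using D pos(3) by (subst ln_le_cancel_iff) auto
  then have l3: "0 \<le> 2 * ln ?D + (\<Sum>c<d. ln (cmod ((ys c)\<^sup>2 + ys c + 1)))"
    unfolding ln_mult_pos[OF zero_less_power[OF D] pos(3)] ln_realpow
    using ln_prod_norm[of d "\<lambda>c. (ys c)\<^sup>2 + ys c + 1"] nz(3) by simp
  have each: "ln (cmod (ys c)) + ln (cmod (1 + ys c)) + ln (cmod ((ys c)\<^sup>2 + ys c + 1))
      \<le> 5 * ln (tri_max (ys c)) - ln (27/4) / 2" if "c < d" for c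
  proof -
    let ?p = "cmod (ys c) * cmod (1 + ys c) * cmod ((ys c)\<^sup>2 + ys c + 1)"
    have p: "0 < ?p" using nz[OF that] by auto
    have "ln (?p\<^sup>2) \<le> ln (4/27 * tri_max (ys c) ^ 10)"
      using norm_height_form_le[of "ys c"] p tri_max_pos[of "ys c"] by (subst ln_le_cancel_iff) auto
    moreover have "ln (4/27 * tri_max (ys c) ^ 10) = - ln (27/4) + 10 * ln (tri_max (ys c))"
      using tri_max_pos[of "ys c"] by (simp add: ln_mult ln_realpow ln_div)
    moreover have "ln (?p\<^sup>2) = 2 * (ln (cmod (ys c)) + ln (cmod (1 + ys c)) + ln (cmod ((ys c)\<^sup>2 + ys c + 1)))"
      using nz[OF that] by (simp add: ln_realpow ln_mult)
    ultimately show ?thesis by simp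
  qed
  have "(\<Sum>c<d. ln (cmod (ys c)) + ln (cmod (1 + ys c)) + ln (cmod ((ys c)\<^sup>2 + ys c + 1)))
      \<le> (\<Sum>c<d. 5 * ln (tri_max (ys c)) - ln (27/4) / 2)"
    by (rule sum_mono) (use each in auto)
  then have S: "(\<Sum>c<d. ln (cmod (ys c))) + (\<Sum>c<d. ln (cmod (1 + ys c))) + (\<Sum>c<d. ln (cmod ((ys c)\<^sup>2 + ys c + 1)))
      \<le> 5 * (\<Sum>c<d. ln (tri_max (ys c))) - d * (ln (27/4) / 2)"
    by (simp add: sum.distrib sum_subtractf sum_distrib_left)
  have "0 < \<bar>real_of_int (poly G 0)\<bar>" unfolding P1[symmetric] by (rule mult_pos_pos[OF D pos(1)])
  moreover have "0 < \<bar>real_of_int (poly G (-1))\<bar>" unfolding P2[symmetric] by (rule mult_pos_pos[OF D pos(2)])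
  ultimately have "poly G 0 \<noteq> 0" "poly G (-1) \<noteq> 0" by simp_all
  then have "ln \<bar>real_of_int (lead_coeff G * poly G 0 * poly G (-1))\<bar> =
      ln ?D + ln \<bar>real_of_int (poly G 0)\<bar> + ln \<bar>real_of_int (poly G (-1))\<bar>"
    using D by (simp add: abs_mult ln_mult)
  also have "\<dots> \<le> 5 * (d * ht) - d * (ln (27/4) / 2)"
  proof -
    have "D + (D + a) + (D + b) \<le> 5 * (D + s) - e" if "0 \<le> 2 * D + c" "a + b + c \<le> 5 * s - e"
      for D a b c s e :: real using that by simp
    from this[OF l3 S] show ?thesis unfolding l1 l2 d_ht .
  qed
  finally have E: "ln \<bar>real_of_int (lead_coeff G * poly G 0 * poly G (-1))\<bar> \<le> 5 * (d * ht) - d * (ln (27/4) / 2)" .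
  have "l / 10 + R / (5 * n) \<le> h" if "R \<le> 5 * (n * h) - n * (l / 2)" "0 < n" for l R n h :: real
  proof -
    have "R / (5 * n) \<le> (5 * (n * h) - n * (l / 2)) / (5 * n)"
      using that by (intro divide_right_mono) auto
    also have "\<dots> = h - l / 10" using that(2) by (simp add: diff_divide_distrib)
    finally show ?thesis by simp
  qed
  from this[OF E] show ?thesis using i0 by simp
qed

text \<open>A lower bound \<open>1/\<theta>\<close> for the side ratio of all the triangles \<open>(1, y, 1 + y)\<close> bounds the form
  \<open>y^2 + y + 1\<close>, hence the height.\<close>

lemma ht_ge_of_ratio:
  assumes y0: "(ys 0)\<^sup>2 + ys 0 + 1 \<noteq> 0" and \<theta>: "\<theta> > 1"
    and ratio: "\<And>c. c < d \<Longrightarrow> tri_max (ys c) \<le> \<theta> * tri_min (ys c)"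
  shows "- ln (1 - 1 / \<theta>\<^sup>2) / 2 \<le> ht"
proof -
  let ?D = "\<bar>real_of_int (lead_coeff G)\<bar>"
  define q :: "int poly" where "q = [:1, 1, 1:]"
  have evq: "poly (of_int_poly q) z = z\<^sup>2 + z + 1" for z :: complex
    by (simp add: q_def algebra_simps power2_eq_square)
  have i0: "0 < d" by (rule deg_pos)
  have q: "?D ^ 0 \<le> ?D ^ 2 * (\<Prod>c<d. cmod (poly (of_int_poly q) (ys c)))"
  proof (rule norm_ge_root[where mu = q and c = 0])
    show "poly (of_int_poly q) (ys 0) \<noteq> 0" using y0 by (simp only: evq not_False_eq_True)
  qed (use i0 in \<open>simp_all add: q_def\<close>)
  have nz: "(ys c)\<^sup>2 + ys c + 1 \<noteq> 0" if "c < d" for c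
    using root_transfer[OF that i0, of q] y0 unfolding evq by blast
  have D: "?D > 0" using abs_lead_ge1 by linarith
  have pos: "0 < (\<Prod>c<d. cmod ((ys c)\<^sup>2 + ys c + 1))" using nz by (auto intro!: prod_pos)
  have "ln 1 \<le> ln (?D ^ 2 * (\<Prod>c<d. cmod ((ys c)\<^sup>2 + ys c + 1)))"
    using q unfolding evq using D pos by (subst ln_le_cancel_iff) auto
  then have l3: "0 \<le> 2 * ln ?D + (\<Sum>c<d. ln (cmod ((ys c)\<^sup>2 + ys c + 1)))"
    unfolding ln_mult_pos[OF zero_less_power[OF D] pos] ln_realpow
    using ln_prod_norm[of d "\<lambda>c. (ys c)\<^sup>2 + ys c + 1"] nz by simp
  have t: "0 < 1 - 1 / \<theta>\<^sup>2" using \<theta> by (simp add: power2_eq_square less_1_mult)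
  have each: "ln (cmod ((ys c)\<^sup>2 + ys c + 1)) \<le> 2 * ln (tri_max (ys c)) + ln (1 - 1 / \<theta>\<^sup>2)" if "c < d" for c
  proof -
    let ?M = "tri_max (ys c)"
    have "?M / \<theta> \<le> tri_min (ys c)" using ratio[OF that] \<theta> by (simp add: field_simps)
    then have "(?M / \<theta>)\<^sup>2 \<le> (tri_min (ys c))\<^sup>2" using tri_max_pos[of "ys c"] \<theta> by (intro power_mono) auto
    then have "cmod ((ys c)\<^sup>2 + ys c + 1) \<le> ?M\<^sup>2 * (1 - 1 / \<theta>\<^sup>2)"
      using norm_cyclotomic3_le[of "ys c"] by (simp add: power_divide algebra_simps)
    then have "ln (cmod ((ys c)\<^sup>2 + ys c + 1)) \<le> ln (?M\<^sup>2 * (1 - 1 / \<theta>\<^sup>2))"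
      using nz[OF that] tri_max_pos[of "ys c"] t by (subst ln_le_cancel_iff) auto
    also have "\<dots> = 2 * ln ?M + ln (1 - 1 / \<theta>\<^sup>2)"
      unfolding ln_mult_pos[OF zero_less_power[OF tri_max_pos] t] ln_realpow by simp
    finally show ?thesis .
  qed
  have "(\<Sum>c<d. ln (cmod ((ys c)\<^sup>2 + ys c + 1))) \<le> (\<Sum>c<d. 2 * ln (tri_max (ys c)) + ln (1 - 1 / \<theta>\<^sup>2))"
    by (rule sum_mono) (use each in auto)
  also have "\<dots> = 2 * (\<Sum>c<d. ln (tri_max (ys c))) + d * ln (1 - 1 / \<theta>\<^sup>2)"
    by (simp add: sum.distrib sum_distrib_left)
  finally have S: "(\<Sum>c<d. ln (cmod ((ys c)\<^sup>2 + ys c + 1)))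
      \<le> 2 * (\<Sum>c<d. ln (tri_max (ys c))) + d * ln (1 - 1 / \<theta>\<^sup>2)" .
  have "0 \<le> 2 * (d * ht) + d * ln (1 - 1 / \<theta>\<^sup>2)"
  proof -
    have "0 \<le> 2 * (D + s) + e" if "0 \<le> 2 * D + c" "c \<le> 2 * s + e" for D c s e :: real
      using that by simp
    from this[OF l3 S] show ?thesis unfolding d_ht .
  qed
  then have "0 \<le> d * (2 * ht + ln (1 - 1 / \<theta>\<^sup>2))" by (simp add: algebra_simps)
  then have "0 \<le> 2 * ht + ln (1 - 1 / \<theta>\<^sup>2)" using i0 by (simp add: zero_le_mult_iff)
  then show ?thesis by simp
qed

end

section \<open>Solutions of two Fermat equations do not give thin triangles\<close>

lemma norm_power_one_plus_minus_linear_le: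
  fixes a :: complex
  shows "cmod ((1 + a) ^ n - 1 - of_nat n * a) \<le> (1 + cmod a) ^ n - 1 - real n * cmod a"
proof (induction n)
  case (Suc n)
  have "(1 + a) ^ Suc n - 1 - of_nat (Suc n) * a = (1 + a) * ((1 + a) ^ n - 1 - of_nat n * a) + of_nat n * a\<^sup>2"
    by (simp add: power2_eq_square algebra_simps)
  also have "cmod \<dots> \<le> cmod (1 + a) * cmod ((1 + a) ^ n - 1 - of_nat n * a) + real n * (cmod a)\<^sup>2"
    by (rule order_trans[OF norm_triangle_ineq]) (simp add: norm_mult norm_power)
  also have "\<dots> \<le> (1 + cmod a) * ((1 + cmod a) ^ n - 1 - real n * cmod a) + real n * (cmod a)\<^sup>2"
    using Suc.IH norm_triangle_ineq[of 1 a] by (intro add_right_mono mult_mono) auto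
  also have "\<dots> = (1 + cmod a) ^ Suc n - 1 - real (Suc n) * cmod a"
    by (simp add: power2_eq_square algebra_simps)
  finally show ?case .
qed simp

lemma norm_power_one_plus_minus_one_le:
  fixes a :: complex
  shows "cmod ((1 + a) ^ n - 1) \<le> (1 + cmod a) ^ n - 1"
proof -
  have "cmod ((1 + a) ^ n - 1) = cmod (((1 + a) ^ n - 1 - of_nat n * a) + of_nat n * a)" by simp
  also have "\<dots> \<le> cmod ((1 + a) ^ n - 1 - of_nat n * a) + cmod (of_nat n * a)" by (rule norm_triangle_ineq)
  also have "\<dots> \<le> ((1 + cmod a) ^ n - 1 - real n * cmod a) + real n * cmod a"
    using norm_power_one_plus_minus_linear_le[of a n] by (simp add: norm_mult)
  finally show ?thesis by simp
qed

lemma power_one_plus_le_exp: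
  fixes x :: real
  assumes "0 \<le> x"
  shows "(1 + x) ^ n \<le> exp (real n * x)"
proof -
  have "(1 + x) ^ n \<le> exp x ^ n" using assms exp_ge_add_one_self[of x] by (intro power_mono) auto
  then show ?thesis by (simp add: exp_of_nat_mult)
qed

text \<open>Termwise comparison with the expansion of \<open>(1 + 1/r)^r \<le> e\<close>.\<close>

lemma power_one_plus_quadratic_bound:
  fixes x :: real
  assumes x: "0 \<le> x" "real r * x \<le> 1" and r: "0 < r"
  shows "(1 + x) ^ r \<le> 1 + real r * x + 4/5 * (real r * x)\<^sup>2"
proof -
  define t where "t = real r * x"
  have t: "0 \<le> t" "t \<le> 1" using x by (auto simp: t_def)
  \<comment> \<open>\<open>t^j <= t^2\<close> fails only for \<open>j = 0, 1\<close>, and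
    \<open>g\<close> makes up for these two terms. Summed with binomial weights it gives
    \<open>1 + t - 2 * t^2\<close>, so 4/5 arises as 14/5 - 2, where 14/5 bounds e.\<close>
  define g where "g j = (if j = 0 then 1 - t\<^sup>2 else if j = 1 then (t - t\<^sup>2) / r else 0)" for j :: nat
  have bnd: "x ^ j \<le> t\<^sup>2 * (1 / real r) ^ j + g j" for j
  proof -
    have xj: "x ^ j = t ^ j * (1 / real r) ^ j" using r by (simp add: t_def power_mult_distrib[symmetric])
    consider "j = 0" | "j = 1" | "2 \<le> j" by linarith
    then show ?thesis
    proof cases
      case 3
      then have "t ^ j \<le> t\<^sup>2" using t by (intro power_decreasing) auto
      then show ?thesis using 3 unfolding xj g_def by (simp add: mult_right_mono divide_right_mono)
    next
      case 2
      have "x = t / r" using r by (simp add: t_def)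
      then show ?thesis using 2 by (simp add: g_def diff_divide_distrib)
    qed (simp add: g_def)
  qed
  have "(1 + x) ^ r = (x + 1) ^ r" by (simp add: add.commute)
  also have "\<dots> = (\<Sum>j\<le>r. of_nat (r choose j) * x ^ j)" by (simp add: binomial_ring)
  also have "\<dots> \<le> (\<Sum>j\<le>r. of_nat (r choose j) * (t\<^sup>2 * (1 / real r) ^ j + g j))"
    by (intro sum_mono mult_left_mono bnd) auto
  also have "\<dots> = t\<^sup>2 * (\<Sum>j\<le>r. of_nat (r choose j) * (1 / real r) ^ j) + (\<Sum>j\<le>r. of_nat (r choose j) * g j)"
    by (simp add: distrib_left sum.distrib sum_distrib_left mult_ac)
  also have "(\<Sum>j\<le>r. of_nat (r choose j) * (1 / real r) ^ j) = (1 / real r + 1) ^ r"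
    by (simp add: binomial_ring)
  also have "(\<Sum>j\<le>r. of_nat (r choose j) * g j) = (\<Sum>j\<in>{0, 1}. of_nat (r choose j) * g j)"
    by (rule sum.mono_neutral_right) (use r in \<open>auto simp: g_def\<close>)
  also have "\<dots> = 1 - t\<^sup>2 + (t - t\<^sup>2)" using r by (simp add: g_def)
  finally have 1: "(1 + x) ^ r \<le> t\<^sup>2 * (1 / real r + 1) ^ r + (1 - t\<^sup>2 + (t - t\<^sup>2))" .
  have "(1 / real r + 1) ^ r \<le> exp (real r * (1 / real r))"
    using power_one_plus_le_exp[of "1 / real r" r] by (simp add: add.commute)
  also have "\<dots> = exp 1" using r by simp
  also have "\<dots> = exp (1/20) ^ 20" by (simp add: exp_of_nat_mult[symmetric])
  also have "\<dots> \<le> (1 + 1/20 + (1/20)\<^sup>2) ^ 20" by (intro power_mono exp_bound) auto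
  also have "\<dots> \<le> 14/5" by (simp add: power2_eq_square power_divide)
  finally have "t\<^sup>2 * (1 / real r + 1) ^ r \<le> t\<^sup>2 * (14/5)" by (intro mult_left_mono) auto
  then show ?thesis using 1 unfolding t_def[symmetric] by simp
qed

text \<open>If \<open>z\<close> were very small, then \<open>1 + z\<close> would be close both to an \<open>s\<close>-th and to an \<open>r\<close>-th root of
  unity up to sign; raising to the powers \<open>r\<close> and \<open>s\<close> leaves no room for the term \<open>r z^s\<close>.\<close>

lemma small_ratio_impossible:
  fixes z :: complex
  assumes z0: "z \<noteq> 0" and z1: "cmod z \<le> 1" and rs: "8 * s \<le> 5 * r" "18 \<le> r"
    and s: "c1\<^sup>2 = 1" "c2\<^sup>2 = 1" "(1 + z) ^ s = c1 * (1 + c2 * z ^ s)"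
    and r: "c3\<^sup>2 = 1" "c4\<^sup>2 = 1" "(1 + z) ^ r = c3 * (1 + c4 * z ^ r)"
  shows "1 \<le> real r * cmod z ^ s"
proof (rule ccontr)
  assume neg: "\<not> ?thesis"
  define \<delta> where "\<delta> = cmod z ^ s"
  define \<xi> where "\<xi> = real r * \<delta>"
  define u where "u = real s * cmod z ^ r"
  have r0: "0 < r" using rs by simp
  have \<delta>: "0 < \<delta>" using z0 by (simp add: \<delta>_def)
  then have \<xi>: "0 < \<xi>" "\<xi> < 1" using neg r0 by (auto simp: \<xi>_def \<delta>_def)
  have unit: "cmod c = 1" if "c\<^sup>2 = 1" for c :: complex
    using that by (metis norm_one norm_power power2_eq_1_iff norm_minus_cancel)
  have a: "cmod (c2 * z ^ s) = \<delta>" using unit[OF s(2)] by (simp add: norm_mult norm_power \<delta>_def)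
  have b: "cmod (c4 * z ^ r) = cmod z ^ r" using unit[OF r(2)] by (simp add: norm_mult norm_power)
  \<comment> \<open>\<open>8s <= 5r\<close> means \<open>5(r - s) >= 3s\<close>, so the fifth power
    of the left side is at most \<open>\<delta>^3\<close>, which is below 18^(-3) < 4^(-5).\<close>
  have small: "cmod z ^ (r - s) \<le> 1/4"
  proof (rule ccontr)
    assume "\<not> ?thesis"
    then have "(1/4) ^ 5 < (cmod z ^ (r - s)) ^ 5" by (intro power_strict_mono) auto
    also have "\<dots> = cmod z ^ ((r - s) * 5)" by (simp add: power_mult)
    also have "\<dots> \<le> cmod z ^ (s * 3)" using z1 rs by (intro power_decreasing) auto
    also have "\<dots> = \<delta> ^ 3" by (simp add: \<delta>_def power_mult)
    also have "\<delta> \<le> 1/18"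
    proof -
      have "18 * \<delta> \<le> \<xi>" unfolding \<xi>_def using rs \<delta> by (intro mult_right_mono) auto
      then show ?thesis using \<xi> by simp
    qed
    then have "\<delta> ^ 3 \<le> (1/18) ^ 3" using \<delta> by (intro power_mono) auto
    finally show False by (simp add: eval_nat_numeral)
  qed
  have u: "0 \<le> u" "u \<le> 5/32 * \<xi>"
  proof -
    show "0 \<le> u" by (simp add: u_def)
    have "cmod z ^ r = cmod z ^ (r - s) * \<delta>" using rs by (simp add: \<delta>_def power_add[symmetric])
    also have "\<dots> \<le> 1/4 * \<delta>" using small \<delta> by (intro mult_right_mono) auto
    finally have "u \<le> real s * (1/4 * \<delta>)" unfolding u_def by (intro mult_left_mono) auto
    also have "\<dots> \<le> (5/8 * real r) * (1/4 * \<delta>)" using rs \<delta> by (intro mult_right_mono) auto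
    finally show "u \<le> 5/32 * \<xi>" by (simp add: \<xi>_def)
  qed
  have B: "cmod ((1 + c4 * z ^ r) ^ s - 1) \<le> 37/32 * u"
  proof -
    have "cmod ((1 + c4 * z ^ r) ^ s - 1) \<le> (1 + cmod z ^ r) ^ s - 1"
      using norm_power_one_plus_minus_one_le[of "c4 * z ^ r" s] unfolding b .
    also have "(1 + cmod z ^ r) ^ s \<le> exp u"
      using power_one_plus_le_exp[of "cmod z ^ r" s] by (simp add: u_def)
    also have "exp u \<le> 1 + u + u\<^sup>2" using u \<xi> by (intro exp_bound) auto
    also have "u\<^sup>2 \<le> 5/32 * u" unfolding power2_eq_square using u \<xi> by (intro mult_right_mono) linarith+
    finally show ?thesis by simp
  qed
  have Q: "(1 + \<delta>) ^ r \<le> 1 + \<xi> + 4/5 * \<xi>\<^sup>2"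
    unfolding \<xi>_def by (rule power_one_plus_quadratic_bound) (use \<delta> \<xi> r0 in \<open>auto simp: \<xi>_def\<close>)
  have xi2: "\<xi>\<^sup>2 \<le> \<xi>" unfolding power2_eq_square using \<xi> by (simp add: mult_left_le)
  have A1: "cmod ((1 + c2 * z ^ s) ^ r - 1) \<le> \<xi> + 4/5 * \<xi>\<^sup>2"
    using norm_power_one_plus_minus_one_le[of "c2 * z ^ s" r] Q unfolding a by simp
  have A2: "\<xi> - 4/5 * \<xi>\<^sup>2 \<le> cmod ((1 + c2 * z ^ s) ^ r - 1)"
  proof -
    let ?a = "c2 * z ^ s"
    have "\<xi> = cmod (of_nat r * ?a)" using a by (simp add: norm_mult \<xi>_def)
    also have "\<dots> = cmod (((1 + ?a) ^ r - 1) - ((1 + ?a) ^ r - 1 - of_nat r * ?a))" by simp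
    also have "\<dots> \<le> cmod ((1 + ?a) ^ r - 1) + cmod ((1 + ?a) ^ r - 1 - of_nat r * ?a)" by (rule norm_triangle_ineq4)
    also have "cmod ((1 + ?a) ^ r - 1 - of_nat r * ?a) \<le> (1 + \<delta>) ^ r - 1 - \<xi>"
      using norm_power_one_plus_minus_linear_le[of ?a r] unfolding a \<xi>_def .
    finally show ?thesis using Q by simp
  qed
  define e where "e = c1 ^ r * c3 ^ s"
  have "e\<^sup>2 = (c1\<^sup>2) ^ r * (c3\<^sup>2) ^ s" by (simp add: e_def power_mult_distrib power_mult[symmetric] mult.commute)
  then have "e\<^sup>2 = 1" using s(1) r(1) by simp
  then have e: "e = 1 \<or> e = -1" by (simp add: power2_eq_1_iff)
  have "((1 + z) ^ s) ^ r = ((1 + z) ^ r) ^ s" by (simp add: power_mult[symmetric] mult.commute)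
  then have eq: "c1 ^ r * (1 + c2 * z ^ s) ^ r = c3 ^ s * (1 + c4 * z ^ r) ^ s"
    unfolding s(3) r(3) power_mult_distrib .
  have "c1 ^ r * c1 ^ r = 1" using s(1) by (metis power_mult_distrib power2_eq_square power_one)
  then have "(1 + c2 * z ^ s) ^ r = e * (1 + c4 * z ^ r) ^ s"
    unfolding e_def mult.assoc eq[symmetric] by (simp add: mult.assoc[symmetric])
  \<comment> \<open>For equal signs the linear term dominates: \<open>\<xi>/5\<close> exceeds 37/32
    * 5/32 * \<open>\<xi>\<close>. For opposite signs two numbers near 1 would sum to 0, yet the
    deviations total at most (9/5 + 37/32 * 5/32) \<open>\<xi>\<close>, which is below 2.\<close>
  with e consider "(1 + c2 * z ^ s) ^ r = (1 + c4 * z ^ r) ^ s" | "(1 + c2 * z ^ s) ^ r = - ((1 + c4 * z ^ r) ^ s)" by auto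
  then show False
  proof cases
    case 1
    then have "\<xi> - 4/5 * \<xi>\<^sup>2 \<le> 37/32 * u" using A2 B by simp
    then show False using u xi2 \<xi> by simp
  next
    case 2
    have "2 = cmod (((1 + c2 * z ^ s) ^ r - 1) + ((1 + c4 * z ^ r) ^ s - 1))" unfolding 2 by simp
    also have "\<dots> \<le> cmod ((1 + c2 * z ^ s) ^ r - 1) + cmod ((1 + c4 * z ^ r) ^ s - 1)" by (rule norm_triangle_ineq)
    finally show False using A1 B u xi2 \<xi> by simp
  qed
qed

text \<open>Divide by the longest side: with \<open>z\<close> the shortest over the longest, up to
  sign, the equation for the exponent \<open>n\<close> becomes
  \<open>(1 + z)^n = c (1 + c' z^n)\<close> with signs \<open>c\<close>, \<open>c'\<close>.
  Admitting arbitrary signs in \<open>small_ratio_impossible\<close> lets it cover all six orders of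
  the sides.\<close>

lemma tri_ratio_bound:
  fixes y :: complex
  assumes y: "y \<noteq> 0" "1 + y \<noteq> 0" and rs: "8 * s \<le> 5 * r" "18 \<le> r"
    and eqs: "(1 + y) ^ s = y ^ s + 1" "(1 + y) ^ r = y ^ r + 1"
  shows "tri_max y ^ s \<le> real r * tri_min y ^ s"
proof -
  have key: "M ^ s \<le> real r * m ^ s"
    if z: "z \<noteq> 0" "cmod z = m / M" and mM: "0 < M" "m \<le> M"
    and form: "\<And>n. (1 + y) ^ n = y ^ n + 1 \<Longrightarrow> \<exists>c c'. c\<^sup>2 = 1 \<and> c'\<^sup>2 = 1 \<and> (1 + z) ^ n = c * (1 + c' * z ^ n)" for z m M
  proof -
    obtain c1 c2 c3 c4 where "c1\<^sup>2 = 1" "c2\<^sup>2 = 1" "(1 + z) ^ s = c1 * (1 + c2 * z ^ s)"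
      "c3\<^sup>2 = 1" "c4\<^sup>2 = 1" "(1 + z) ^ r = c3 * (1 + c4 * z ^ r)"
      using form[OF eqs(1)] form[OF eqs(2)] by blast
    moreover have "cmod z \<le> 1" using z(2) mM by simp
    ultimately have "1 \<le> real r * cmod z ^ s" using small_ratio_impossible[OF z(1) _ rs] by blast
    then show ?thesis using mM unfolding z(2) by (simp add: power_divide field_simps)
  qed
  have sq: "((-1) ^ n)\<^sup>2 = (1::complex)" "(- ((-1) ^ n))\<^sup>2 = (1::complex)" for n
    by (simp_all add: power_mult[symmetric])
  have sgn: "(-1) ^ n * (-1) ^ n = (1::complex)" for n using sq(1)[of n] by (simp add: power2_eq_square)
  have neg: "(- w) ^ n = (-1) ^ n * w ^ n" for w :: complex and n by (rule power_minus)
  have one: "(1::complex)\<^sup>2 = 1" by simp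
  show ?thesis
  proof (cases rule: tri_cases[of y])
    case 1
    have "\<exists>c c'. c\<^sup>2 = 1 \<and> c'\<^sup>2 = 1 \<and> (1 + 1 / y) ^ n = c * (1 + c' * (1 / y) ^ n)" if E: "(1 + y) ^ n = y ^ n + 1" for n
    proof -
      have "1 + 1 / y = (1 + y) / y" using y by (simp add: field_simps)
      then have "(1 + 1 / y) ^ n = (y ^ n + 1) / y ^ n" by (simp only: power_divide E)
      also have "\<dots> = 1 * (1 + 1 * (1 / y) ^ n)" using y by (simp add: power_divide add_divide_distrib)
      finally show ?thesis using one by blast
    qed
    then show ?thesis unfolding 1
      by (intro key[of "1 / y"]) (use y tri_between[of y] 1 in \<open>auto simp: norm_divide\<close>)
  next
    case 2
    have "\<exists>c c'. c\<^sup>2 = 1 \<and> c'\<^sup>2 = 1 \<and> (1 + - 1 / (1 + y)) ^ n = c * (1 + c' * (- 1 / (1 + y)) ^ n)" if E: "(1 + y) ^ n = y ^ n + 1" for n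
    proof -
      have "1 + - 1 / (1 + y) = y / (1 + y)" using y by (simp add: field_simps)
      then have "(1 + - 1 / (1 + y)) ^ n = y ^ n / (1 + y) ^ n" by (simp only: power_divide)
      also have "y ^ n = (1 + y) ^ n - ((-1) ^ n * (-1) ^ n)" unfolding sgn using E by simp
      also have "\<dots> / (1 + y) ^ n = 1 * (1 + - ((-1) ^ n) * (- 1 / (1 + y)) ^ n)"
        unfolding power_divide using y by (simp add: diff_divide_distrib)
      finally show ?thesis using one sq(2) by blast
    qed
    then show ?thesis unfolding 2
      by (intro key[of "- 1 / (1 + y)"]) (use y tri_between[of y] 2 in \<open>auto simp: norm_divide\<close>)
  next
    case 3
    have "\<exists>c c'. c\<^sup>2 = 1 \<and> c'\<^sup>2 = 1 \<and> (1 + y) ^ n = c * (1 + c' * y ^ n)" if E: "(1 + y) ^ n = y ^ n + 1" for n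
    proof -
      have "(1 + y) ^ n = 1 * (1 + 1 * y ^ n)" using E by simp
      then show ?thesis using one by blast
    qed
    then show ?thesis unfolding 3
      by (intro key[of y]) (use y tri_between[of y] 3 in auto)
  next
    case 4
    have "\<exists>c c'. c\<^sup>2 = 1 \<and> c'\<^sup>2 = 1 \<and> (1 + - y / (1 + y)) ^ n = c * (1 + c' * (- y / (1 + y)) ^ n)" if E: "(1 + y) ^ n = y ^ n + 1" for n
    proof -
      have "1 + - y / (1 + y) = 1 / (1 + y)" using y by (simp add: field_simps)
      then have "(1 + - y / (1 + y)) ^ n = 1 / (1 + y) ^ n" by (simp only: power_divide power_one)
      moreover have "((1 + y) ^ n - ((-1) ^ n * (-1) ^ n) * y ^ n) / (1 + y) ^ n = 1 * (1 + - ((-1) ^ n) * (- y / (1 + y)) ^ n)"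
        unfolding power_divide neg[of y] using y by (simp add: diff_divide_distrib mult.assoc)
      moreover have "(1 + y) ^ n - ((-1) ^ n * (-1) ^ n) * y ^ n = 1" unfolding sgn using E by simp
      ultimately show ?thesis using one sq(2) by metis
    qed
    then show ?thesis unfolding 4
      by (intro key[of "- y / (1 + y)"]) (use y tri_between[of y] 4 in \<open>auto simp: norm_divide norm_minus_cancel\<close>)
  next
    case 5
    have "\<exists>c c'. c\<^sup>2 = 1 \<and> c'\<^sup>2 = 1 \<and> (1 + - (1 + y)) ^ n = c * (1 + c' * (- (1 + y)) ^ n)" if E: "(1 + y) ^ n = y ^ n + 1" for n
    proof -
      have "- ((-1) ^ n) * (1 + - ((-1) ^ n) * (- (1 + y)) ^ n) = - ((-1) ^ n) + (-1) ^ n * (((-1) ^ n * (-1) ^ n) * (1 + y) ^ n)"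
        unfolding neg[of "1 + y"] by (simp add: algebra_simps)
      also have "\<dots> = (-1) ^ n * y ^ n" unfolding sgn E by (simp add: algebra_simps)
      also have "\<dots> = (1 + - (1 + y)) ^ n" using neg[of y n] by simp
      finally show ?thesis using sq(2) by metis
    qed
    then show ?thesis unfolding 5
      by (intro key[of "- (1 + y)"]) (use y tri_between[of y] 5 in \<open>auto simp: norm_minus_cancel simp del: minus_add_distrib\<close>)
  next
    case 6
    have "\<exists>c c'. c\<^sup>2 = 1 \<and> c'\<^sup>2 = 1 \<and> (1 + - (1 + y) / y) ^ n = c * (1 + c' * (- (1 + y) / y) ^ n)" if E: "(1 + y) ^ n = y ^ n + 1" for n
    proof -
      have "1 + - (1 + y) / y = - 1 / y" using y by (simp add: field_simps)
      then have "(1 + - (1 + y) / y) ^ n = (-1) ^ n / y ^ n" by (simp only: power_divide)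
      moreover have "- ((-1) ^ n) * (1 + - ((-1) ^ n) * (- (1 + y) / y) ^ n)
          = - ((-1) ^ n) + (-1) ^ n * (((-1) ^ n * (-1) ^ n) * (1 + y) ^ n) / y ^ n"
        unfolding power_divide neg[of "1 + y"] by (simp add: algebra_simps)
      moreover have "\<dots> = (-1) ^ n / y ^ n" unfolding sgn E using y by (simp add: add_divide_distrib distrib_left)
      ultimately show ?thesis using sq(2) by metis
    qed
    then show ?thesis unfolding 6
      by (intro key[of "- (1 + y) / y"]) (use y tri_between[of y] 6 in \<open>auto simp: norm_divide norm_minus_cancel simp del: minus_add_distrib\<close>)
  qed
qed

section \<open>The polynomials F_n and first height bounds from two exponents\<close>

definition Fpoly :: "nat \<Rightarrow> int poly" where
  "Fpoly n = [:1, 1:] ^ n - monom 1 n - 1"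

lemma poly_Fpoly: "poly (of_int_poly (Fpoly n)) z = (1 + z) ^ n - z ^ n - (1::'a::{comm_ring_1,ring_char_0})"
  by (simp add: Fpoly_def of_int_poly_hom.hom_minus of_int_poly_hom.hom_power map_poly_monom poly_monom)

lemma poly_Fpoly_eq_0: "poly (of_int_poly (Fpoly n)) z = 0 \<longleftrightarrow> (1 + z) ^ n = z ^ n + (1::complex)"
  unfolding poly_Fpoly by (auto simp: algebra_simps)

lemma unit_triangle:
  fixes y :: complex
  assumes "cmod y = 1" "cmod (1 + y) = 1"
  shows "y\<^sup>2 + y + 1 = 0"
proof -
  have n: "(Re y)\<^sup>2 + (Im y)\<^sup>2 = 1" "(1 + Re y)\<^sup>2 + (Im y)\<^sup>2 = 1"
    using assms cmod_power2[of y] cmod_power2[of "1 + y"] by auto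
  then have re: "Re y = - 1/2" by (simp add: power2_eq_square algebra_simps)
  then have "(Im y)\<^sup>2 = 3/4" using n(1) by (simp add: power2_eq_square)
  then show ?thesis using re by (simp add: complex_eq_iff power2_eq_square)
qed

context irreducible_roots
begin

lemma Fpoly_transfer:
  assumes "(1 + ys 0) ^ n = ys 0 ^ n + 1" "i < d"
  shows "(1 + ys i) ^ n = ys i ^ n + 1"
  using root_transfer[OF deg_pos assms(2), of "Fpoly n"] assms(1) unfolding poly_Fpoly_eq_0 by blast

lemma ht_ge_gap:
  assumes y0: "ys 0 \<noteq> 0" "1 + ys 0 \<noteq> 0" "(ys 0)\<^sup>2 + ys 0 + 1 \<noteq> 0"
    and rs: "8 * s \<le> 5 * r" "18 \<le> r" "0 < s"
    and eqs: "(1 + ys 0) ^ s = ys 0 ^ s + 1" "(1 + ys 0) ^ r = ys 0 ^ r + 1"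
    and \<theta>: "\<theta> > 1" "real r \<le> \<theta> ^ s"
  shows "- ln (1 - 1 / \<theta>\<^sup>2) / 2 \<le> ht"
proof (rule ht_ge_of_ratio[OF y0(3) \<theta>(1)])
  fix c assume c: "c < d"
  have "ys c \<noteq> 0" using root_transfer[OF c deg_pos, of "[:0,1:]"] y0 by auto
  moreover have "1 + ys c \<noteq> 0" using root_transfer[OF c deg_pos, of "[:1,1:]"] y0 by auto
  ultimately have "tri_max (ys c) ^ s \<le> real r * tri_min (ys c) ^ s"
    using tri_ratio_bound[OF _ _ rs(1,2) Fpoly_transfer[OF eqs(1) c] Fpoly_transfer[OF eqs(2) c]] by blast
  also have "\<dots> \<le> \<theta> ^ s * tri_min (ys c) ^ s"
    using \<theta>(2) tri_min_nonneg by (intro mult_right_mono) auto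
  also have "\<dots> = (\<theta> * tri_min (ys c)) ^ s" by (simp add: power_mult_distrib)
  finally have le: "tri_max (ys c) ^ s \<le> (\<theta> * tri_min (ys c)) ^ s" .
  show "tri_max (ys c) \<le> \<theta> * tri_min (ys c)"
  proof (rule ccontr)
    assume "\<not> ?thesis"
    then have "(\<theta> * tri_min (ys c)) ^ s < tri_max (ys c) ^ s"
      using \<theta>(1) tri_min_nonneg[of "ys c"] rs(3) by (intro power_strict_mono) auto
    then show False using le by simp
  qed
qed

lemma norm_power_le_tri_max:
  "cmod (ys i ^ e) \<le> tri_max (ys i) ^ e" "cmod ((1 + ys i) ^ e) \<le> tri_max (ys i) ^ e" "1 \<le> tri_max (ys i) ^ e"
  unfolding norm_power using tri_max_ge[of "ys i"] by (auto intro!: power_mono one_le_power)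

lemma norm_diff_le_add:
  fixes a b :: complex
  assumes "cmod a \<le> A" "cmod b \<le> B"
  shows "cmod (a - b) \<le> A + B" "cmod (a + b) \<le> A + B"
  using assms norm_triangle_ineq4[of a b] norm_triangle_ineq[of a b] by linarith+

text \<open>With \<open>x = 1 + y\<close>, both \<open>(1, -1, -1)\<close> and
  \<open>(x^e, -y^e, -1)\<close> are orthogonal to \<open>(x^s, y^s, 1)\<close>. They could be
  parallel only if \<open>x^e = y^e\<close>; the equations then force \<open>y^e = 1\<close>, so the
  triangle is equilateral, which is excluded. The bound is useful while \<open>e < s\<close>, that
  is, when the exponents differ by a factor below 2.\<close>

lemma ht_le_close:
  assumes q: "(ys 0)\<^sup>2 + ys 0 + 1 \<noteq> 0" and e: "0 < e"
    and eqs: "(1 + ys 0) ^ s = ys 0 ^ s + 1" "(1 + ys 0) ^ (s + e) = ys 0 ^ (s + e) + 1"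
  shows "(real s - real e) * ht \<le> ln 2"
proof -
  have de: "degree ([:1,1:] ^ e :: int poly) \<le> e" using degree_power_le[of "[:1,1::int:]" e] by simp
  have "(real s - real (0 + e)) * ht \<le> ln 2"
  proof (rule ht_bound_of_relations[where a = 1 and b = "-1" and c = "-1" and a' = "[:1,1:] ^ e"
        and b' = "- monom 1 e" and c' = "-1" and ?i0.0 = 0])
    fix i assume i: "i < d"
    note pw = norm_power_le_tri_max[of i e]
    show "(1 + ys i) ^ s * poly (of_int_poly 1) (ys i) + ys i ^ s * poly (of_int_poly (- 1)) (ys i) + poly (of_int_poly (- 1)) (ys i) = 0"
      using Fpoly_transfer[OF eqs(1) i] by (simp add: of_int_poly_hom.hom_uminus)
    show "(1 + ys i) ^ s * poly (of_int_poly ([:1,1:] ^ e)) (ys i) + ys i ^ s * poly (of_int_poly (- monom 1 e)) (ys i) + poly (of_int_poly (- 1)) (ys i) = 0"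
      using Fpoly_transfer[OF eqs(2) i]
      by (simp add: of_int_poly_hom.hom_uminus of_int_poly_hom.hom_power map_poly_monom poly_monom power_add)
    show "cmod (poly (of_int_poly (- 1)) (ys i) * poly (of_int_poly (- 1)) (ys i) -
          poly (of_int_poly (- 1)) (ys i) * poly (of_int_poly (- monom 1 e)) (ys i)) \<le> 2 * tri_max (ys i) ^ (0 + e)"
      using norm_diff_le_add(1)[OF _ pw(1), of 1 "tri_max (ys i) ^ e"] pw(3)
      by (simp add: of_int_poly_hom.hom_uminus map_poly_monom poly_monom)
    show "cmod (poly (of_int_poly (- 1)) (ys i) * poly (of_int_poly ([:1,1:] ^ e)) (ys i) -
          poly (of_int_poly 1) (ys i) * poly (of_int_poly (- 1)) (ys i)) \<le> 2 * tri_max (ys i) ^ (0 + e)"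
      using norm_diff_le_add(1)[OF _ pw(2), of 1 "tri_max (ys i) ^ e"] pw(3)
      by (simp add: of_int_poly_hom.hom_uminus of_int_poly_hom.hom_power)
    show "cmod (poly (of_int_poly 1) (ys i) * poly (of_int_poly (- monom 1 e)) (ys i) -
          poly (of_int_poly (- 1)) (ys i) * poly (of_int_poly ([:1,1:] ^ e)) (ys i)) \<le> 2 * tri_max (ys i) ^ (0 + e)"
      using norm_diff_le_add(1)[OF pw(2) pw(1)]
      by (simp add: of_int_poly_hom.hom_uminus of_int_poly_hom.hom_power map_poly_monom poly_monom)
  next
    show "poly (of_int_poly 1) (ys 0) * poly (of_int_poly (- monom 1 e)) (ys 0) \<noteq>
        poly (of_int_poly (- 1)) (ys 0) * poly (of_int_poly ([:1,1:] ^ e)) (ys 0)"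
    proof
      assume "poly (of_int_poly 1) (ys 0) * poly (of_int_poly (- monom 1 e)) (ys 0) =
        poly (of_int_poly (- 1)) (ys 0) * poly (of_int_poly ([:1,1:] ^ e)) (ys 0)"
      then have xy: "(1 + ys 0) ^ e = ys 0 ^ e"
        by (simp add: of_int_poly_hom.hom_uminus of_int_poly_hom.hom_power map_poly_monom poly_monom)
      have "(ys 0 ^ s + 1) * ys 0 ^ e = ys 0 ^ s * ys 0 ^ e + 1"
        using eqs(2) unfolding power_add eqs(1) xy .
      then have "ys 0 ^ e = 1" by (simp add: algebra_simps)
      then have "cmod (ys 0) ^ e = 1" "cmod (1 + ys 0) ^ e = 1" using xy by (simp_all add: norm_power[symmetric])
      then have "cmod (ys 0) = 1" "cmod (1 + ys 0) = 1" using e power_eq_1_iff[of "cmod (ys 0)" e] power_eq_1_iff[of "cmod (1 + ys 0)" e] by auto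
      then show False using unit_triangle q by blast
    qed
  qed (use de in \<open>simp_all add: deg_pos degree_monom_eq\<close>)
  then show ?thesis by simp
qed

end

section \<open>Pade relations\<close>

text \<open>\<open>hsum u v a b (n + 1)\<close> is the complete homogeneous symmetric polynomial of degree \<open>n\<close> in
  \<open>a\<close> copies of \<open>u\<close> and \<open>b\<close> copies of \<open>v\<close>; the index is shifted to make the recursion uniform.\<close>

fun hsum :: "'a::comm_ring_1 \<Rightarrow> 'a \<Rightarrow> nat \<Rightarrow> nat \<Rightarrow> nat \<Rightarrow> 'a" where
  "hsum u v a b 0 = 0"
| "hsum u v 0 0 (Suc n) = (if n = 0 then 1 else 0)"
| "hsum u v 0 (Suc b) (Suc n) = hsum u v 0 b (Suc n) + v * hsum u v 0 (Suc b) n"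
| "hsum u v (Suc a) b (Suc n) = hsum u v a b (Suc n) + u * hsum u v (Suc a) b n"

lemma hsum_Suc_right:
  "hsum u v a (Suc b) (Suc n) = hsum u v a b (Suc n) + v * hsum u v a (Suc b) n"
proof (induction a arbitrary: n)
  case (Suc a)
  show ?case
  proof (induction n)
    case 0
    then show ?case using Suc.IH[of 0] by simp
  next
    case (Suc n)
    have "hsum u v (Suc a) (Suc b) (Suc (Suc n)) = hsum u v a (Suc b) (Suc (Suc n)) + u * hsum u v (Suc a) (Suc b) (Suc n)"
      by simp
    also have "hsum u v (Suc a) (Suc b) (Suc n) = hsum u v (Suc a) b (Suc n) + v * hsum u v (Suc a) (Suc b) n"
      by (rule Suc.IH)
    also have "hsum u v a (Suc b) (Suc (Suc n)) = hsum u v a b (Suc (Suc n)) + v * hsum u v a (Suc b) (Suc n)"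
      by (rule \<open>\<And>n. hsum u v a (Suc b) (Suc n) = _ n\<close>)
    finally show ?case by (simp add: algebra_simps)
  qed
qed simp

lemma hsum_sym: "hsum u v a b n = hsum v u b a n"
proof (induction u v a b n rule: hsum.induct)
  case (3 u v b n)
  then show ?case by (simp add: hsum_Suc_right)
next
  case (4 u v a b n)
  then show ?case by (simp add: hsum_Suc_right)
qed auto

lemma hsum_diff:
  "(u - v) * hsum u v (Suc a) (Suc b) n = u * hsum u v (Suc a) b n - v * hsum u v a (Suc b) n"
proof (cases n)
  case (Suc m)
  have 1: "hsum u v (Suc a) b (Suc m) = hsum u v (Suc a) (Suc b) (Suc m) - v * hsum u v (Suc a) (Suc b) m"
    by (simp only: hsum_Suc_right) simp
  have 2: "hsum u v a (Suc b) (Suc m) = hsum u v (Suc a) (Suc b) (Suc m) - u * hsum u v (Suc a) (Suc b) m"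
    by simp
  show ?thesis unfolding Suc 1 2 by (simp only: algebra_simps)
qed simp

lemma hsum_one_variable: "hsum u v (Suc a) 0 (Suc n) = of_nat ((a + n) choose n) * u ^ n"
proof (induction a arbitrary: n)
  case 0
  show ?case by (induction n) auto
next
  case (Suc a)
  show ?case
  proof (induction n)
    case 0
    then show ?case using Suc.IH[of 0] by simp
  next
    case (Suc n)
    then show ?case using \<open>\<And>n. hsum u v (Suc a) 0 (Suc n) = _ n\<close>[of "Suc n"]
      by (simp add: algebra_simps)
  qed
qed

lemma hsum_zero_left: "hsum 0 v a b n = hsum 0 v 0 b n"
proof (induction a)
  case (Suc a)
  then show ?case by (cases n) auto
qed simp

lemma hsum_equal: "hsum u u a b n = hsum u u (a + b) 0 n"
proof (induction u u a b n rule: hsum.induct)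
  case (3 u v b n)
  then show ?case by (simp add: hsum_sym[of _ _ 0])
qed auto

lemma hsum_nonneg: "0 \<le> u \<Longrightarrow> 0 \<le> v \<Longrightarrow> 0 \<le> hsum u v a b n" for u v :: real
  by (induction u v a b n rule: hsum.induct) auto

lemma norm_hsum_le:
  fixes u v :: complex
  shows "cmod u \<le> R \<Longrightarrow> cmod v \<le> R \<Longrightarrow> cmod (hsum u v a b n) \<le> hsum R R a b n"
proof (induction u v a b n rule: hsum.induct)
  case (3 u v b n)
  have R: "0 \<le> R" using 3 norm_ge_zero order_trans by blast
  have "cmod (v * hsum u v 0 (Suc b) n) \<le> R * hsum R R 0 (Suc b) n"
    unfolding norm_mult using 3 R by (intro mult_mono) (auto intro: hsum_nonneg)
  then show ?case unfolding hsum.simps using 3 by (intro order_trans[OF norm_triangle_ineq add_mono]) auto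
next
  case (4 u v a b n)
  have R: "0 \<le> R" using 4 norm_ge_zero order_trans by blast
  have "cmod (u * hsum u v (Suc a) b n) \<le> R * hsum R R (Suc a) b n"
    unfolding norm_mult using 4 R by (intro mult_mono) (auto intro: hsum_nonneg)
  then show ?case unfolding hsum.simps using 4 by (intro order_trans[OF norm_triangle_ineq add_mono]) auto
qed auto

text \<open>The binomial coefficient is the number of monomials of degree \<open>n\<close> in
  \<open>c + 1\<close> variables.\<close>

lemma norm_hsum_le_binomial:
  fixes u v :: complex
  assumes "cmod u \<le> R" "cmod v \<le> R" "a + b = Suc c"
  shows "cmod (hsum u v a b (Suc n)) \<le> real ((c + n) choose n) * R ^ n"
  using norm_hsum_le[OF assms(1,2), of a b "Suc n"] unfolding hsum_equal[of R a b] assms(3) hsum_one_variable .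

lemma degree_hsum_le:
  fixes u v :: "int poly"
  shows "degree u \<le> s \<Longrightarrow> degree v \<le> s \<Longrightarrow> degree (hsum u v a b (Suc n)) \<le> n * s"
proof (induction u v a b "Suc n" arbitrary: n rule: hsum.induct)
  case (3 u v b n)
  have "degree (v * hsum u v 0 (Suc b) n) \<le> n * s"
  proof (cases n)
    case (Suc m)
    have "degree (v * hsum u v 0 (Suc b) n) \<le> degree v + degree (hsum u v 0 (Suc b) n)" by (rule degree_mult_le)
    also have "\<dots> \<le> s + m * s" using 3 Suc by (intro add_mono) auto
    finally show ?thesis by (simp add: Suc)
  qed simp
  then show ?case using 3 by (auto intro!: degree_add_le)
next
  case (4 u v a b n)
  have "degree (u * hsum u v (Suc a) b n) \<le> n * s"
  proof (cases n)
    case (Suc m)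
    have "degree (u * hsum u v (Suc a) b n) \<le> degree u + degree (hsum u v (Suc a) b n)" by (rule degree_mult_le)
    also have "\<dots> \<le> s + m * s" using 4 Suc by (intro add_mono) auto
    finally show ?thesis by (simp add: Suc)
  qed simp
  then show ?case using 4 by (auto intro!: degree_add_le)
qed auto

lemma poly_hsum: "poly (hsum u v a b n) z = hsum (poly u z) (poly v z) a b n"
  by (induction u v a b n rule: hsum.induct) auto

lemma of_int_poly_hsum:
  "(of_int_poly (hsum u v a b n) :: complex poly) = hsum (of_int_poly u) (of_int_poly v) a b n"
  by (induction u v a b n rule: hsum.induct) (auto simp: of_int_poly_hom.hom_mult of_int_poly_hom.hom_add)

text \<open>Up to powers of \<open>U\<close>, \<open>V\<close>, \<open>W\<close> the three terms are the residues of
  \<open>1 / ((t - a)^\<alpha> (t - b)^\<beta> (t - c)^\<gamma>)\<close> with \<open>U = b - c\<close>, \<open>V = c - a\<close>, \<open>W = a - b\<close>; the induction is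
  the partial fraction identity \<open>(a - b) / ((t - a) (t - b)) = 1 / (t - a) - 1 / (t - b)\<close>.\<close>

lemma pade_identity:
  fixes U V W :: "'a::comm_ring_1"
  assumes "U + V + W = 0" "0 < \<alpha> + \<beta>"
  shows "U ^ (\<beta> + g) * ((-1) ^ Suc g * hsum (- V) W \<beta> (Suc g) \<alpha>)
       + V ^ (g + \<alpha>) * ((-1) ^ \<alpha> * hsum (- W) U (Suc g) \<alpha> \<beta>)
       + W ^ (\<alpha> + \<beta> - 1) * ((-1) ^ \<beta> * hsum (- U) V \<alpha> \<beta> (Suc g)) = 0"
  using assms(2)
proof (induction "\<alpha> + \<beta>" arbitrary: \<alpha> \<beta>)
  case (Suc n)
  consider (a0) b where "\<alpha> = 0" "\<beta> = Suc b" | (b0) a where "\<alpha> = Suc a" "\<beta> = 0"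
    | (ab) a b where "\<alpha> = Suc a" "\<beta> = Suc b"
    using Suc.hyps(2) by (cases \<alpha>; cases \<beta>) auto
  then show ?case
  proof cases
    case a0
    have sym: "(b + g) choose b = (b + g) choose g" using binomial_symmetric[of b "b + g"] by simp
    show ?thesis unfolding a0 hsum_one_variable hsum_sym[of "- U" V 0]
      by (simp add: sym hsum_one_variable power_minus[of W] algebra_simps)
  next
    case b0
    have sym: "(a + g) choose a = (a + g) choose g" using binomial_symmetric[of a "a + g"] by simp
    show ?thesis unfolding b0 hsum_one_variable hsum_sym[of "- V" W 0]
      by (simp add: sym hsum_one_variable power_minus[of U] algebra_simps)
  next
    case ab
    define A1 where "A1 = (-1) ^ Suc g * hsum (- V) W b (Suc g) (Suc a)"
    define B1 where "B1 = (-1) ^ Suc a * hsum (- W) U (Suc g) (Suc a) b"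
    define C1 where "C1 = (-1) ^ b * hsum (- U) V (Suc a) b (Suc g)"
    define A2 where "A2 = (-1) ^ Suc g * hsum (- V) W (Suc b) (Suc g) a"
    define B2 where "B2 = (-1) ^ a * hsum (- W) U (Suc g) a (Suc b)"
    define C2 where "C2 = (-1) ^ Suc b * hsum (- U) V a (Suc b) (Suc g)"
    \<comment> \<open>Lowering \<open>\<beta>\<close> gives \<open>I1\<close>, lowering
      \<open>\<alpha>\<close> gives \<open>I2\<close>; the claim is the combination
      \<open>U * I1 - V * I2\<close>.\<close>
    have I1: "U ^ (b + g) * A1 + V ^ (g + Suc a) * B1 + W ^ (a + b) * C1 = 0"
      using Suc.hyps(1)[of "Suc a" b] Suc.hyps(2) ab unfolding A1_def B1_def C1_def by simp
    have I2: "U ^ (Suc b + g) * A2 + V ^ (g + a) * B2 + W ^ (a + b) * C2 = 0"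
      using Suc.hyps(1)[of a "Suc b"] Suc.hyps(2) ab unfolding A2_def B2_def C2_def by simp
    have A: "(-1) ^ Suc g * hsum (- V) W (Suc b) (Suc g) (Suc a) = A1 - V * A2"
      unfolding A1_def A2_def hsum.simps(4)[of "- V" W b "Suc g" a] by (simp add: algebra_simps)
    have B: "(-1) ^ Suc a * hsum (- W) U (Suc g) (Suc a) (Suc b) = U * B1 - B2"
      unfolding B1_def B2_def hsum_Suc_right[of "- W" U "Suc g" a b] by (simp add: algebra_simps)
    have W: "W = - U - V" using assms(1) by (metis add_uminus_conv_diff add_eq_0_iff minus_add_distrib)
    have C: "W * ((-1) ^ Suc b * hsum (- U) V (Suc a) (Suc b) (Suc g)) = U * C1 - V * C2"
    proof -
      have "W * ((-1) ^ Suc b * hsum (- U) V (Suc a) (Suc b) (Suc g)) =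
          (-1) ^ Suc b * ((- U - V) * hsum (- U) V (Suc a) (Suc b) (Suc g))" unfolding W by (simp only: mult_ac)
      also have "\<dots> = U * C1 - V * C2"
        unfolding hsum_diff C1_def C2_def by (simp only: right_diff_distrib) (simp add: mult_ac)
      finally show ?thesis .
    qed
    have "U ^ (Suc b + g) * (A1 - V * A2) + V ^ (g + Suc a) * (U * B1 - B2) + W ^ (a + b) * (U * C1 - V * C2)
      = U * (U ^ (b + g) * A1 + V ^ (g + Suc a) * B1 + W ^ (a + b) * C1)
      - V * (U ^ (Suc b + g) * A2 + V ^ (g + a) * B2 + W ^ (a + b) * C2)"
      by (simp add: algebra_simps)
    also have "\<dots> = 0" unfolding I1 I2 by simp
    also have "W ^ (a + b) * (U * C1 - V * C2) = W ^ (Suc a + Suc b - 1) * ((-1) ^ Suc b * hsum (- U) V (Suc a) (Suc b) (Suc g))"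
      unfolding C[symmetric] by (simp add: mult_ac)
    finally show ?thesis unfolding ab A B .
  qed
qed simp

context
  fixes k :: nat and V :: "'a::comm_ring_1"
begin

text \<open>Coefficients of \<open>pade_identity\<close> for \<open>U = 1 - V\<close>,
  \<open>W = -1\<close>: the unprimed ones belong to the pole orders \<open>(k, k, k + 1)\<close>,
  the primed ones to \<open>(k, k + 1, k)\<close>.\<close>

definition pA where "pA = (-1) ^ Suc k * hsum (- V) (- 1) k (Suc k) k"
definition pB where "pB = (-1) ^ k * hsum 1 (1 - V) (Suc k) k k"
definition pC where "pC = - ((-1) ^ k * hsum (V - 1) V k k (Suc k))"
definition pA' where "pA' = (-1) ^ k * hsum (- V) (- 1) (Suc k) k k"
definition pB' where "pB' = (-1) ^ k * hsum 1 (1 - V) k k (Suc k)"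
definition pC' where "pC' = (-1) ^ Suc k * hsum (V - 1) V k (Suc k) k"

lemma pade_first:
  assumes "0 < k"
  shows "(1 - V) ^ (2 * k) * pA + V ^ (2 * k) * pB + pC = 0"
proof -
  obtain g where "k = Suc g" using assms by (cases k) auto
  then have "k + k - 1 = Suc (2 * g)" by simp
  then have "(-1::'a) ^ (k + k - 1) = -1" by (simp only: power_Suc power_mult) simp
  then show ?thesis using pade_identity[of "1 - V" V "-1" k k k] assms
    by (simp add: pA_def pB_def pC_def mult_2)
qed

lemma pade_second:
  assumes "0 < k"
  shows "(1 - V) ^ (2 * k) * pA' + V ^ (2 * k - 1) * pB' + pC' = 0"
proof -
  obtain g where g: "k = Suc g" using assms by (cases k) auto
  have e: "Suc k + g = 2 * k" "g + k = 2 * k - 1" using g by auto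
  have sgn: "(-1::'a) ^ (k + Suc k - 1) = 1" by simp
  have "(1 - V) ^ (Suc k + g) * pA' + V ^ (g + k) * pB' + (-1) ^ (k + Suc k - 1) * pC' = 0"
    using pade_identity[of "1 - V" V "-1" k "Suc k" g]
    unfolding pA'_def pB'_def pC'_def g[symmetric] by simp
  then show ?thesis unfolding e sgn by simp
qed

end

lemma eliminate_leading_term:
  fixes P T v A B C A' B' C' :: "'a::comm_ring_1"
  assumes "P * A + T * v * B + C = 0" "P * A' + T * B' + C' = 0"
  shows "T * (A * B' - B * (A' * v)) = A' * C - A * C'"
proof -
  have C: "C = - (P * A + T * v * B)" "C' = - (P * A' + T * B')"
    using assms by (metis add.inverse_unique minus_minus)+
  show ?thesis unfolding C by (simp add: algebra_simps)
qed

lemma degree_sign_mult: "degree ((-1) ^ n * p :: int poly) = degree p"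
  by (cases "even n") auto

text \<open>Once the terms with (1 - V)^(2k) are eliminated, the determinant times V^(2k-1) is a
  polynomial of degree at most 2k - 1, so the determinant is constant. Its value at
  \<open>V = 0\<close> is, up to sign, a product of two nonzero binomial coefficients. The extra
  factor \<open>V\<close> at \<open>pA'\<close> brings the second relation to the exponent
  2k.\<close>

lemma pade_independent_poly:
  assumes k: "0 < k"
  shows "\<exists>c. c \<noteq> 0 \<and> pA k [:0,1:] * pB' k [:0,1:] - pB k [:0,1:] * (pA' k [:0,1:] * [:0,1:]) = [:c::int:]"
proof -
  define t :: "int poly" where "t = [:0, 1:]"
  obtain g where g: "k = Suc g" using k by (cases k) auto
  define Q where "Q = pA k t * pB' k t - pB k t * (pA' k t * t)"
  have lin: "degree (- t) \<le> 1" "degree (- 1 :: int poly) \<le> 1" "degree (t - 1) \<le> 1" "degree t \<le> 1"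
    by (simp_all add: t_def degree_diff_le)
  have dA: "degree (pA k t) \<le> g" "degree (pA' k t) \<le> g" "degree (pC' k t) \<le> g"
    using degree_hsum_le[OF lin(1,2), of k "Suc k" g] degree_hsum_le[OF lin(1,2), of "Suc k" k g]
      degree_hsum_le[OF lin(3,4), of k "Suc k" g]
    unfolding pA_def pA'_def pC'_def degree_sign_mult g[symmetric] by simp_all
  have dC: "degree (pC k t) \<le> Suc g"
    using degree_hsum_le[OF lin(3,4), of k k k]
    unfolding pC_def degree_minus degree_sign_mult g[symmetric] by simp
  have "t ^ (2 * k) = t ^ (2 * k - 1) * t" using power_minus_mult[of "2 * k" t] k by simp
  then have eq: "t ^ (2 * k - 1) * Q = pA' k t * pC k t - pA k t * pC' k t"
    unfolding Q_def using pade_first[OF k, of t] pade_second[OF k, of t] by (intro eliminate_leading_term) simp_all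
  have "degree (pA' k t * pC k t - pA k t * pC' k t) \<le> 2 * k - 1"
  proof (rule degree_diff_le)
    show "degree (pA' k t * pC k t) \<le> 2 * k - 1"
      using degree_mult_le[of "pA' k t" "pC k t"] dA dC g by linarith
    show "degree (pA k t * pC' k t) \<le> 2 * k - 1"
      using degree_mult_le[of "pA k t" "pC' k t"] dA g by linarith
  qed
  then have le: "degree (t ^ (2 * k - 1) * Q) \<le> 2 * k - 1" unfolding eq .
  have "degree Q = 0"
  proof (cases "Q = 0")
    case False
    then have "degree (t ^ (2 * k - 1) * Q) = (2 * k - 1) + degree Q"
      by (subst degree_mult_eq) (auto simp: t_def degree_power_eq)
    then show ?thesis using le by simp
  qed simp
  then obtain c where c: "Q = [:c:]" by (metis degree_eq_zeroE)
  have "c = poly (pA k t) 0 * poly (pB' k t) 0"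
    using arg_cong[OF c, of "\<lambda>p. poly p 0"] by (simp add: Q_def t_def)
  moreover have "poly (pA k t) 0 \<noteq> 0"
  proof -
    have "poly (pA k t) 0 = (-1) ^ Suc k * hsum 0 (-1) k (Suc k) k"
      by (simp add: pA_def poly_hsum t_def)
    moreover have "hsum 0 (-1::int) k (Suc k) k = hsum (-1) 0 (Suc k) 0 k"
      unfolding hsum_zero_left[of "-1" k] hsum_sym[of 0 "-1" 0] ..
    moreover have "hsum (-1::int) 0 (Suc k) 0 k \<noteq> 0" unfolding g hsum_one_variable by (simp add: binomial_eq_0_iff)
    ultimately show ?thesis by simp
  qed
  moreover have "poly (pB' k t) 0 \<noteq> 0"
  proof -
    have "poly (pB' k t) 0 = (-1) ^ k * hsum 1 1 k k (Suc k)"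
      by (simp add: pB'_def poly_hsum t_def)
    moreover have "hsum (1::int) 1 k k (Suc k) = hsum 1 1 (Suc (g + k)) 0 (Suc k)"
      unfolding hsum_equal[of 1 k k] using g by (simp only: add_Suc)
    moreover have "hsum (1::int) 1 (Suc (g + k)) 0 (Suc k) \<noteq> 0"
      unfolding hsum_one_variable by (simp add: binomial_eq_0_iff)
    ultimately show ?thesis by simp
  qed
  ultimately have "c \<noteq> 0" by simp
  then show ?thesis using c unfolding Q_def t_def by blast
qed

context irreducible_roots
begin

lemma norm_pair_sums:
  fixes a b c p q r :: complex
  assumes "cmod a + cmod b \<le> K" "cmod b + cmod c \<le> K" "cmod c + cmod a \<le> K"
    and "cmod p \<le> R" "cmod q \<le> R" "cmod r \<le> R"
  shows "cmod (b * r - c * q) \<le> K * R" "cmod (c * p - a * r) \<le> K * R" "cmod (a * q - b * p) \<le> K * R"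
proof -
  have R: "0 \<le> R" using assms(4) norm_ge_zero[of p] by linarith
  have *: "cmod (a * q - b * p) \<le> K * R" if "cmod a + cmod b \<le> K" "cmod p \<le> R" "cmod q \<le> R" for a b p q
  proof -
    have "cmod (a * q - b * p) \<le> cmod a * cmod q + cmod b * cmod p"
      using norm_triangle_ineq4[of "a * q" "b * p"] by (simp add: norm_mult)
    also have "\<dots> \<le> cmod a * R + cmod b * R" using that by (intro add_mono mult_left_mono) auto
    also have "\<dots> \<le> K * R" using that(1) R by (simp add: distrib_right[symmetric] mult_right_mono)
    finally show ?thesis .
  qed
  show "cmod (b * r - c * q) \<le> K * R" "cmod (c * p - a * r) \<le> K * R" "cmod (a * q - b * p) \<le> K * R"
    by (rule *; use assms in simp)+
qed

lemma ht_bound_of_relation_pair: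
  fixes a b c p q r :: "int poly" and \<kappa> :: real
  defines "ev \<equiv> (\<lambda>p i. poly (of_int_poly p) (ys i) :: complex)"
  assumes deg: "degree a \<le> N1" "degree b \<le> N1" "degree c \<le> N1" "degree p \<le> N2" "degree q \<le> N2" "degree r \<le> N2"
    and rel: "\<And>i. i < d \<Longrightarrow> (1 + ys i) ^ m * ev a i + ys i ^ m * ev b i + ev c i = 0"
    and rel': "\<And>i. i < d \<Longrightarrow> (1 + ys i) ^ m * ev p i + ys i ^ m * ev q i + ev r i = 0"
    and sums: "\<And>i. i < d \<Longrightarrow> cmod (ev a i) + cmod (ev b i) \<le> \<kappa> * tri_max (ys i) ^ N1"
      "\<And>i. i < d \<Longrightarrow> cmod (ev b i) + cmod (ev c i) \<le> \<kappa> * tri_max (ys i) ^ N1"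
      "\<And>i. i < d \<Longrightarrow> cmod (ev c i) + cmod (ev a i) \<le> \<kappa> * tri_max (ys i) ^ N1"
    and small: "\<And>i. i < d \<Longrightarrow> cmod (ev p i) \<le> tri_max (ys i) ^ N2" "\<And>i. i < d \<Longrightarrow> cmod (ev q i) \<le> tri_max (ys i) ^ N2"
      "\<And>i. i < d \<Longrightarrow> cmod (ev r i) \<le> tri_max (ys i) ^ N2"
    and \<kappa>: "\<kappa> > 0"
    and nz: "ev a 0 * ev q 0 \<noteq> ev b 0 * ev p 0"
  shows "(real m - real (N1 + N2)) * ht \<le> ln \<kappa>"
proof (rule ht_bound_of_relations[OF deg _ _ _ _ _ \<kappa> deg_pos])
  fix i assume i: "i < d"
  note * = norm_pair_sums[OF sums[OF i] small[OF i], unfolded ev_def mult.assoc power_add[symmetric]]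
  show "cmod (poly (of_int_poly b) (ys i) * poly (of_int_poly r) (ys i) - poly (of_int_poly c) (ys i) * poly (of_int_poly q) (ys i))
      \<le> \<kappa> * tri_max (ys i) ^ (N1 + N2)" by (rule *(1))
  show "cmod (poly (of_int_poly c) (ys i) * poly (of_int_poly p) (ys i) - poly (of_int_poly a) (ys i) * poly (of_int_poly r) (ys i))
      \<le> \<kappa> * tri_max (ys i) ^ (N1 + N2)" by (rule *(2))
  show "cmod (poly (of_int_poly a) (ys i) * poly (of_int_poly q) (ys i) - poly (of_int_poly b) (ys i) * poly (of_int_poly p) (ys i))
      \<le> \<kappa> * tri_max (ys i) ^ (N1 + N2)" by (rule *(3))
qed (use rel rel' nz in \<open>simp_all add: ev_def\<close>)

end

lemma parallel_cancel:
  fixes a b a' b' p q :: "'a::comm_ring_1"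
  assumes "a * q = b * p" "a' * q = b' * p"
  shows "(a * b' - b * a') * p = 0"
proof -
  have "(a * b' - b * a') * p = a * (b' * p) - a' * (b * p)" by (simp add: algebra_simps)
  also have "\<dots> = 0" unfolding assms[symmetric] by (simp add: algebra_simps)
  finally show ?thesis .
qed

context irreducible_roots
begin

abbreviation ev :: "int poly \<Rightarrow> nat \<Rightarrow> complex" where
  "ev p i \<equiv> poly (of_int_poly p) (ys i)"

abbreviation zero_exponent :: "nat \<Rightarrow> bool" where
  "zero_exponent n \<equiv> (1 + ys 0) ^ n = ys 0 ^ n + 1"

text \<open>Sums of two entries are bounded because an entry of a cross product involves only two
  entries of each factor. For the Pade triples this gives exactly
  \<open>(3 * k) choose k\<close>.\<close>

definition relation_triple :: "nat \<Rightarrow> nat \<Rightarrow> real \<Rightarrow> int poly \<Rightarrow> int poly \<Rightarrow> int poly \<Rightarrow> bool" where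
  "relation_triple N m \<kappa> a b c \<longleftrightarrow> degree a \<le> N \<and> degree b \<le> N \<and> degree c \<le> N \<and>
     (\<forall>i<d. (1 + ys i) ^ m * ev a i + ys i ^ m * ev b i + ev c i = 0 \<and>
        cmod (ev a i) + cmod (ev b i) \<le> \<kappa> * tri_max (ys i) ^ N \<and>
        cmod (ev b i) + cmod (ev c i) \<le> \<kappa> * tri_max (ys i) ^ N \<and>
        cmod (ev c i) + cmod (ev a i) \<le> \<kappa> * tri_max (ys i) ^ N)"

text \<open>The second relation at the exponent \<open>m\<close> is \<open>(x^e, -y^e, -1)\<close>
  with \<open>x = 1 + y\<close>, obtained by splitting \<open>e\<close> off the larger
  exponent.\<close>

lemma ht_le_of_triple_above:
  assumes T: "relation_triple N m \<kappa> a b c" and \<kappa>: "0 < \<kappa>" and zero: "zero_exponent (m + e)"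
    and nz: "ev a 0 * - (ys 0 ^ e) \<noteq> ev b 0 * (1 + ys 0) ^ e"
  shows "(real m - real N - real e) * ht \<le> ln \<kappa>"
proof -
  note T' = T[unfolded relation_triple_def]
  note pw = norm_power_le_tri_max
  have de: "degree ([:1,1:] ^ e :: int poly) \<le> e" using degree_power_le[of "[:1,1::int:]" e] by simp
  have "(real m - real (N + e)) * ht \<le> ln \<kappa>"
  proof (rule ht_bound_of_relation_pair[where a = a and b = b and c = c and p = "[:1,1:] ^ e" and q = "- monom 1 e" and r = "-1"])
    fix i assume i: "i < d"
    show "(1 + ys i) ^ m * ev ([:1,1:] ^ e) i + ys i ^ m * ev (- monom 1 e) i + ev (- 1) i = 0"
      using Fpoly_transfer[OF zero i]
      by (simp add: of_int_poly_hom.hom_uminus of_int_poly_hom.hom_power map_poly_monom poly_monom power_add)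
    show "cmod (ev ([:1,1:] ^ e) i) \<le> tri_max (ys i) ^ e"
      using pw(2)[of i e] by (simp add: of_int_poly_hom.hom_power)
    show "cmod (ev (- monom 1 e) i) \<le> tri_max (ys i) ^ e"
      using pw(1)[of i e] by (simp add: of_int_poly_hom.hom_uminus map_poly_monom poly_monom)
    show "cmod (ev (- 1) i) \<le> tri_max (ys i) ^ e"
      using pw(3)[of i e] by (simp add: of_int_poly_hom.hom_uminus)
  next
    show "ev a 0 * ev (- monom 1 e) 0 \<noteq> ev b 0 * ev ([:1,1:] ^ e) 0"
      using nz by (simp add: of_int_poly_hom.hom_uminus of_int_poly_hom.hom_power map_poly_monom poly_monom)
  qed (use T' de \<kappa> in \<open>auto simp: degree_monom_eq\<close>)
  then show ?thesis by (simp add: algebra_simps)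
qed

text \<open>Here the exponent of the triple exceeds \<open>r\<close>, so \<open>x^f\<close> and
  \<open>y^f\<close> with \<open>x = 1 + y\<close> are absorbed into its first two entries, and the
  second relation is \<open>(1, -1, -1)\<close>.\<close>

lemma ht_le_of_triple_below:
  assumes T: "relation_triple N m \<kappa> a b c" and \<kappa>: "0 < \<kappa>" and m: "m = r + f" and zero: "zero_exponent r"
    and nz: "- (ev a 0 * (1 + ys 0) ^ f) \<noteq> ev b 0 * ys 0 ^ f"
  shows "(real r - real N - real f) * ht \<le> ln \<kappa>"
proof -
  note T' = T[unfolded relation_triple_def]
  note pw = norm_power_le_tri_max
  have df: "degree ([:1,1:] ^ f :: int poly) \<le> f" using degree_power_le[of "[:1,1::int:]" f] by simp
  have eva: "ev (a * [:1,1:] ^ f) i = ev a i * (1 + ys i) ^ f" for i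
    by (simp add: of_int_poly_hom.hom_power of_int_poly_hom.hom_mult)
  have evb: "ev (b * monom 1 f) i = ev b i * ys i ^ f" for i
    by (simp add: of_int_poly_hom.hom_mult map_poly_monom poly_monom)
  have "(real r - real (N + f + 0)) * ht \<le> ln \<kappa>"
  proof (rule ht_bound_of_relation_pair[where a = "a * [:1,1:] ^ f" and b = "b * monom 1 f" and c = c and p = 1 and q = "-1" and r = "-1"])
    show "degree (a * [:1,1:] ^ f) \<le> N + f" using degree_mult_le[of a "[:1,1:] ^ f"] T' df by linarith
    show "degree (b * monom 1 f) \<le> N + f" using degree_mult_le[of b "monom 1 f"] T' by (simp add: degree_monom_eq)
    show "degree c \<le> N + f" using T' by simp
  next
    fix i assume i: "i < d"
    let ?M = "tri_max (ys i)"
    show "(1 + ys i) ^ r * ev 1 i + ys i ^ r * ev (- 1) i + ev (- 1) i = 0"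
      using Fpoly_transfer[OF zero i] by (simp add: of_int_poly_hom.hom_uminus)
    have "(1 + ys i) ^ m * ev a i + ys i ^ m * ev b i + ev c i = 0" using T' i by blast
    then show "(1 + ys i) ^ r * ev (a * [:1,1:] ^ f) i + ys i ^ r * ev (b * monom 1 f) i + ev c i = 0"
      unfolding eva evb m by (simp add: power_add mult_ac)
    have s: "u * g + v * h \<le> \<kappa> * ?M ^ (N + f)" if "u + v \<le> \<kappa> * ?M ^ N" "0 \<le> u" "0 \<le> v" "0 \<le> g" "g \<le> ?M ^ f" "0 \<le> h" "h \<le> ?M ^ f" for u v g h
    proof -
      have "u * g + v * h \<le> u * ?M ^ f + v * ?M ^ f" using that by (intro add_mono mult_left_mono) auto
      also have "\<dots> = (u + v) * ?M ^ f" by (simp add: distrib_right)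
      also have "\<dots> \<le> \<kappa> * ?M ^ N * ?M ^ f" using that(1) tri_max_pos[of "ys i"] by (intro mult_right_mono) auto
      finally show ?thesis by (simp add: power_add mult.assoc)
    qed
    show "cmod (ev (a * [:1,1:] ^ f) i) + cmod (ev (b * monom 1 f) i) \<le> \<kappa> * ?M ^ (N + f)"
      unfolding eva evb norm_mult using T' i pw[of i f] by (intro s) auto
    show "cmod (ev (b * monom 1 f) i) + cmod (ev c i) \<le> \<kappa> * ?M ^ (N + f)"
      unfolding eva evb norm_mult using s[of "cmod (ev b i)" "cmod (ev c i)" "cmod (ys i ^ f)" 1] T' i pw[of i f] by auto
    show "cmod (ev c i) + cmod (ev (a * [:1,1:] ^ f) i) \<le> \<kappa> * ?M ^ (N + f)"
      unfolding eva evb norm_mult using s[of "cmod (ev c i)" "cmod (ev a i)" 1 "cmod ((1 + ys i) ^ f)"] T' i pw[of i f] by auto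
  next
    show "ev (a * [:1,1:] ^ f) 0 * ev (- 1) 0 \<noteq> ev (b * monom 1 f) 0 * ev 1 0"
      using nz unfolding eva evb by (simp add: of_int_poly_hom.hom_uminus)
  qed (use \<kappa> in \<open>auto simp: of_int_poly_hom.hom_uminus\<close>)
  then show ?thesis by (simp add: algebra_simps)
qed

text \<open>Substitute \<open>V = -y^s\<close>, so that \<open>1 - V\<close> is
  \<open>(1 + y)^s\<close> at the roots. The second Pade relation is multiplied by \<open>V\<close>
  to reach the same exponent \<open>2ks\<close>.\<close>

lemma pade_triples:
  assumes k: "0 < k" and zero: "zero_exponent s"
  shows "\<exists>a b c a' b' c'. relation_triple (k * s) (2 * k * s) (real ((3 * k) choose k)) a b c \<and>
     relation_triple (k * s) (2 * k * s) (real ((3 * k) choose k)) a' b' c' \<and> ev a 0 * ev b' 0 \<noteq> ev b 0 * ev a' 0"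
proof -
  obtain g where g: "k = Suc g" using k by (cases k) auto
  define V where "V = - monom (1::int) s"
  define v where "v i = - (ys i ^ s)" for i
  \<comment> \<open>\<open>c1\<close> counts the monomials of degree \<open>k - 1\<close> in
    \<open>2k + 1\<close> variables, \<open>c2\<close> those of degree \<open>k\<close> in
    \<open>2k\<close> variables. Each triple has only one entry of the larger size
    \<open>c2\<close>, so any two entries sum to at most \<open>c1 + c2\<close>.\<close>
  define c1 where "c1 = real ((3 * k - 1) choose (k - 1))"
  define c2 where "c2 = real ((3 * k - 1) choose k)"
  have csum: "c1 + c2 = real ((3 * k) choose k)"
  proof -
    have "3 * k = Suc (3 * k - 1)" using k by simp
    then have "(3 * k) choose k = ((3 * k - 1) choose (k - 1)) + ((3 * k - 1) choose k)"
      using g by (metis binomial_Suc_Suc diff_Suc_1)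
    then show ?thesis unfolding c1_def c2_def by simp
  qed
  have c12: "0 \<le> c1" "c1 \<le> c2"
    unfolding c1_def c2_def using k by (auto intro!: binomial_mono)
  have ev_hsum: "ev (hsum u w a b n) i = hsum (ev u i) (ev w i) a b n" for u w a b n i
    by (simp add: of_int_poly_hsum poly_hsum)
  have evV: "ev V i = v i" "ev (- V) i = - v i" "ev (1 - V) i = 1 - v i" "ev (V - 1) i = v i - 1" "ev (- 1) i = - 1" "ev 1 i = 1" for i
    by (simp_all add: V_def v_def of_int_poly_hom.hom_uminus of_int_poly_hom.hom_minus of_int_poly_hom.hom_add map_poly_monom poly_monom)
  have evsgn: "ev ((-1) ^ n * p) i = (-1) ^ n * ev p i" for n p i
    by (simp add: of_int_poly_hom.hom_mult of_int_poly_hom.hom_power of_int_poly_hom.hom_uminus)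
  have evA: "ev (pA k V) i = pA k (v i)" "ev (pB k V) i = pB k (v i)" "ev (pC k V) i = pC k (v i)"
    "ev (pA' k V) i = pA' k (v i)" "ev (pB' k V) i = pB' k (v i)" "ev (pC' k V) i = pC' k (v i)" for i
    unfolding pA_def pB_def pC_def pA'_def pB'_def pC'_def of_int_poly_hom.hom_uminus poly_minus evsgn ev_hsum evV by simp_all
  have dV: "degree (- V) \<le> s" "degree (- 1 :: int poly) \<le> s" "degree (1 :: int poly) \<le> s" "degree (1 - V) \<le> s" "degree (V - 1) \<le> s" "degree V \<le> s"
    by (auto simp: V_def degree_monom_eq intro!: degree_diff_le degree_add_le)
  have dg: "degree (pA k V) \<le> g * s" "degree (pB k V) \<le> g * s" "degree (pA' k V) \<le> g * s" "degree (pC' k V) \<le> g * s"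
    using degree_hsum_le[OF dV(1,2), of k "Suc k" g] degree_hsum_le[OF dV(3,4), of "Suc k" k g]
      degree_hsum_le[OF dV(1,2), of "Suc k" k g] degree_hsum_le[OF dV(5,6), of k "Suc k" g]
    unfolding pA_def pB_def pA'_def pC'_def degree_sign_mult g[symmetric] by simp_all
  have dk: "degree (pC k V) \<le> k * s" "degree (pB' k V) \<le> k * s"
    using degree_hsum_le[OF dV(5,6), of k k k] degree_hsum_le[OF dV(3,4), of k k k]
    unfolding pC_def pB'_def degree_minus degree_sign_mult by simp_all
  have gk: "g * s \<le> k * s" "g * s + s = k * s" using g by auto
  have dV': "degree (p * V) \<le> k * s" if "degree p \<le> g * s" for p
    using degree_mult_le[of p V] dV(6) that gk by linarith
  have rel: "(1 + ys i) ^ (2 * k * s) * pA k (v i) + ys i ^ (2 * k * s) * pB k (v i) + pC k (v i) = 0"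
      "(1 + ys i) ^ (2 * k * s) * (pA' k (v i) * v i) + ys i ^ (2 * k * s) * pB' k (v i) + pC' k (v i) * v i = 0" if i: "i < d" for i
  proof -
    have "1 - v i = (1 + ys i) ^ s" using Fpoly_transfer[OF zero i] by (simp add: v_def)
    then have U: "(1 - v i) ^ (2 * k) = (1 + ys i) ^ (2 * k * s)" by (simp add: power_mult[symmetric] mult.commute)
    have W: "v i ^ (2 * k) = ys i ^ (2 * k * s)" by (simp add: v_def power_mult[symmetric] mult.commute)
    show "(1 + ys i) ^ (2 * k * s) * pA k (v i) + ys i ^ (2 * k * s) * pB k (v i) + pC k (v i) = 0"
      using pade_first[OF k, of "v i"] unfolding U W .
    have W': "v i ^ (2 * k - 1) * v i = v i ^ (2 * k)" using power_minus_mult[of "2 * k" "v i"] k by simp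
    have "((1 - v i) ^ (2 * k) * pA' k (v i) + v i ^ (2 * k - 1) * pB' k (v i) + pC' k (v i)) * v i = 0"
      unfolding pade_second[OF k, of "v i"] by simp
    then have "(1 - v i) ^ (2 * k) * (pA' k (v i) * v i) + (v i ^ (2 * k - 1) * v i) * pB' k (v i) + pC' k (v i) * v i = 0"
      by (simp add: algebra_simps)
    then show "(1 + ys i) ^ (2 * k * s) * (pA' k (v i) * v i) + ys i ^ (2 * k * s) * pB' k (v i) + pC' k (v i) * v i = 0"
      unfolding W' U W .
  qed
  have size: "cmod (pA k (v i)) \<le> c1 * tri_max (ys i) ^ (k * s)" "cmod (pB k (v i)) \<le> c1 * tri_max (ys i) ^ (k * s)"
     "cmod (pC k (v i)) \<le> c2 * tri_max (ys i) ^ (k * s)"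
     "cmod (pA' k (v i) * v i) \<le> c1 * tri_max (ys i) ^ (k * s)" "cmod (pB' k (v i)) \<le> c2 * tri_max (ys i) ^ (k * s)"
     "cmod (pC' k (v i) * v i) \<le> c1 * tri_max (ys i) ^ (k * s)" if i: "i < d" for i
  proof -
    define R where "R = tri_max (ys i) ^ s"
    have Rk: "tri_max (ys i) ^ (k * s) = R ^ g * R" by (simp add: R_def power_mult[symmetric] mult.commute g power_add)
    have R1: "1 \<le> R" using norm_power_le_tri_max(3)[of i s] by (simp add: R_def)
    then have Rg: "R ^ g \<le> R ^ g * R" by (simp add: mult_le_cancel_left1)
    have v: "cmod (v i) \<le> R" "cmod (- v i) \<le> R" using norm_power_le_tri_max(1)[of i s] by (simp_all add: v_def R_def)
    have "cmod (1 - v i) \<le> R" using norm_power_le_tri_max(2)[of i s] Fpoly_transfer[OF zero i]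
      by (simp add: v_def R_def add.commute)
    then have v1: "cmod (1 - v i) \<le> R" "cmod (v i - 1) \<le> R" by (simp_all add: norm_minus_commute)
    have one: "cmod 1 \<le> R" "cmod (- 1) \<le> R" using R1 by simp_all
    have n1: "2 * k + g = 3 * k - 1" "2 * k - 1 + k = 3 * k - 1" "k - 1 = g" using g by auto
    have sum1: "k + Suc k = Suc (2 * k)" "Suc k + k = Suc (2 * k)" "k + k = Suc (2 * k - 1)" using k by auto
    have b1: "cmod (hsum u w a b k) \<le> c1 * R ^ g" if "cmod u \<le> R" "cmod w \<le> R" "a + b = Suc (2 * k)" for u w :: complex and a b
      using norm_hsum_le_binomial[OF that, of g] unfolding n1(1) g[symmetric] c1_def n1(3) .
    have b2: "cmod (hsum u w k k (Suc k)) \<le> c2 * (R ^ g * R)" if "cmod u \<le> R" "cmod w \<le> R" for u w :: complex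
      using norm_hsum_le_binomial[OF that sum1(3), of k] unfolding n1(2) c2_def by (simp add: g mult_ac)
    have sg: "cmod ((-1) ^ n * z) = cmod z" for n z by (simp add: norm_mult norm_power)
    have up: "cmod z \<le> c1 * (R ^ g * R)" if "cmod z \<le> c1 * R ^ g" for z
      using that mult_left_mono[OF Rg c12(1)] by linarith
    have upv: "cmod (z * v i) \<le> c1 * (R ^ g * R)" if "cmod z \<le> c1 * R ^ g" for z
    proof -
      have "cmod z * cmod (v i) \<le> (c1 * R ^ g) * R" using that v(1) R1 c12(1) by (intro mult_mono) auto
      then show ?thesis by (simp add: norm_mult mult.assoc)
    qed
    show "cmod (pA k (v i)) \<le> c1 * tri_max (ys i) ^ (k * s)"
      unfolding Rk pA_def sg by (rule up[OF b1[OF v(2) one(2) sum1(1)]])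
    show "cmod (pB k (v i)) \<le> c1 * tri_max (ys i) ^ (k * s)"
      unfolding Rk pB_def sg by (rule up[OF b1[OF one(1) v1(1) sum1(2)]])
    show "cmod (pC k (v i)) \<le> c2 * tri_max (ys i) ^ (k * s)"
      unfolding Rk pC_def norm_minus_cancel sg by (rule b2[OF v1(2) v(1)])
    show "cmod (pA' k (v i) * v i) \<le> c1 * tri_max (ys i) ^ (k * s)"
      unfolding Rk by (rule upv) (unfold pA'_def sg, rule b1[OF v(2) one(2) sum1(2)])
    show "cmod (pB' k (v i)) \<le> c2 * tri_max (ys i) ^ (k * s)"
      unfolding Rk pB'_def sg by (rule b2[OF one(1) v1(1)])
    show "cmod (pC' k (v i) * v i) \<le> c1 * tri_max (ys i) ^ (k * s)"
      unfolding Rk by (rule upv) (unfold pC'_def sg, rule b1[OF v1(2) v(1) sum1(1)])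
  qed
  have sums: "x + y \<le> real ((3 * k) choose k) * M" if "x \<le> c1 * M" "y \<le> c2 * M" for x y M
    using that unfolding csum[symmetric] by (simp add: distrib_right)
  have sums': "x + y \<le> real ((3 * k) choose k) * M" if "x \<le> c1 * M" "y \<le> c1 * M" "0 \<le> M" for x y M
    using that mult_right_mono[OF c12(2) that(3)] unfolding csum[symmetric] by (simp add: distrib_right)
  have pos: "0 \<le> tri_max (ys i) ^ (k * s)" for i using tri_max_pos[of "ys i"] by simp
  have evmV: "ev (p * V) i = ev p i * v i" for p i using evV(1) by (simp add: of_int_poly_hom.hom_mult)
  have T1: "relation_triple (k * s) (2 * k * s) (real ((3 * k) choose k)) (pA k V) (pB k V) (pC k V)"
    unfolding relation_triple_def evA
  proof (intro conjI allI impI)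
    fix i assume i: "i < d"
    show "cmod (pC k (v i)) + cmod (pA k (v i)) \<le> real ((3 * k) choose k) * tri_max (ys i) ^ (k * s)"
      using sums[OF size(1)[OF i] size(3)[OF i]] by simp
  qed (use dg dk gk rel size sums sums' pos in \<open>(auto intro: order_trans)[3], blast+\<close>)
  have T2: "relation_triple (k * s) (2 * k * s) (real ((3 * k) choose k)) (pA' k V * V) (pB' k V) (pC' k V * V)"
    unfolding relation_triple_def evmV evA
  proof (intro conjI allI impI)
    fix i assume i: "i < d"
    show "cmod (pB' k (v i)) + cmod (pC' k (v i) * v i) \<le> real ((3 * k) choose k) * tri_max (ys i) ^ (k * s)"
      using sums[OF size(6)[OF i] size(5)[OF i]] by simp
  qed (use dg dk gk rel size sums sums' pos dV' in \<open>blast+\<close>)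
  have "ev (pA k V) 0 * ev (pB' k V) 0 \<noteq> ev (pB k V) 0 * ev (pA' k V * V) 0"
  proof -
    obtain c where c: "c \<noteq> 0" "pA k [:0,1:] * pB' k [:0,1:] - pB k [:0,1:] * (pA' k [:0,1:] * [:0,1:]) = [:c::int:]"
      using pade_independent_poly[OF k] by blast
    define t where "t = [:0, 1::complex:]"
    define tI where "tI = [:0, 1::int:]"
    have tt: "of_int_poly tI = t" by (simp add: t_def tI_def)
    have "of_int_poly (pA k tI * pB' k tI - pB k tI * (pA' k tI * tI)) = [:of_int c :: complex:]"
      unfolding c(2)[folded tI_def] by (rule poly_eqI) (auto simp: coeff_pCons split: nat.split)
    then have "pA k t * pB' k t - pB k t * (pA' k t * t) = [:of_int c:]"
      unfolding pA_def pB_def pA'_def pB'_def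
      by (simp add: tt of_int_poly_hom.hom_mult of_int_poly_hom.hom_minus of_int_poly_hom.hom_uminus of_int_poly_hom.hom_power of_int_poly_hsum)
    then have "poly (pA k t * pB' k t - pB k t * (pA' k t * t)) (v 0) = of_int c" by simp
    moreover have "poly (pA k t) (v 0) = pA k (v 0)" "poly (pB k t) (v 0) = pB k (v 0)" "poly (pA' k t) (v 0) = pA' k (v 0)"
       "poly (pB' k t) (v 0) = pB' k (v 0)" "poly t (v 0) = v 0"
      unfolding t_def pA_def pB_def pA'_def pB'_def by (simp_all add: poly_hsum)
    ultimately have "pA k (v 0) * pB' k (v 0) - pB k (v 0) * (pA' k (v 0) * v 0) = of_int c" by simp
    then show ?thesis unfolding evmV evA using c(1) by auto
  qed
  then show ?thesis using T1 T2 by blast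
qed

text \<open>Two independent triples cannot both be parallel to \<open>(x^e, -y^e, -1)\<close>,
  \<open>x = 1 + y\<close>, so one of them yields the bound. The same argument works below
  \<open>2ks\<close>.\<close>

lemma ht_le_pade_above:
  assumes k: "0 < k" and x0: "1 + ys 0 \<noteq> 0" and zero: "zero_exponent s" "zero_exponent r" and r: "2 * k * s \<le> r"
  shows "(3 * real k * real s - real r) * ht \<le> ln (real ((3 * k) choose k))"
proof -
  define e where "e = r - 2 * k * s"
  have r': "r = 2 * k * s + e" using r by (simp add: e_def)
  obtain a b c a' b' c' where T: "relation_triple (k * s) (2 * k * s) (real ((3 * k) choose k)) a b c"
     "relation_triple (k * s) (2 * k * s) (real ((3 * k) choose k)) a' b' c'" and ind: "ev a 0 * ev b' 0 \<noteq> ev b 0 * ev a' 0"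
    using pade_triples[OF k zero(1)] by blast
  have \<kappa>: "0 < real ((3 * k) choose k)" using k by (simp add: zero_less_binomial_iff)
  have "ev a 0 * - (ys 0 ^ e) \<noteq> ev b 0 * (1 + ys 0) ^ e \<or> ev a' 0 * - (ys 0 ^ e) \<noteq> ev b' 0 * (1 + ys 0) ^ e"
  proof (rule ccontr)
    assume "\<not> ?thesis"
    then have "ev a 0 * - (ys 0 ^ e) = ev b 0 * (1 + ys 0) ^ e" "ev a' 0 * - (ys 0 ^ e) = ev b' 0 * (1 + ys 0) ^ e" by auto
    then have "(ev a 0 * ev b' 0 - ev b 0 * ev a' 0) * (1 + ys 0) ^ e = 0" by (rule parallel_cancel)
    then show False using ind x0 by simp
  qed
  then have "(real (2 * k * s) - real (k * s) - real e) * ht \<le> ln (real ((3 * k) choose k))"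
    using ht_le_of_triple_above[OF T(1) \<kappa>, of e] ht_le_of_triple_above[OF T(2) \<kappa>, of e] zero(2) r' by auto
  moreover have "real (2 * k * s) - real (k * s) - real e = 3 * real k * real s - real r" unfolding r' by simp
  ultimately show ?thesis by (simp only:)
qed

lemma ht_le_pade_below:
  assumes k: "0 < k" and xy0: "1 + ys 0 \<noteq> 0" "ys 0 \<noteq> 0" and zero: "zero_exponent s" "zero_exponent r" and r: "r \<le> 2 * k * s"
  shows "(2 * real r - 3 * real k * real s) * ht \<le> ln (real ((3 * k) choose k))"
proof -
  define f where "f = 2 * k * s - r"
  have r': "2 * k * s = r + f" using r by (simp add: f_def)
  obtain a b c a' b' c' where T: "relation_triple (k * s) (2 * k * s) (real ((3 * k) choose k)) a b c"
     "relation_triple (k * s) (2 * k * s) (real ((3 * k) choose k)) a' b' c'" and ind: "ev a 0 * ev b' 0 \<noteq> ev b 0 * ev a' 0"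
    using pade_triples[OF k zero(1)] by blast
  have \<kappa>: "0 < real ((3 * k) choose k)" using k by (simp add: zero_less_binomial_iff)
  have "- (ev a 0 * (1 + ys 0) ^ f) \<noteq> ev b 0 * ys 0 ^ f \<or> - (ev a' 0 * (1 + ys 0) ^ f) \<noteq> ev b' 0 * ys 0 ^ f"
  proof (rule ccontr)
    assume "\<not> ?thesis"
    then have "ev a 0 * - ((1 + ys 0) ^ f) = ev b 0 * ys 0 ^ f" "ev a' 0 * - ((1 + ys 0) ^ f) = ev b' 0 * ys 0 ^ f" by auto
    then have "(ev a 0 * ev b' 0 - ev b 0 * ev a' 0) * ys 0 ^ f = 0" by (rule parallel_cancel)
    then show False using ind xy0 by simp
  qed
  then have "(real r - real (k * s) - real f) * ht \<le> ln (real ((3 * k) choose k))"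
    using ht_le_of_triple_below[OF T(1) \<kappa> r' zero(2)] ht_le_of_triple_below[OF T(2) \<kappa> r' zero(2)] by blast
  moreover have "real r - real (k * s) - real f = 2 * real r - 3 * real k * real s"
  proof -
    have "real f = 2 * real k * real s - real r" using arg_cong[OF r', of real] by simp
    then show ?thesis by simp
  qed
  ultimately show ?thesis by (simp only:)
qed

end

text \<open>\<open>Y - 1\<close>, \<open>X + 1\<close> and \<open>X + Y\<close> are twice the
  medians of the triangle with sides 1, |X|, |Y|; each equation is the difference of two median
  formulas.\<close>

lemma triangle_medians_strict:
  fixes X Y :: complex
  assumes "X = Y + 1"
  shows "(cmod (Y - 1))\<^sup>2 + 3 * (cmod X)\<^sup>2 = (cmod (X + Y))\<^sup>2 + 3"
    "(cmod (X + 1))\<^sup>2 + 3 * (cmod Y)\<^sup>2 = (cmod (X + Y))\<^sup>2 + 3"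
  unfolding assms cmod_power2 by (simp_all add: power2_eq_square algebra_simps)

context irreducible_roots
begin

lemma ev_cubic:
  "ev (monom 1 s - 1) i = ys i ^ s - 1" "ev (- ([:1,1:] ^ s + 1)) i = - ((1 + ys i) ^ s + 1)"
  "ev ([:1,1:] ^ s + monom 1 s) i = (1 + ys i) ^ s + ys i ^ s"
  by (simp_all add: of_int_poly_hom.hom_uminus of_int_poly_hom.hom_minus of_int_poly_hom.hom_add of_int_poly_hom.hom_power map_poly_monom poly_monom)

text \<open>For \<open>X = Y + 1\<close> one has X^3 (Y - 1) - Y^3 (X + 1) + (X + Y) = 0. At the
  exponent \<open>3s\<close> the degree is only \<open>s\<close>, so this fills the hole around
  \<open>r = 3s\<close> that the Pade bounds leave.\<close>

lemma cubic_triple: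
  assumes zero: "zero_exponent s"
  shows "relation_triple s (3 * s) 4 (monom 1 s - 1) (- ([:1,1:] ^ s + 1)) ([:1,1:] ^ s + monom 1 s)"
proof -
  have ds: "degree ([:1,1:] ^ s :: int poly) \<le> s" using degree_power_le[of "[:1,1::int:]" s] by simp
  have alg: "(Y + 1) ^ 3 * (Y - 1) + Y ^ 3 * - (Y + 1 + 1) + (Y + 1 + Y) = 0" for Y :: complex
    by (simp add: power3_eq_cube algebra_simps)
  have two: "cmod (u + v) \<le> 2 * R" "cmod (u - v) \<le> 2 * R" if "cmod u \<le> R" "cmod v \<le> R" for u v R
    using that norm_triangle_ineq[of u v] norm_triangle_ineq4[of u v] by linarith+
  show ?thesis unfolding relation_triple_def ev_cubic
  proof (intro conjI allI impI)
    show "degree (monom 1 s - 1 :: int poly) \<le> s" by (rule degree_diff_le) (auto simp: degree_monom_eq)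
    show "degree (- ([:1,1:] ^ s + 1) :: int poly) \<le> s" unfolding degree_minus by (rule degree_add_le) (use ds in auto)
    show "degree ([:1,1:] ^ s + monom 1 s :: int poly) \<le> s" by (rule degree_add_le) (use ds in \<open>auto simp: degree_monom_eq\<close>)
  next
    fix i assume i: "i < d"
    note z = Fpoly_transfer[OF zero i]
    show "(1 + ys i) ^ (3 * s) * (ys i ^ s - 1) + ys i ^ (3 * s) * - ((1 + ys i) ^ s + 1) + ((1 + ys i) ^ s + ys i ^ s) = 0"
      using alg[of "ys i ^ s"] unfolding mult.commute[of 3 s] power_mult z .
    note pw = norm_power_le_tri_max[of i s]
    have one: "cmod 1 \<le> tri_max (ys i) ^ s" using pw(3) by simp
    have a: "cmod (ys i ^ s - 1) \<le> 2 * tri_max (ys i) ^ s" by (rule two(2)[OF pw(1) one])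
    have b: "cmod (- ((1 + ys i) ^ s + 1)) \<le> 2 * tri_max (ys i) ^ s" unfolding norm_minus_cancel by (rule two(1)[OF pw(2) one])
    have c: "cmod ((1 + ys i) ^ s + ys i ^ s) \<le> 2 * tri_max (ys i) ^ s" by (rule two(1)[OF pw(2) pw(1)])
    show "cmod (ys i ^ s - 1) + cmod (- ((1 + ys i) ^ s + 1)) \<le> 4 * tri_max (ys i) ^ s" using a b by linarith
    show "cmod (- ((1 + ys i) ^ s + 1)) + cmod ((1 + ys i) ^ s + ys i ^ s) \<le> 4 * tri_max (ys i) ^ s" using b c by linarith
    show "cmod ((1 + ys i) ^ s + ys i ^ s) + cmod (ys i ^ s - 1) \<le> 4 * tri_max (ys i) ^ s" using a c by linarith
  qed
qed

text \<open>The relation vector cannot be proportional to \<open>(x^e, -y^e, -1)\<close>: by the median formula its largest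
  entry would belong to the smallest side.\<close>

lemma ht_le_cubic_above:
  assumes q: "(ys 0)\<^sup>2 + ys 0 + 1 \<noteq> 0" and zero: "zero_exponent s" "zero_exponent r" and s: "0 < s" and r: "3 * s \<le> r"
  shows "(5 * real s - real r) * ht \<le> ln 4"
proof -
  define e where "e = r - 3 * s"
  have r': "r = 3 * s + e" using r by (simp add: e_def)
  define x where "x = 1 + ys 0"
  define y where "y = ys 0"
  have X: "x ^ s = y ^ s + 1" using zero(1) by (simp add: x_def y_def)
  have "(y ^ s - 1) * - (y ^ e) \<noteq> - (x ^ s + 1) * x ^ e"
  proof
    assume eq: "(y ^ s - 1) * - (y ^ e) = - (x ^ s + 1) * x ^ e"
    have r1: "x ^ (3 * s) * (y ^ s - 1) + y ^ (3 * s) * - (x ^ s + 1) + (x ^ s + y ^ s) = 0"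
      using cubic_triple[OF zero(1)] deg_pos unfolding relation_triple_def ev_cubic x_def y_def by blast
    have r2: "x ^ (3 * s) * x ^ e + y ^ (3 * s) * - (y ^ e) + -1 = 0"
      using zero(2) unfolding r' by (simp add: power_add x_def y_def)
    note cp = cross_product_parallel[OF r1 r2]
    have "- (x ^ s + 1) * - 1 - (x ^ s + y ^ s) * - (y ^ e) = 0" using cp(1) eq by simp
    then have b: "x ^ s + 1 = - ((x ^ s + y ^ s) * y ^ e)" by (simp add: eq_neg_iff_add_eq_0 algebra_simps)
    have "(x ^ s + y ^ s) * x ^ e - (y ^ s - 1) * - 1 = 0" using cp(2) eq by simp
    then have a: "y ^ s - 1 = - ((x ^ s + y ^ s) * x ^ e)" by (simp add: eq_neg_iff_add_eq_0 algebra_simps)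
    define C where "C = (cmod (x ^ s + y ^ s))\<^sup>2"
    have C0: "0 \<le> C" by (simp add: C_def)
    have sq: "(t ^ e)\<^sup>2 \<le> 1 \<and> (t ^ s)\<^sup>2 < 1" if "0 \<le> t" "t < 1" for t :: real
    proof -
      have "t ^ s < 1" using power_strict_mono[of t 1 s] that s by simp
      then have "(t ^ s)\<^sup>2 < 1" using that by (simp add: power_less_one_iff abs_square_less_1)
      moreover have "(t ^ e)\<^sup>2 \<le> 1" using that by (simp add: power_le_one)
      ultimately show ?thesis by simp
    qed
    have sq': "1 \<le> (t ^ e)\<^sup>2 \<and> 1 < (t ^ s)\<^sup>2" if "1 < t" for t :: real
      using that s by (simp add: one_less_power one_le_power)
    \<comment> \<open>The left side is monotone in \<open>t\<close>, strictly in its second term,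
      and takes the value \<open>C + 3\<close> at \<open>t = 1\<close>.\<close>
    have key: "t = 1" if "C * (t ^ e)\<^sup>2 + 3 * (t ^ s)\<^sup>2 = C + 3" "0 \<le> t" for t :: real
    proof (rule ccontr)
      assume "t \<noteq> 1"
      then consider "t < 1" | "1 < t" by linarith
      then show False
      proof cases
        case 1
        then show False using sq[OF that(2) 1] mult_left_mono[of "(t ^ e)\<^sup>2" 1 C] C0 that(1) by simp
      next
        case 2
        then show False using sq'[OF 2] mult_left_mono[of 1 "(t ^ e)\<^sup>2" C] C0 that(1) by simp
      qed
    qed
    have "(cmod (y ^ s - 1))\<^sup>2 = C * (cmod x ^ e)\<^sup>2" unfolding a C_def by (simp add: norm_mult norm_power power_mult_distrib)
    then have "cmod x = 1"
      using triangle_medians_strict(1)[OF X] unfolding C_def[symmetric] norm_power by (intro key) auto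
    moreover have "(cmod (x ^ s + 1))\<^sup>2 = C * (cmod y ^ e)\<^sup>2" unfolding b C_def by (simp add: norm_mult norm_power power_mult_distrib)
    then have "cmod y = 1"
      using triangle_medians_strict(2)[OF X] unfolding C_def[symmetric] norm_power by (intro key) auto
    ultimately show False using unit_triangle[of y] q by (simp add: x_def y_def)
  qed
  then have nz: "ev (monom 1 s - 1) 0 * - (ys 0 ^ e) \<noteq> ev (- ([:1,1:] ^ s + 1)) 0 * (1 + ys 0) ^ e"
    unfolding ev_cubic x_def y_def .
  have "(real (3 * s) - real s - real e) * ht \<le> ln 4"
    using ht_le_of_triple_above[OF cubic_triple[OF zero(1)] _ zero(2)[unfolded r'] nz] by simp
  then show ?thesis unfolding r' by simp
qed

text \<open>If the relations are parallel, the cubic triple turns into the information that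
  \<open>s - f\<close> is a zero exponent too. Then \<open>ht_le_close\<close> for
  \<open>s - f\<close> and \<open>s\<close> gives the second alternative, as
  \<open>s - 2f = 2r - 5s\<close>.\<close>

lemma ht_le_cubic_below:
  assumes q: "(ys 0)\<^sup>2 + ys 0 + 1 \<noteq> 0" and xy0: "1 + ys 0 \<noteq> 0" "ys 0 \<noteq> 0"
    and zero: "zero_exponent s" "zero_exponent r" and r: "r < 3 * s" "2 * s < r"
  shows "(2 * real r - 4 * real s) * ht \<le> ln 4 \<or> (2 * real r - 5 * real s) * ht \<le> ln 2"
proof -
  define f where "f = 3 * s - r"
  have r': "3 * s = r + f" and f: "0 < f" "f < s" using r by (auto simp: f_def)
  define x where "x = 1 + ys 0"
  define y where "y = ys 0"
  have X: "x ^ s = y ^ s + 1" using zero(1) by (simp add: x_def y_def)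
  have rf: "real f = 3 * real s - real r" using arg_cong[OF r', of real] by simp
  show ?thesis
  proof (cases "- ((y ^ s - 1) * x ^ f) = - (x ^ s + 1) * y ^ f")
    case False
    then have nz: "- (ev (monom 1 s - 1) 0 * (1 + ys 0) ^ f) \<noteq> ev (- ([:1,1:] ^ s + 1)) 0 * ys 0 ^ f"
      unfolding ev_cubic x_def y_def .
    have "(real r - real s - real f) * ht \<le> ln 4"
      using ht_le_of_triple_below[OF cubic_triple[OF zero(1)] _ r' zero(2) nz] by simp
    then show ?thesis unfolding rf by (simp add: algebra_simps)
  next
    case True
    define a where "a = y ^ s - 1"
    define b where "b = - (x ^ s + 1)"
    define c where "c = x ^ s + y ^ s"
    have eq: "- (a * x ^ f) = b * y ^ f" using True by (simp add: a_def b_def)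
    have "x ^ (3 * s) * a + y ^ (3 * s) * b + c = 0"
      using cubic_triple[OF zero(1)] deg_pos unfolding relation_triple_def ev_cubic x_def y_def a_def b_def c_def by blast
    then have r1: "x ^ r * (a * x ^ f) + y ^ r * (b * y ^ f) + c = 0" unfolding r' by (simp add: power_add mult_ac)
    have r2: "x ^ r * 1 + y ^ r * -1 + -1 = 0" using zero(2) by (simp add: x_def y_def)
    note cp = cross_product_parallel[OF r1 r2]
    have c1: "c = b * y ^ f" using cp(1) eq by simp
    have c2: "c = - (a * x ^ f)" using c1 eq by simp
    \<comment> \<open>The cubic triple is orthogonal to \<open>(x^s, y^s, 1)\<close> as well as to
      the vector with exponents \<open>3s\<close>; this second orthogonality yields the new zero
      exponent.\<close>
    have id: "x ^ s * a + y ^ s * b + c = 0" unfolding a_def b_def c_def X by (simp add: algebra_simps)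
    have split: "x ^ s = x ^ (s - f) * x ^ f" "y ^ s = y ^ (s - f) * y ^ f" using f by (simp_all add: power_add[symmetric])
    have "x ^ s * a = x ^ (s - f) * - c" unfolding split c2 by (simp add: mult_ac)
    moreover have "y ^ s * b = y ^ (s - f) * c" unfolding split c1 by (simp add: mult_ac)
    ultimately have "x ^ (s - f) * - c + y ^ (s - f) * c + c = 0" using id by simp
    then have "c * (y ^ (s - f) + 1 - x ^ (s - f)) = 0" by (simp add: algebra_simps)
    moreover have "c \<noteq> 0"
    proof
      assume "c = 0"
      then have "a = 0" using c2 xy0 by (simp add: x_def)
      then have "y ^ s = 1" by (simp add: a_def)
      then show False using \<open>c = 0\<close> X by (simp add: c_def)
    qed
    ultimately have z: "zero_exponent (s - f)" by (simp add: x_def y_def)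
    have "zero_exponent (s - f + f)" using zero(1) f by simp
    from ht_le_close[OF q f(1) z this] have "(real (s - f) - real f) * ht \<le> ln 2" .
    then show ?thesis using f unfolding of_nat_diff[OF less_imp_le[OF f(2)]] rf by simp
  qed
qed

end

section \<open>Numerical comparison of the height bounds for s at least 11\<close>

abbreviation lconst :: real where "lconst \<equiv> ln (27/4)"

lemma lconst_pos: "0 < lconst" by simp

text \<open>All logarithms are measured in units of \<open>lconst\<close>, which turns numerical
  comparisons into inequalities between rational powers.\<close>

lemma ln_less_lconst:
  fixes \<kappa> :: real
  assumes "0 < \<kappa>" "\<kappa> ^ b < (27/4) ^ a" "0 < b"
  shows "ln \<kappa> < real a / real b * lconst"
proof -
  have "ln (\<kappa> ^ b) < ln ((27/4) ^ a)" using assms by (subst ln_less_cancel_iff) auto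
  then have "real b * ln \<kappa> < real a * lconst" by (simp add: ln_realpow)
  then show ?thesis using assms(3) by (simp add: field_simps)
qed

lemma lconst_le_ln:
  fixes \<kappa> :: real
  assumes "0 < \<kappa>" "(27/4) ^ a \<le> \<kappa> ^ b" "0 < b"
  shows "real a / real b * lconst \<le> ln \<kappa>"
proof -
  have "ln ((27/4) ^ a) \<le> ln (\<kappa> ^ b)" using assms by (subst ln_le_cancel_iff) auto
  then have "real a * lconst \<le> real b * ln \<kappa>" by (simp add: ln_realpow)
  then show ?thesis using assms(3) by (simp add: field_simps)
qed

lemma gap_value:
  fixes \<theta> :: real
  assumes "1 < \<theta>" "(27/4) ^ (2 * a) * (1 - 1 / \<theta>\<^sup>2) ^ b \<le> 1" "0 < b"
  shows "real a / real b * lconst \<le> - ln (1 - 1 / \<theta>\<^sup>2) / 2"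
proof -
  have x: "0 < 1 - 1 / \<theta>\<^sup>2" using assms(1) by (simp add: power2_eq_square less_1_mult)
  have "ln ((27/4) ^ (2 * a) * (1 - 1 / \<theta>\<^sup>2) ^ b) \<le> ln 1" using assms(2) x by (subst ln_le_cancel_iff) auto
  then have "real (2 * a) * lconst + real b * ln (1 - 1 / \<theta>\<^sup>2) \<le> 0"
    unfolding ln_mult_pos[OF zero_less_power zero_less_power[OF x]] ln_realpow using x by (simp add: ln_mult_pos ln_realpow)
  then have "real a * lconst \<le> real b * (- ln (1 - 1 / \<theta>\<^sup>2) / 2)" by simp
  then have "real a * lconst / real b \<le> real b * (- ln (1 - 1 / \<theta>\<^sup>2) / 2) / real b" by (intro divide_right_mono) auto
  then show ?thesis using assms(3) by simp
qed

lemma linear_le_power: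
  fixes \<theta> \<rho> :: real
  assumes "\<rho> * 11 \<le> \<theta> ^ 11" "12/11 \<le> \<theta>" "11 \<le> s" "0 \<le> \<rho>"
  shows "\<rho> * real s \<le> \<theta> ^ s"
  using assms(3)
proof (induction s rule: dec_induct)
  case (step n)
  have "\<rho> * real (Suc n) \<le> \<rho> * (12/11 * real n)" using step assms(4) by (intro mult_left_mono) auto
  also have "\<dots> = 12/11 * (\<rho> * real n)" by simp
  also have "\<dots> \<le> \<theta> * \<theta> ^ n" using step assms by (intro mult_mono) auto
  finally show ?case by simp
qed (use assms in simp)

lemma binomial_3k_step:
  "real ((3 * Suc k) choose Suc k) \<le> 27/4 * real ((3 * k) choose k)"
proof -
  have e: "3 * Suc k = Suc (Suc (Suc (3 * k)))" by simp
  have d1: "3 * Suc k - Suc k = Suc (Suc (2 * k))" "3 * k - k = 2 * k" by simp_all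
  define F where "F = (fact (3 * k) :: real) / (fact k * fact (2 * k))"
  have F0: "0 \<le> F" by (simp add: F_def)
  have B: "real ((3 * k) choose k) = F" unfolding F_def using binomial_fact[of k "3 * k", where 'a = real] d1 by simp
  have "real ((3 * Suc k) choose Suc k) = fact (3 * Suc k) / (fact (Suc k) * fact (Suc (Suc (2 * k))))"
    using binomial_fact[of "Suc k" "3 * Suc k", where 'a = real] unfolding d1 by simp
  also have "\<dots> = F * (((3 * real k + 3) * (3 * real k + 2) * (3 * real k + 1)) / ((real k + 1) * (2 * real k + 2) * (2 * real k + 1)))"
    unfolding F_def e fact_Suc by (simp add: divide_simps) (simp add: algebra_simps)
  also have "\<dots> \<le> F * (27/4)"
  proof (rule mult_left_mono[OF _ F0])
    have "(3 * real k + 3) * (3 * real k + 2) * (3 * real k + 1) \<le> 27/4 * ((real k + 1) * (2 * real k + 2) * (2 * real k + 1))"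
    proof -
      have "27/4 * ((real k + 1) * (2 * real k + 2) * (2 * real k + 1)) - (3 * real k + 3) * (3 * real k + 2) * (3 * real k + 1)
          = 27/2 * (real k * real k) + 21 * real k + 15/2" by (simp add: algebra_simps)
      moreover have "0 \<le> real k * real k" by simp
      ultimately show ?thesis by linarith
    qed
    then show "((3 * real k + 3) * (3 * real k + 2) * (3 * real k + 1)) / ((real k + 1) * (2 * real k + 2) * (2 * real k + 1)) \<le> 27/4"
      by (subst pos_divide_le_eq) auto
  qed
  finally show ?thesis using B by simp
qed

lemma product_contradiction:
  fixes g h :: real
  assumes "g * h \<le> B" "B < g0 * h0" "g0 \<le> g" "h0 \<le> h" "0 \<le> g0" "0 \<le> h0"
  shows False
proof -
  have "g0 * h0 \<le> g * h" using assms by (intro mult_mono) auto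
  then show False using assms by linarith
qed

lemma binomials_3k:
  "(3::nat) choose 1 = 3" "(6::nat) choose 2 = 15" "(9::nat) choose 3 = 84" "(12::nat) choose 4 = 495"
  "(15::nat) choose 5 = 3003" "(18::nat) choose 6 = 18564" "(21::nat) choose 7 = 116280"
  by (subst binomial_fact', simp, simp add: fact_numeral)+

lemma ln_values:
  "ln 2 < 4/11 * lconst" "ln 3 < 3/5 * lconst" "ln 4 < 8/11 * lconst" "ln 15 < 10/7 * lconst"
  "ln 84 < 7/3 * lconst" "ln 495 < 10/3 * lconst" "ln 3003 < 21/5 * lconst" "ln 18564 < 26/5 * lconst"
  "ln 116280 < 31/5 * lconst"
  using ln_less_lconst[of 2 11 4] ln_less_lconst[of 3 5 3] ln_less_lconst[of 4 11 8] ln_less_lconst[of 15 7 10]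
    ln_less_lconst[of 84 3 7] ln_less_lconst[of 495 3 10] ln_less_lconst[of 3003 5 21] ln_less_lconst[of 18564 5 26]
    ln_less_lconst[of 116280 5 31]
  by (simp_all add: power_divide)

context irreducible_roots
begin

lemma ht_le_pade:
  assumes k: "0 < k" and xy0: "1 + ys 0 \<noteq> 0" "ys 0 \<noteq> 0" and zero: "zero_exponent s" "zero_exponent r"
    and g: "g \<le> 3 * real k * real s - real r" "g \<le> 2 * real r - 3 * real k * real s"
  shows "g * ht \<le> ln (real ((3 * k) choose k))"
proof (cases "2 * k * s \<le> r")
  case True
  from ht_le_pade_above[OF k xy0(1) zero True] show ?thesis
    using mult_right_mono[OF g(1) ht_nonneg] by linarith
next
  case False
  then have "r \<le> 2 * k * s" by simp
  from ht_le_pade_below[OF k xy0 zero this] show ?thesis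
    using mult_right_mono[OF g(2) ht_nonneg] by linarith
qed

text \<open>The height bound is applied with \<open>k\<close> the integer nearest to about \<open>r / (2 s)\<close>. The binomial coefficients
  grow by a factor of at most \<open>27/4\<close> with \<open>k\<close>, the other side by \<open>\<sigma>\<close> times the logarithm of \<open>27/4\<close>, so
  the case \<open>k = K\<close> suffices.\<close>

lemma no_large_exponent:
  assumes xy0: "1 + ys 0 \<noteq> 0" "ys 0 \<noteq> 0" and zero: "zero_exponent s" "zero_exponent r"
    and \<sigma>: "1 \<le> \<sigma>" "\<sigma> * lconst \<le> real s * ht"
    and K: "2 \<le> K" "ln (real ((3 * K) choose K)) < (real K - 4/3) * \<sigma> * lconst"
    and r: "(6 * K - 2) * s \<le> 3 * r" "0 < s"
  shows False
proof -
  \<comment> \<open>\<open>k\<close> is the integer part of \<open>r / (2s) + 1/3\<close>. The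
    offset 1/3 balances the two factors: both \<open>3ks - r\<close> and \<open>2r - 3ks\<close> are
    then at least \<open>(k - 4/3) s\<close>.\<close>
  define k where "k = (3 * r + 2 * s) div (6 * s)"
  have "6 * s * K \<le> 3 * r + 2 * s" using r(1) K(1) by (simp add: algebra_simps diff_mult_distrib)
  then have kK: "K \<le> k" unfolding k_def using r(2) by (simp add: less_eq_div_iff_mult_less_eq mult.commute)
  have "6 * s * k \<le> 3 * r + 2 * s" unfolding k_def by (rule times_div_less_eq_dividend)
  then have "real (6 * s * k) \<le> real (3 * r + 2 * s)" by (simp only: of_nat_le_iff)
  then have lo: "6 * (real k * real s) \<le> 3 * real r + 2 * real s" by (simp add: algebra_simps)
  have "3 * r + 2 * s < 6 * s * Suc k" 
    using dividend_less_times_div[of "6 * s" "3 * r + 2 * s"] r(2) unfolding k_def[symmetric] by simp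
  then have "real (3 * r + 2 * s) < real (6 * s * Suc k)" by (simp only: of_nat_less_iff)
  then have hi: "3 * real r + 2 * real s < 6 * (real k * real s) + 6 * real s" by (simp add: algebra_simps)
  have bin: "ln (real ((3 * k) choose k)) < (real k - 4/3) * \<sigma> * lconst"
    using kK
  proof (induction k rule: dec_induct)
    case (step n)
    have pos: "0 < real ((3 * n) choose n)" "0 < real ((3 * Suc n) choose Suc n)" by (simp_all add: zero_less_binomial_iff)
    have "ln (real ((3 * Suc n) choose Suc n)) \<le> ln (27/4 * real ((3 * n) choose n))"
      using binomial_3k_step[of n] pos by (subst ln_le_cancel_iff) auto
    also have "\<dots> = lconst + ln (real ((3 * n) choose n))" using pos by (intro ln_mult_pos) auto
    also have "\<dots> < lconst + (real n - 4/3) * \<sigma> * lconst" using step.IH by simp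
    also have "\<dots> \<le> \<sigma> * lconst + (real n - 4/3) * \<sigma> * lconst" using \<sigma>(1) lconst_pos by simp
    also have "\<dots> = (real (Suc n) - 4/3) * \<sigma> * lconst" by (simp add: algebra_simps)
    finally show ?case .
  qed (use K(2) in simp)
  have k0: "0 < k" using kK K(1) by simp
  have "(real k - 4/3) * real s * ht \<le> ln (real ((3 * k) choose k))"
  proof (rule ht_le_pade[OF k0 xy0 zero])
    show "(real k - 4/3) * real s \<le> 3 * real k * real s - real r" using hi by (simp add: left_diff_distrib)
    show "(real k - 4/3) * real s \<le> 2 * real r - 3 * real k * real s" using lo by (simp add: left_diff_distrib)
  qed
  moreover have "(real k - 4/3) * (\<sigma> * lconst) \<le> (real k - 4/3) * (real s * ht)"
    using \<sigma>(2) kK K(1) by (intro mult_left_mono) auto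
  ultimately show False using bin by (simp add: mult.assoc)
qed

lemma ht_ge_basic:
  assumes "ys 0 \<noteq> 0" "1 + ys 0 \<noteq> 0" "(ys 0)\<^sup>2 + ys 0 + 1 \<noteq> 0"
  shows "lconst / 10 \<le> ht"
proof -
  let ?z = "lead_coeff G * poly G 0 * poly G (-1)"
  have "0 \<le> ln \<bar>real_of_int ?z\<bar>"
  proof (cases "?z = 0")
    case False
    then have "1 \<le> \<bar>?z\<bar>" by linarith
    then have "1 \<le> \<bar>real_of_int ?z\<bar>" by linarith
    then show ?thesis by (rule ln_ge_zero)
  next
    \<comment> \<open>With the convention \<open>ln 0 = 0\<close> the bound also holds in this
      case.\<close>
    case True
    then show ?thesis by (simp only: True) simp
  qed
  then have "0 \<le> ln \<bar>real_of_int ?z\<bar> / (5 * real d)" by simp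
  then show ?thesis using ht_ge[OF assms] by linarith
qed

end

lemma gap_value_rational:
  fixes P Q :: nat
  assumes "0 < Q" "Q < P" "27 ^ (2 * a) * (P\<^sup>2 - Q\<^sup>2) ^ b \<le> 4 ^ (2 * a) * (P\<^sup>2) ^ b" "0 < b"
  shows "real a / real b * lconst \<le> - ln (1 - 1 / (real P / real Q)\<^sup>2) / 2"
proof (rule gap_value)
  show "1 < real P / real Q" using assms(1,2) by simp
  have "Q\<^sup>2 \<le> P\<^sup>2" using assms(2) by (intro power_mono) auto
  then have e: "1 - 1 / (real P / real Q)\<^sup>2 = real (P\<^sup>2 - Q\<^sup>2) / real (P\<^sup>2)"
    using assms(1,2) by (simp add: of_nat_diff field_simps)
  have "real (27 ^ (2 * a) * (P\<^sup>2 - Q\<^sup>2) ^ b) \<le> real (4 ^ (2 * a) * (P\<^sup>2) ^ b)" using assms(3) by (simp only: of_nat_le_iff)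
  then have "27 ^ (2 * a) * real (P\<^sup>2 - Q\<^sup>2) ^ b \<le> 4 ^ (2 * a) * real (P\<^sup>2) ^ b" by simp
  moreover have "0 < 4 ^ (2 * a) * real (P\<^sup>2) ^ b" using assms(1,2) by simp
  ultimately have "27 ^ (2 * a) * real (P\<^sup>2 - Q\<^sup>2) ^ b / (4 ^ (2 * a) * real (P\<^sup>2) ^ b) \<le> 1" by (simp only: divide_le_eq_1_pos)
  then show "(27 / 4) ^ (2 * a) * (1 - 1 / (real P / real Q)\<^sup>2) ^ b \<le> 1"
    unfolding e by (simp only: power_divide times_divide_times_eq)
qed (use assms in simp)

context irreducible_roots
begin

text \<open>The range of \<open>r / s\<close> is cut into pieces, each refuted by one upper bound of
  the form "multiple of \<open>s\<close> times the height", against \<open>lconst / 10\<close> or an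
  improved lower bound from the shape of the triangles.\<close>

lemma no_common_exponents_ge_11:
  assumes y0: "ys 0 \<noteq> 0" "1 + ys 0 \<noteq> 0" "(ys 0)\<^sup>2 + ys 0 + 1 \<noteq> 0"
    and s: "11 \<le> s" "s < r" and zero: "zero_exponent s" "zero_exponent r"
  shows False
proof -
  define S R h where "S = real s" and "R = real r" and "h = ht"
  note xy0 = y0(2,1)
  have S: "11 \<le> S" "S < R" using s by (auto simp: S_def R_def)
  have L: "0 < lconst" by (rule lconst_pos)
  have h: "1/10 * lconst \<le> h" using ht_ge_basic[OF y0] by (simp add: h_def)
  have pade: "g * h \<le> ln (real ((3 * k) choose k))" if "0 < k" "g \<le> 3 * real k * S - R" "g \<le> 2 * R - 3 * real k * S" for k g
    using ht_le_pade[OF that(1) xy0 zero] that(2,3) by (simp add: h_def S_def R_def)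
  have close: "(2 * S - R) * h \<le> ln 2"
    using ht_le_close[OF y0(3), of "r - s" s] s zero by (simp add: h_def S_def R_def)
  have gap: "c * lconst \<le> h" if "R \<le> \<rho> * S" "\<rho> * 11 \<le> \<theta> ^ 11" "12/11 \<le> \<theta>" "0 \<le> \<rho>" "c * lconst \<le> - ln (1 - 1 / \<theta>\<^sup>2) / 2" "8 * S \<le> 5 * R" for c \<rho> \<theta>
  proof -
    have "real r \<le> \<theta> ^ s" using linear_le_power[OF that(2,3) s(1) that(4)] that(1) by (simp add: S_def R_def)
    moreover have "8 * s \<le> 5 * r" using that(6) by (simp add: S_def R_def)
    moreover have "18 \<le> r" "0 < s" using s that(6) by (simp_all add: S_def R_def)
    moreover have "1 < \<theta>" using that(3) by simp
    ultimately have "- ln (1 - 1 / \<theta>\<^sup>2) / 2 \<le> h"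
      unfolding h_def by (intro ht_ge_gap[OF y0 _ _ _ zero])
    then show ?thesis using that(5) by linarith
  qed
  \<comment> \<open>7/5, 73/50 and 79/50 satisfy \<open>\<theta>^11 >= 11 * \<rho>\<close> for the
    range ends \<open>\<rho>\<close> = 27/10, 27/5 and 40/3, whence
    \<open>r <= \<theta>^s\<close>.\<close>
  have g1: "2/11 * lconst \<le> - ln (1 - 1 / (7/5)\<^sup>2) / 2"
    using gap_value_rational[of 5 7 2 11] by simp
  have g2: "9/55 * lconst \<le> - ln (1 - 1 / (73/50)\<^sup>2) / 2"
    using gap_value_rational[of 50 73 9 55] by simp
  have g3: "2/15 * lconst \<le> - ln (1 - 1 / (79/50)\<^sup>2) / 2"
    using gap_value_rational[of 50 79 2 15] by simp
  have gap1: "2/11 * lconst \<le> h" if "8 * S \<le> 5 * R" "R \<le> 27/10 * S"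
    by (rule gap[OF that(2) _ _ _ g1 that(1)]) (simp_all add: power_divide)
  have gap2: "9/55 * lconst \<le> h" if "8 * S \<le> 5 * R" "R \<le> 27/5 * S"
    by (rule gap[OF that(2) _ _ _ g2 that(1)]) (simp_all add: power_divide)
  have gap3: "2/15 * lconst \<le> h" if "8 * S \<le> 5 * R" "R \<le> 40/3 * S"
    by (rule gap[OF that(2) _ _ _ g3 that(1)]) (simp_all add: power_divide)
  \<comment> \<open>From 22/3 on, the breakpoints are \<open>2k + 4/3\<close>, where the choice of
    \<open>k\<close> in \<open>no_large_exponent\<close> changes. Below, the relations used are in
    turn \<open>close\<close>, Pade with \<open>k = 1\<close>, cubic, and Pade with
    \<open>k = 2\<close> and \<open>k = 3\<close>.\<close>
  consider "5 * R \<le> 8 * S" | "8 * S < 5 * R" "R \<le> 7/4 * S" | "7/4 * S < R" "R \<le> 27/10 * S" | "27/10 * S < R" "R < 3 * S"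
    | "3 * S \<le> R" "R \<le> 21/5 * S" | "21/5 * S < R" "R \<le> 26/5 * S" | "26/5 * S < R" "R \<le> 27/5 * S"
    | "27/5 * S < R" "R \<le> 22/3 * S" | "22/3 * S < R" "R \<le> 28/3 * S" | "28/3 * S < R" "R \<le> 34/3 * S" | "34/3 * S < R" "R \<le> 40/3 * S"
    | "40/3 * S < R" by linarith
  then show False
  proof cases
    case 1
    show False by (rule product_contradiction[OF close, of "44/10" "1/10 * lconst"]) (use 1 S h L ln_values(1) in linarith)+
  next
    case 2
    have "2/11 * lconst \<le> h" by (rule gap1) (use 2 S in linarith)+
    then show False by - (rule product_contradiction[OF close, of "11/4" "2/11 * lconst"], (use 2 S L ln_values(1) in linarith)+)
  next
    case 3
    have "2/11 * lconst \<le> h" by (rule gap1) (use 3 S in linarith)+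
    moreover have "33/10 * h \<le> ln 3" using pade[of 1 "33/10"] 3 S binomials_3k(1) by simp
    ultimately show False by - (rule product_contradiction[of "33/10" h "ln 3" "33/10" "2/11 * lconst"], (use L ln_values(2) in linarith)+)
  next
    case 4
    have "(2 * R - 4 * S) * h \<le> ln 4 \<or> (2 * R - 5 * S) * h \<le> ln 2"
      using ht_le_cubic_below[OF y0(3) xy0 zero] 4 S by (simp add: S_def R_def h_def)
    then show False
    proof
      assume "(2 * R - 4 * S) * h \<le> ln 4"
      then show False by (rule product_contradiction[of _ _ _ 11 "1/10 * lconst"]) (use 4 S h L ln_values(3) in linarith)+
    next
      assume "(2 * R - 5 * S) * h \<le> ln 2"
      then show False by (rule product_contradiction[of _ _ _ "44/10" "1/10 * lconst"]) (use 4 S h L ln_values(1) in linarith)+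
    qed
  next
    case 5
    have "(5 * S - R) * h \<le> ln 4"
      using ht_le_cubic_above[OF y0(3) zero] 5 S by (simp add: S_def R_def h_def)
    then show False by (rule product_contradiction[of _ _ _ "88/10" "1/10 * lconst"]) (use 5 S h L ln_values(3) in linarith)+
  next
    case 6
    have "9/55 * lconst \<le> h" by (rule gap2) (use 6 S in linarith)+
    moreover have "88/10 * h \<le> ln 15" using pade[of 2 "88/10"] 6 S binomials_3k(2) by simp
    ultimately show False by - (rule product_contradiction[of "88/10" h "ln 15" "88/10" "9/55 * lconst"], (use L ln_values(4) in linarith)+)
  next
    case 7
    have "9/55 * lconst \<le> h" by (rule gap2) (use 7 S in linarith)+
    moreover have "154/10 * h \<le> ln 84" using pade[of 3 "154/10"] 7 S binomials_3k(3) by simp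
    ultimately show False by - (rule product_contradiction[of "154/10" h "ln 84" "154/10" "9/55 * lconst"], (use L ln_values(5) in linarith)+)
  next
    case 8
    have "2/15 * lconst \<le> h" by (rule gap3) (use 8 S in linarith)+
    moreover have "55/3 * h \<le> ln 84" using pade[of 3 "55/3"] 8 S binomials_3k(3) by simp
    ultimately show False by - (rule product_contradiction[of "55/3" h "ln 84" "55/3" "2/15 * lconst"], (use L ln_values(5) in linarith)+)
  next
    case 9
    have "2/15 * lconst \<le> h" by (rule gap3) (use 9 S in linarith)+
    moreover have "29 * h \<le> ln 495" using pade[of 4 29] 9 S binomials_3k(4) by simp
    ultimately show False by - (rule product_contradiction[of 29 h "ln 495" 29 "2/15 * lconst"], (use L ln_values(6) in linarith)+)
  next
    case 10
    have "2/15 * lconst \<le> h" by (rule gap3) (use 10 S in linarith)+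
    moreover have "40 * h \<le> ln 3003" using pade[of 5 40] 10 S binomials_3k(5) by simp
    ultimately show False by - (rule product_contradiction[of 40 h "ln 3003" 40 "2/15 * lconst"], (use L ln_values(7) in linarith)+)
  next
    case 11
    have "2/15 * lconst \<le> h" by (rule gap3) (use 11 S in linarith)+
    moreover have "51 * h \<le> ln 18564" using pade[of 6 51] 11 S binomials_3k(6) by simp
    ultimately show False by - (rule product_contradiction[of 51 h "ln 18564" 51 "2/15 * lconst"], (use L ln_values(8) in linarith)+)
  next
    case 12
    show False
    \<comment> \<open>11/10 is \<open>s >= 11\<close> times the basic height bound 1/10. With it,
      \<open>K = 7\<close> is the first value that meets the numerical condition;
      \<open>K = 6\<close> just fails.\<close>
    proof (rule no_large_exponent[OF xy0 zero, of "11/10" 7])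
      have "11 * (1/10 * lconst) \<le> S * h" using S h L by (intro mult_mono) auto
      then show "11/10 * lconst \<le> real s * ht" by (simp add: S_def h_def)
      show "ln (real ((3 * 7) choose 7)) < (real 7 - 4/3) * (11/10) * lconst" 
      proof -
        have "real ((3 * 7) choose 7) = 116280" using binomials_3k(7) by simp
        moreover have "(real 7 - 4/3) * (11/10) * lconst = 187/30 * lconst" by simp
        ultimately show ?thesis using ln_values(9) L by (simp only:)
      qed
      show "(6 * 7 - 2) * s \<le> 3 * r" using 12 by (simp add: S_def R_def)
    qed (use s in auto)
  qed
qed

end

section \<open>Exponents below eleven\<close>

text \<open>Take the primitive part of an annihilating polynomial of least degree.\<close>

lemma ex_irreducible_int_poly:
  fixes f :: "int poly" and y :: complex
  assumes "f \<noteq> 0" "poly (of_int_poly f) y = 0"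
  shows "\<exists>G. irreducible G \<and> degree G > 0 \<and> poly (of_int_poly G) y = 0"
proof -
  define P where "P g \<longleftrightarrow> g \<noteq> 0 \<and> poly (of_int_poly g) y = 0" for g :: "int poly"
  have "P f" using assms by (simp add: P_def)
  then obtain g where g: "P g" and least: "\<And>g'. P g' \<Longrightarrow> degree g \<le> degree g'"
    using ex_has_least_nat[of P f degree] by blast
  define G where "G = primitive_part g"
  have g_eq: "g = smult (content g) G" by (simp add: G_def)
  have "content g \<noteq> 0" using g by (simp add: P_def)
  have G0: "G \<noteq> 0" using g by (simp add: G_def P_def)
  have "poly (of_int_poly (smult (content g) G)) y = 0" using g g_eq by (simp add: P_def)
  then have Gy: "poly (of_int_poly G) y = 0" using \<open>content g \<noteq> 0\<close> by (simp add: of_int_hom.map_poly_hom_smult)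
  have dG: "degree G = degree g" by (simp add: G_def)
  have cG: "content G = 1" using g by (simp add: G_def P_def)
  have pos: "degree G > 0"
  proof (rule ccontr)
    assume "\<not> ?thesis"
    then obtain c where "G = [:c:]" by (metis degree_eq_zeroE gr0I)
    then show False using G0 Gy by simp
  qed
  have const_unit: "is_unit b" if ab: "G = a * b" and db: "degree b = 0" for a b
  proof -
    obtain c where c: "b = [:c:]" using db by (metis degree_eq_zeroE)
    have "[:c:] dvd G" unfolding ab c by (rule dvd_triv_right)
    then have "c dvd 1" using cG by (metis const_poly_dvd_iff_dvd_content)
    then show ?thesis unfolding c by (simp add: is_unit_const_poly_iff)
  qed
  have "irreducible G"
  proof (rule irreducibleI)
    show "\<not> is_unit G" using pos by (auto simp: is_unit_poly_iff)
    fix a b assume ab: "G = a * b"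
    then have nz: "a \<noteq> 0" "b \<noteq> 0" using G0 by auto
    have "poly (of_int_poly a) y * poly (of_int_poly b) y = 0" using Gy unfolding ab by (simp add: of_int_poly_hom.hom_mult)
    then consider "P a" | "P b" using nz by (auto simp: P_def)
    then show "is_unit a \<or> is_unit b"
    proof cases
      case 1
      then have "degree b = 0" using least[of a] dG nz unfolding ab by (simp add: degree_mult_eq)
      then show ?thesis using const_unit[OF ab] by blast
    next
      case 2
      then have "degree a = 0" using least[of b] dG nz unfolding ab by (simp add: degree_mult_eq)
      then show ?thesis using const_unit[of b a] ab by (simp add: mult.commute)
    qed
  qed (use G0 in simp)
  then show ?thesis using pos Gy by blast
qed

lemma odd_degree_real_root:
  fixes p :: "real poly"
  assumes "odd (degree p)"
  shows "\<exists>x. poly p x = 0"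
proof -
  have main: "\<exists>x. poly p x = 0" if odd: "odd (degree p)" and pos: "lead_coeff p > 0" for p :: "real poly"
  proof -
    obtain n where n: "\<And>x. n \<le> x \<Longrightarrow> lead_coeff p \<le> poly p x" using poly_pinfty_gt_lc[OF pos] by blast
    define q where "q = - pcompose p [:0, -1:]"
    have "lead_coeff q = lead_coeff p" using odd using lead_coeff_comp[of "[:0, -1:]" p] by (simp add: q_def)
    then obtain m where m: "\<And>x. m \<le> x \<Longrightarrow> lead_coeff p \<le> poly q x" using poly_pinfty_gt_lc[of q] pos by auto
    define a where "a = max \<bar>m\<bar> \<bar>n\<bar> + 1"
    have an: "n \<le> a" and am: "m \<le> a" unfolding a_def by linarith+
    have "0 < poly p a" using n[OF an] pos by linarith
    moreover have "poly p (- a) < 0" using m[OF am] pos by (simp add: q_def poly_pcompose)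
    moreover have "- a < a" by (simp add: a_def)
    ultimately show ?thesis using poly_IVT_pos[of "- a" a p] by blast
  qed
  have "p \<noteq> 0" using assms by auto
  then have "lead_coeff p \<noteq> 0" by simp
  then have "lead_coeff p > 0 \<or> lead_coeff (- p) > 0" unfolding lead_coeff_minus by linarith
  then show ?thesis using main[of p] main[of "- p"] assms by auto
qed

lemma superadditive_power:
  fixes a b :: real
  assumes "0 < a" "0 < b" "2 \<le> n"
  shows "a ^ n + b ^ n < (a + b) ^ n"
proof -
  obtain m where n: "n = Suc (Suc m)" using assms(3) by (metis Suc_le_D numeral_2_eq_2 Suc_le_mono)
  have "a ^ Suc m < (a + b) ^ Suc m" "b ^ Suc m < (a + b) ^ Suc m" using assms by (intro power_strict_mono; simp)+
  then have "a * a ^ Suc m + b * b ^ Suc m < a * (a + b) ^ Suc m + b * (a + b) ^ Suc m"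
    using assms by (intro add_strict_mono mult_strict_left_mono) auto
  then show ?thesis by (simp add: n algebra_simps)
qed

text \<open>On each of the three open intervals the equation contradicts the strict superadditivity
  of powers on positive reals. The purpose is that real-root-free factors have even degree and
  constant sign, which makes factorizations easy to exclude.\<close>

lemma real_Fermat_root:
  fixes y :: real
  assumes "(1 + y) ^ n = y ^ n + 1" "2 \<le> n"
  shows "y = 0 \<or> y = - 1"
proof (rule ccontr)
  assume neg: "\<not> ?thesis"
  consider "0 < y" | "- 1 < y" "y < 0" | "y < - 1" using neg by fastforce
  then show False
  proof cases
    case 1
    then show False using superadditive_power[of 1 y n] assms by simp
  next
    case 2
    have a: "(1 + y) ^ n + (- y) ^ n < 1" using superadditive_power[of "1 + y" "- y" n] 2 assms(2) by simp
    show False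
    proof (cases "even n")
      case True
      then have "(- y) ^ n = y ^ n" "0 \<le> y ^ n" by (simp_all add: zero_le_even_power)
      then show False using a assms(1) by linarith
    next
      case False
      then have "(- y) ^ n = - (y ^ n)" by simp
      then show False using a assms(1) by linarith
    qed
  next
    case 3
    have a: "(- (1 + y)) ^ n + 1 < (- y) ^ n" using superadditive_power[of "- (1 + y)" 1 n] 3 assms(2) by simp
    show False
    proof (cases "even n")
      case True
      then have "(- y) ^ n = y ^ n" "(- (1 + y)) ^ n = (1 + y) ^ n" by (rule power_minus_even)+
      then show False using a assms(1) by linarith
    next
      case False
      then have "(- y) ^ n = - (y ^ n)" "(- (1 + y)) ^ n = - ((1 + y) ^ n)" by (rule power_minus_odd)+
      then show False using a assms(1) by linarith
    qed
  qed
qed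

lemma int_poly_factor_sign:
  fixes A K :: "int poly"
  assumes "K dvd A" "\<And>x::real. poly (of_int_poly A) x \<noteq> 0"
  shows "even (degree K)" "0 < poly K 0 * poly K z"
proof -
  obtain L where L: "A = K * L" using assms(1) by blast
  have nr: "poly (of_int_poly K) x \<noteq> 0" for x :: real
    using assms(2)[of x] unfolding L by (auto simp: of_int_poly_hom.hom_mult)
  show "even (degree K)" using odd_degree_real_root[of "of_int_poly K"] nr by auto
  have e: "poly (of_int_poly K) (of_int z) = (of_int (poly K z) :: real)" for z by simp
  have same: False if "poly K a * poly K b < 0" "a < b" for a b
  proof -
    have "(poly K a < 0 \<and> 0 < poly K b) \<or> (0 < poly K a \<and> poly K b < 0)" using that(1) by (simp add: mult_less_0_iff) blast
    then show False
      using poly_IVT_pos[of "of_int a" "of_int b" "of_int_poly K :: real poly"] poly_IVT_neg[of "of_int a" "of_int b" "of_int_poly K :: real poly"]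
        that(2) nr unfolding e by fastforce
  qed
  have nz: "poly K a \<noteq> 0" for a using nr[of "of_int a"] unfolding e by simp
  show "0 < poly K 0 * poly K z"
  proof (rule ccontr)
    assume "\<not> ?thesis"
    then have neg: "poly K 0 * poly K z < 0" using nz[of 0] nz[of z] by (metis mult_eq_0_iff linorder_neqE_linordered_idom)
    then have "z \<noteq> 0" by (auto simp: mult_less_0_iff)
    then show False using same[of 0 z] same[of z 0] neg by (cases "z < 0") (auto simp: mult.commute)
  qed
qed

lemma two_power_mod:
  assumes "(2::int) ^ k mod m = 1"
  shows "(2::int) ^ r mod m = 2 ^ (r mod k) mod m"
proof -
  have "(2::int) ^ r = (2 ^ k) ^ (r div k) * 2 ^ (r mod k)"
    by (simp add: power_mult[symmetric] power_add[symmetric])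
  also have "\<dots> mod m = ((2 ^ k mod m) ^ (r div k) mod m) * 2 ^ (r mod k) mod m"
    by (simp add: mod_mult_left_eq power_mod)
  also have "\<dots> = 2 ^ (r mod k) mod m" unfolding assms by (simp add: mod_mult_left_eq)
  finally show ?thesis .
qed

lemma coeff_Fpoly:
  assumes "0 < n"
  shows "coeff (Fpoly n) i = (if i = 0 \<or> i \<ge> n then 0 else int (n choose i))"
proof -
  have "coeff ([:1, 1:] ^ n) i = int (n choose i)"
  proof (cases "i \<le> n")
    case True then show ?thesis using coeff_linear_poly_power[of i n 1 "1::int"] by simp
  next
    case False
    then have "degree ([:1, 1::int:] ^ n) < i" by (simp add: degree_linear_power degree_power_eq)
    then show ?thesis using False by (simp add: coeff_eq_0 binomial_eq_0)
  qed
  then show ?thesis using assms unfolding Fpoly_def by (auto simp: coeff_1 not_le)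
qed

lemma Fpoly_coeffs:
  assumes "2 \<le> n"
  shows "coeff (Fpoly n) 0 = 0" "coeff (Fpoly n) 1 = int n" "degree (Fpoly n) = n - 1" "lead_coeff (Fpoly n) = int n"
proof -
  have c: "coeff (Fpoly n) i = (if i = 0 \<or> i \<ge> n then 0 else int (n choose i))" for i
    using assms by (intro coeff_Fpoly) simp
  show "coeff (Fpoly n) 0 = 0" "coeff (Fpoly n) 1 = int n" using assms by (simp_all add: c)
  have l: "coeff (Fpoly n) (n - 1) = int n"
  proof -
    obtain m where "n = Suc (Suc m)" using assms by (metis Suc_le_D numeral_2_eq_2 Suc_le_mono)
    then have "n choose (n - 1) = n" by (simp del: binomial_Suc_Suc)
    then show ?thesis using assms by (simp add: c)
  qed
  show d: "degree (Fpoly n) = n - 1"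
  proof (rule antisym)
    show "degree (Fpoly n) \<le> n - 1" by (rule degree_le) (use assms in \<open>auto simp: c\<close>)
    show "n - 1 \<le> degree (Fpoly n)" by (rule le_degree) (use l assms in simp)
  qed
  show "lead_coeff (Fpoly n) = int n" unfolding d by (rule l)
qed

lemma poly_Fpoly_1: "poly (Fpoly n) 1 = 2 ^ n - 2"
  by (simp add: Fpoly_def poly_monom)

text \<open>The Newton polygon of a product is the sum of those of the factors; by hypothesis that of \<open>G * K\<close>
  meets the axis in a single point, while both ends of that of \<open>G\<close> lie on the axis.\<close>

lemma dvd_mult_single_coeff:
  fixes G K :: "int poly" and p :: int
  assumes p: "prime p" and lead: "\<not> p dvd lead_coeff G" and const: "\<not> p dvd coeff G 0"
    and coeffs: "\<And>i. \<not> p dvd coeff (G * K) i \<longleftrightarrow> i = m"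
  shows "degree G = 0"
proof -
  have ex: "\<exists>j. \<not> p dvd coeff K j"
  proof (rule ccontr)
    assume "\<not> ?thesis"
    then have "p dvd coeff (G * K) m" unfolding coeff_mult by (intro dvd_sum dvd_mult) auto
    then show False using coeffs by blast
  qed
  have bound: "j \<le> degree K" if "\<not> p dvd coeff K j" for j using that by (metis dvd_0_right le_degree)
  define a where "a = (LEAST j. \<not> p dvd coeff K j)"
  define b where "b = (GREATEST j. \<not> p dvd coeff K j)"
  have a: "\<not> p dvd coeff K a" unfolding a_def by (rule LeastI_ex) (rule ex)
  have a': "p dvd coeff K j" if "j < a" for j using not_less_Least[of j "\<lambda>j. \<not> p dvd coeff K j"] that unfolding a_def by blast
  have b: "\<not> p dvd coeff K b" unfolding b_def using ex bound by (elim exE) (rule GreatestI_nat[where b = "degree K"], auto)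
  have b': "p dvd coeff K j" if "b < j" for j
    using Greatest_le_nat[of "\<lambda>j. \<not> p dvd coeff K j" j "degree K"] bound that unfolding b_def by force
  have ab: "a \<le> b" using a' b by (meson not_le)
  have "\<not> p dvd coeff (G * K) a"
  proof
    assume h: "p dvd coeff (G * K) a"
    have "coeff (G * K) a = coeff G 0 * coeff K a + (\<Sum>i\<in>{1..a}. coeff G i * coeff K (a - i))"
      unfolding coeff_mult by (simp add: sum.atLeast_Suc_atMost atLeast0AtMost[symmetric])
    moreover have "p dvd (\<Sum>i\<in>{1..a}. coeff G i * coeff K (a - i))"
      by (intro dvd_sum dvd_mult a') auto
    ultimately have "p dvd coeff G 0 * coeff K a" using h by (simp only: dvd_add_left_iff)
    then show False using prime_dvd_multD[OF p] const a by blast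
  qed
  moreover have "\<not> p dvd coeff (G * K) (degree G + b)"
  proof
    let ?d = "degree G"
    assume h: "p dvd coeff (G * K) (?d + b)"
    have "coeff (G * K) (?d + b) = (\<Sum>i\<in>{..?d + b} - {?d}. coeff G i * coeff K (?d + b - i)) + coeff G ?d * coeff K b"
      unfolding coeff_mult by (subst sum.remove[of _ ?d]) auto
    moreover have "p dvd (\<Sum>i\<in>{..?d + b} - {?d}. coeff G i * coeff K (?d + b - i))"
    proof (rule dvd_sum)
      fix i assume i: "i \<in> {..?d + b} - {?d}"
      show "p dvd coeff G i * coeff K (?d + b - i)"
      proof (cases "i < ?d")
        case True then show ?thesis by (intro dvd_mult b') auto
      next
        case False then show ?thesis using i by (simp add: coeff_eq_0)
      qed
    qed
    ultimately have "p dvd coeff G ?d * coeff K b" using h by (simp only: dvd_add_right_iff)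
    then show False using prime_dvd_multD[OF p] lead b by blast
  qed
  ultimately have "a = m" "degree G + b = m" using coeffs by blast+
  then show ?thesis using ab by simp
qed

text \<open>The numbers are coefficients and values of a quadratic factor \<open>H = a Y^2 + b Y + c\<close>: \<open>v = H(-1)\<close>, and the
  last three divisors are \<open>H(1)\<close>, \<open>H(2)\<close> and \<open>H(-2)\<close>.\<close>

lemma quadratic_factor_values:
  fixes A K :: "int poly"
  assumes K: "K dvd A" "degree K = 2" and nr: "\<And>x::real. poly (of_int_poly A) x \<noteq> 0"
    and A0: "\<bar>poly A 0\<bar> \<le> 8"
  obtains a c v :: int where "0 < a" "0 < c" "0 < v" "a dvd lead_coeff A" "c dvd poly A 0" "v dvd poly A (- 1)"
    "2 * (a + c) - v dvd poly A 1" "6 * a + 3 * c - 2 * v dvd poly A 2" "2 * a - c + 2 * v dvd poly A (- 2)"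
proof -
  have "\<exists>H. H dvd A \<and> degree H = 2 \<and> 0 < poly H 0"
  proof (cases "0 < poly K 0")
    case False
    have "0 < poly (- K) 0" using int_poly_factor_sign(2)[OF K(1) nr, of 0] False by (auto simp: zero_less_mult_iff)
    then show ?thesis using K by (intro exI[of _ "- K"]) auto
  qed (use K in blast)
  then obtain H where H: "H dvd A" "degree H = 2" "0 < poly H 0" by blast
  obtain c b a where H_eq: "H = [:c, b, a:]" and a: "a \<noteq> 0" 
  proof -
    have "H = [:coeff H 0, coeff H 1, coeff H 2:]"
    proof (rule poly_eqI)
      fix n :: nat
      consider "n = 0" | "n = 1" | "n = 2" | "2 < n" by linarith
      then show "coeff H n = coeff [:coeff H 0, coeff H 1, coeff H 2:] n"
        by cases (use H(2) in \<open>auto simp: coeff_pCons coeff_eq_0 numeral_2_eq_2 split: nat.splits\<close>)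
    qed
    moreover have "coeff H 2 \<noteq> 0" using H(2) leading_coeff_0_iff[of H] by auto
    ultimately show ?thesis using that by blast
  qed
  have pos: "0 < poly H z" for z
    using int_poly_factor_sign(2)[OF H(1) nr, of z] H(3) by (simp add: zero_less_mult_iff)
  have dv: "poly H z dvd poly A z" for z using H(1) by (auto elim!: dvdE)
  have c: "0 < c" using H(3) by (simp add: H_eq)
  have "poly A 0 \<noteq> 0" using nr[of 0] by (simp add: poly_0_coeff_0)
  moreover have "c dvd poly A 0" using dv[of 0] by (simp add: H_eq)
  ultimately have "c \<le> 8" using A0 dvd_imp_le_int[of "poly A 0" c] by linarith
  \<comment> \<open>\<open>H(3) + H(-3) = 18a + 2c\<close> is positive and \<open>c <= 8\<close>, so
    \<open>a\<close> cannot be negative. This is where the bound on \<open>poly A 0\<close>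
    enters.\<close>
  then have "0 < a" using pos[of 3] pos[of "-3"] a by (simp add: H_eq)
  moreover have "0 < a - b + c" using pos[of "-1"] by (simp add: H_eq)
  moreover have "a dvd lead_coeff A"
  proof -
    obtain L where "A = H * L" using H(1) by blast
    then have "lead_coeff A = lead_coeff H * lead_coeff L" by (simp add: lead_coeff_mult)
    moreover have "lead_coeff H = a" using a by (simp add: H_eq)
    ultimately show ?thesis by simp
  qed
  moreover have "a - b + c dvd poly A (- 1)" using dv[of "-1"] by (simp add: H_eq algebra_simps)
  moreover have "2 * (a + c) - (a - b + c) dvd poly A 1" using dv[of 1] by (simp add: H_eq algebra_simps)
  moreover have "6 * a + 3 * c - 2 * (a - b + c) dvd poly A 2" using dv[of 2] by (simp add: H_eq algebra_simps)
  moreover have "2 * a - c + 2 * (a - b + c) dvd poly A (- 2)" using dv[of "-2"] by (simp add: H_eq algebra_simps)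
  ultimately show ?thesis using c \<open>c dvd poly A 0\<close> that by blast
qed

text \<open>All factors have even degree, so in degree at most 6 a nontrivial factorization has a
  quadratic factor.\<close>

lemma no_proper_factor:
  fixes A G :: "int poly"
  assumes G: "G dvd A" "degree G > 0" and A: "degree A \<le> 6" "content A = 1"
    and nr: "\<And>x::real. poly (of_int_poly A) x \<noteq> 0" and nq: "\<And>K. K dvd A \<Longrightarrow> degree K \<noteq> 2"
  shows "A = G \<or> A = - G"
proof -
  obtain K where K: "A = G * K" using G(1) by blast
  then have KA: "K dvd A" by simp
  have "A \<noteq> 0" using A(2) by auto
  then have "degree G + degree K \<le> 6" using A(1) K by (auto simp: degree_mult_eq)
  moreover have "even (degree G)" "even (degree K)" using int_poly_factor_sign(1)[OF _ nr] G(1) KA by blast+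
  moreover have "degree G \<noteq> 2" "degree K \<noteq> 2" using nq G(1) KA by blast+
  ultimately have "degree K = 0" using G(2) by presburger
  then obtain k where k: "K = [:k:]" by (metis degree_eq_zeroE)
  have "k dvd 1" using KA A(2) unfolding k by (metis const_poly_dvd_iff_dvd_content)
  then have "k = 1 \<or> k = - 1" by (simp add: zdvd1_eq abs_if split: if_splits)
  then show ?thesis unfolding K k by auto
qed

lemma dvd_cases_4:
  fixes u :: int assumes "0 < u" "u dvd 4" shows "u = 1 \<or> u = 2 \<or> u = 4"
proof -
  have "u \<le> 4" using assms zdvd_imp_le by simp
  then consider "u = 1" | "u = 2" | "u = 3" | "u = 4" using assms(1) by linarith
  then show ?thesis by cases (use assms(2) in auto)
qed

lemma dvd_cases_6:
  fixes u :: int assumes "0 < u" "u dvd 6" shows "u = 1 \<or> u = 2 \<or> u = 3 \<or> u = 6"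
proof -
  have "u \<le> 6" using assms zdvd_imp_le by simp
  then consider "u = 1" | "u = 2" | "u = 3" | "u = 4" | "u = 5" | "u = 6" using assms(1) by linarith
  then show ?thesis by cases (use assms(2) in auto)
qed

lemma dvd_cases_3:
  fixes u :: int assumes "0 < u" "u dvd 3" shows "u = 1 \<or> u = 3"
proof -
  have "u \<le> 3" using assms zdvd_imp_le by simp
  then consider "u = 1" | "u = 2" | "u = 3" using assms(1) by linarith
  then show ?thesis by cases (use assms(2) in auto)
qed

lemma dvd_cases_2:
  fixes u :: int assumes "0 < u" "u dvd 2" shows "u = 1 \<or> u = 2"
  using assms zdvd_imp_le[of u 2] by auto

text \<open>The cofactors of \<open>Fpoly 6\<close>, 8, 9 and 10 once numerical factors and the
  roots 0 and -1 that occur are split off. The first three are treated through their lack of proper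
  factors, \<open>A10\<close> through divisibility by 5.\<close>

abbreviation A6 :: "int poly" where "A6 \<equiv> [:6, 15, 20, 15, 6:]"
abbreviation A8 :: "int poly" where "A8 \<equiv> [:4, 14, 28, 35, 28, 14, 4:]"
abbreviation A9 :: "int poly" where "A9 \<equiv> [:3, 9, 19, 23, 19, 9, 3:]"
abbreviation A10 :: "int poly" where "A10 \<equiv> [:10, 45, 120, 210, 252, 210, 120, 45, 10:]"

lemma Fpoly_factors:
  "Fpoly 6 = pCons 0 A6" "Fpoly 8 = smult 2 (pCons 0 A8)" "Fpoly 9 = smult 3 ([:0, 1, 1:] * A9)" "Fpoly 10 = pCons 0 A10"
  unfolding Fpoly_def by code_simp+

lemma Fermat_factor:
  fixes y :: "'a::{comm_ring_1,ring_char_0}"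
  shows "(1 + y) ^ 6 - y ^ 6 - 1 = y * poly (of_int_poly A6) y"
    "(1 + y) ^ 8 - y ^ 8 - 1 = 2 * y * poly (of_int_poly A8) y"
    "(1 + y) ^ 9 - y ^ 9 - 1 = 3 * y * (1 + y) * poly (of_int_poly A9) y"
    "(1 + y) ^ 10 - y ^ 10 - 1 = y * poly (of_int_poly A10) y"
  unfolding poly_Fpoly[symmetric] Fpoly_factors
  by (simp_all only: of_int_poly_hom.hom_mult of_int_hom.map_poly_hom_smult of_int_hom.map_poly_pCons_hom poly_mult poly_smult poly_pCons)
    (simp_all add: algebra_simps)

lemma Fermat_factor_no_real_root:
  fixes x :: real
  shows "poly (of_int_poly A6) x \<noteq> 0" "poly (of_int_poly A8) x \<noteq> 0" "poly (of_int_poly A9) x \<noteq> 0"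
proof -
  have nz: "x \<noteq> 0 \<and> x \<noteq> - 1" if "poly (of_int_poly A) x = 0" "poly A 0 \<noteq> 0" "poly A (- 1) \<noteq> 0" for A :: "int poly"
  proof -
    have "poly (of_int_poly A) (of_int z :: real) = of_int (poly A z)" for z by simp
    from this[of 0] this[of "- 1"] that show ?thesis by auto
  qed
  show "poly (of_int_poly A6) x \<noteq> 0"
  proof
    assume h: "poly (of_int_poly A6) x = 0"
    then have "(1 + x) ^ 6 = x ^ 6 + 1" using Fermat_factor(1)[of x] by (simp only: mult_zero_right)
    then have "x = 0 \<or> x = - 1" by (rule real_Fermat_root) simp
    then show False using nz[OF h] by simp
  qed
  show "poly (of_int_poly A8) x \<noteq> 0"
  proof
    assume h: "poly (of_int_poly A8) x = 0"
    then have "(1 + x) ^ 8 = x ^ 8 + 1" using Fermat_factor(2)[of x] by (simp only: mult_zero_right)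
    then have "x = 0 \<or> x = - 1" by (rule real_Fermat_root) simp
    then show False using nz[OF h] by simp
  qed
  show "poly (of_int_poly A9) x \<noteq> 0"
  proof
    assume h: "poly (of_int_poly A9) x = 0"
    then have "(1 + x) ^ 9 = x ^ 9 + 1" using Fermat_factor(3)[of x] by (simp only: mult_zero_right)
    then have "x = 0 \<or> x = - 1" by (rule real_Fermat_root) simp
    then show False using nz[OF h] by simp
  qed
qed

lemma A6_no_quadratic_factor: "K dvd A6 \<Longrightarrow> degree K \<noteq> 2"
proof
  assume K: "K dvd A6" "degree K = 2"
  obtain a c v :: int where p: "0 < a" "0 < c" "0 < v" and d: "a dvd 6" "c dvd 6" "v dvd 2"
    "2 * (a + c) - v dvd 62" "6 * a + 3 * c - 2 * v dvd 332"
    by (rule quadratic_factor_values[OF K Fermat_factor_no_real_root(1)]) simp_all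
  show False
    using dvd_cases_6[OF p(1) d(1)] dvd_cases_6[OF p(2) d(2)] dvd_cases_2[OF p(3) d(3)] d(4,5) by (elim disjE) simp_all
qed

lemma A8_no_quadratic_factor: "K dvd A8 \<Longrightarrow> degree K \<noteq> 2"
proof
  assume K: "K dvd A8" "degree K = 2"
  obtain a c v :: int where p: "0 < a" "0 < c" "0 < v" and d: "a dvd 4" "c dvd 4" "v dvd 1" "2 * (a + c) - v dvd 127"
    by (rule quadratic_factor_values[OF K Fermat_factor_no_real_root(2)]) simp_all
  show False
    using dvd_cases_4[OF p(1) d(1)] dvd_cases_4[OF p(2) d(2)] p(3) d(3,4) by (elim disjE) simp_all
qed

lemma A9_no_quadratic_factor: "K dvd A9 \<Longrightarrow> degree K \<noteq> 2"
proof
  assume K: "K dvd A9" "degree K = 2"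
  obtain a c v :: int where p: "0 < a" "0 < c" "0 < v" and d: "a dvd 3" "c dvd 3" "v dvd 3"
    "2 * (a + c) - v dvd 85" "6 * a + 3 * c - 2 * v dvd 1065" "2 * a - c + 2 * v dvd 85"
    by (rule quadratic_factor_values[OF K Fermat_factor_no_real_root(3)]) simp_all
  show False
    using dvd_cases_3[OF p(1) d(1)] dvd_cases_3[OF p(2) d(2)] dvd_cases_3[OF p(3) d(3)] d(4-6) by (elim disjE) simp_all
qed

lemma ln_values_ge: "11/6 * lconst \<le> ln 72" "21/16 * lconst \<le> ln 16" "1 * lconst \<le> ln 27" "4/5 * lconst \<le> ln 5"
proof -
  have "real 11 / real 6 * lconst \<le> ln 72" by (rule lconst_le_ln) (simp_all add: power_divide)
  then show "11/6 * lconst \<le> ln 72" by simp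
  have "real 21 / real 16 * lconst \<le> ln 16" by (rule lconst_le_ln) (simp_all add: power_divide)
  then show "21/16 * lconst \<le> ln 16" by simp
  have "real 1 / real 1 * lconst \<le> ln 27" by (rule lconst_le_ln) (simp_all add: power_divide)
  then show "1 * lconst \<le> ln 27" by simp
  have "real 4 / real 5 * lconst \<le> ln 5" by (rule lconst_le_ln) (simp_all add: power_divide)
  then show "4/5 * lconst \<le> ln 5" by simp
qed

context irreducible_roots
begin

text \<open>28/3 is \<open>(6K - 2) / 3\<close> for \<open>K = 5\<close>. The factor 23/20 is what
  \<open>ht_ge\<close> gives with \<open>ln_values_ge\<close> for \<open>s = 6\<close> and
  \<open>s = 8\<close>: 6/10 + 6/20 * 11/6 = 8/10 + 8/30 * 21/16 = 23/20. For \<open>s = 9\<close>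
  and \<open>s = 10\<close> the value is 6/5.\<close>

lemma no_exponent_ge_28_3:
  assumes xy0: "1 + ys 0 \<noteq> 0" "ys 0 \<noteq> 0" and zero: "zero_exponent s" "zero_exponent r"
    and h: "23/20 * lconst \<le> real s * ht" and r: "28 * s \<le> 3 * r" "0 < s"
  shows False
proof (rule no_large_exponent[OF xy0 zero _ h, of 5])
  show "ln (real (3 * 5 choose 5)) < (real 5 - 4/3) * (23/20) * lconst"
  proof -
    have "real ((3 * 5) choose 5) = 3003" using binomials_3k(5) by simp
    moreover have "(real 5 - 4/3) * (23/20) * lconst = 253/60 * lconst" by simp
    ultimately show ?thesis using ln_values(7) lconst_pos by (simp only:)
  qed
qed (use r in auto)

text \<open>As \<open>A\<close> divides \<open>Fpoly r\<close>, its leading coefficient and its value at 1 confine \<open>r\<close> to few residue classes.\<close>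

lemma exponent_constraints:
  assumes A: "A = G \<or> A = - G" and zero: "zero_exponent r" and r: "2 \<le> r"
  shows "poly A 1 dvd 2 ^ r - 2" "lead_coeff A dvd int r"
    "\<bar>lead_coeff A * poly A 0 * poly A (- 1)\<bar> = \<bar>lead_coeff G * poly G 0 * poly G (- 1)\<bar>"
    "degree G = degree A"
proof -
  have "G dvd Fpoly r"
    by (rule irreducible_int_poly_dvd[OF irr root[OF deg_pos] _ deg_pos]) (use zero in \<open>simp add: poly_Fpoly_eq_0\<close>)
  then have "A dvd Fpoly r" using A by auto
  then obtain K where K: "Fpoly r = A * K" by blast
  show "poly A 1 dvd 2 ^ r - 2" using poly_Fpoly_1[of r] unfolding K by (metis poly_mult dvd_triv_left)
  show "lead_coeff A dvd int r" using Fpoly_coeffs(4)[OF r] unfolding K lead_coeff_mult by (metis dvd_triv_left)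
qed (use A in \<open>auto simp: abs_mult\<close>)

text \<open>The last hypothesis offers three certificates for a given \<open>r\<close>: it is large;
  or a Pade bound applies, with \<open>b\<close> the binomial coefficient for \<open>k\<close>,
  \<open>\<beta>\<close> bounding \<open>ln b\<close> in units of \<open>lconst\<close> and
  \<open>g\<close> the available factor; or the cubic bound applies.\<close>

lemma no_common_exponent_of_factor:
  assumes y0: "ys 0 \<noteq> 0" "1 + ys 0 \<noteq> 0" "(ys 0)\<^sup>2 + ys 0 + 1 \<noteq> 0"
    and zero: "zero_exponent s" "zero_exponent r" and s: "2 \<le> s" "s < r"
    and A: "A = G \<or> A = - G"
    and val: "23/20 * lconst \<le> real s * (lconst / 10 + ln \<bar>real_of_int (lead_coeff A * poly A 0 * poly A (-1))\<bar> / (5 * real (degree A)))"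
    and r: "28 * s \<le> 3 * r \<or> (\<exists>k b \<beta> g. (k, b, \<beta>) \<in> {(2::nat, 15::real, 10/7), (3, 84, 7/3), (4, 495, 10/3)} \<and> 
         real g \<le> 3 * real k * real s - real r \<and> real g \<le> 2 * real r - 3 * real k * real s \<and> \<beta> * real s \<le> 23/20 * real g)
         \<or> 3 * s \<le> r \<and> 8/11 * real s \<le> 23/20 * (5 * real s - real r)"
  shows False
proof -
  note xy0 = y0(2,1)
  have e: "\<bar>real_of_int (lead_coeff A * poly A 0 * poly A (-1))\<bar> = \<bar>real_of_int (lead_coeff G * poly G 0 * poly G (-1))\<bar>"
    using exponent_constraints(3)[OF A zero(2)] s by (simp only: of_int_abs[symmetric])
  have "lconst / 10 + ln \<bar>real_of_int (lead_coeff A * poly A 0 * poly A (-1))\<bar> / (5 * real (degree A)) \<le> ht"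
    using ht_ge[OF y0] exponent_constraints(4)[OF A zero(2)] s unfolding e by simp
  then have "real s * (lconst / 10 + ln \<bar>real_of_int (lead_coeff A * poly A 0 * poly A (-1))\<bar> / (5 * real (degree A))) \<le> real s * ht"
    by (intro mult_left_mono) auto
  with val have h: "23/20 * lconst \<le> real s * ht" by linarith
  have small: False if g: "g * ht \<le> ln b" "ln b < \<beta> * lconst" "\<beta> * real s \<le> 23/20 * g" "0 \<le> g" for g b \<beta> :: real
  proof -
    have "23/20 * g * lconst \<le> g * (real s * ht)" using mult_left_mono[OF h g(4)] by (simp add: mult_ac)
    also have "\<dots> = real s * (g * ht)" by (simp add: mult_ac)
    also have "\<dots> \<le> real s * ln b" using g(1) by (intro mult_left_mono) auto
    also have "\<dots> < real s * (\<beta> * lconst)" using g(2) s by (intro mult_strict_left_mono) auto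
    also have "\<dots> = \<beta> * real s * lconst" by (simp add: mult_ac)
    also have "\<dots> \<le> 23/20 * g * lconst" using g(3) lconst_pos by (intro mult_right_mono) auto
    finally show False by simp
  qed
  from r consider "28 * s \<le> 3 * r" | k b \<beta> g where "(k, b, \<beta>) \<in> {(2::nat, 15::real, 10/7), (3, 84, 7/3), (4, 495, 10/3)}" 
         "real g \<le> 3 * real k * real s - real r" "real g \<le> 2 * real r - 3 * real k * real s" "\<beta> * real s \<le> 23/20 * real g"
      | "3 * s \<le> r" "8/11 * real s \<le> 23/20 * (5 * real s - real r)" by blast
  then show False
  proof cases
    case 1
    then show False using no_exponent_ge_28_3[OF xy0 zero h] s by simp
  next
    case (2 k b \<beta> g)
    have kb: "k = 2 \<and> b = 15 \<and> \<beta> = 10/7 \<or> k = 3 \<and> b = 84 \<and> \<beta> = 7/3 \<or> k = 4 \<and> b = 495 \<and> \<beta> = 10/3"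
      using 2(1) by (simp only: insert_iff prod.inject empty_iff) blast
    then have "0 < k" "real ((3 * k) choose k) = b" using binomials_3k by auto
    moreover have "ln b < \<beta> * lconst" using kb ln_values(4,5,6) by metis
    ultimately have k: "0 < k" "real ((3 * k) choose k) = b" "ln b < \<beta> * lconst" by blast+
    have "real g * ht \<le> ln b" using ht_le_pade[OF k(1) xy0 zero 2(2,3)] k(2) by simp
    then show False using small[OF _ k(3) 2(4)] by simp
  next
    case 3
    have "(5 * real s - real r) * ht \<le> ln 4" using ht_le_cubic_above[OF y0(3) zero] 3(1) s by simp
    moreover have "0 \<le> 5 * real s - real r"
    proof -
      have "0 \<le> 8/11 * real s" by simp
      also note 3(2)
      finally show ?thesis by simp
    qed
    ultimately show False using small[OF _ ln_values(3) 3(2)] by simp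
  qed
qed

lemma G_dvd_of_root: "poly (of_int_poly f) (ys 0) = 0 \<Longrightarrow> G dvd f"
  by (rule irreducible_int_poly_dvd[OF irr root[OF deg_pos] _ deg_pos])

end

lemma content_eq_1I:
  fixes A :: "int poly"
  assumes "x * coeff A i + y * coeff A j + z * coeff A k = 1"
  shows "content A = 1"
proof -
  have "content A dvd x * coeff A i + y * coeff A j + z * coeff A k" by (intro dvd_add dvd_mult content_dvd_coeff)
  then have "is_unit (content A)" using assms by simp
  then show ?thesis by (metis normalize_content is_unit_normalize)
qed

lemma content_values: "content A6 = 1" "content A8 = 1" "content A9 = 1"
proof -
  show "content A6 = 1" by (rule content_eq_1I[of 1 _ 0 1 1 "- 1" 2]) (simp add: numeral_2_eq_2)
  show "content A8 = 1" by (rule content_eq_1I[of 9 _ 0 0 1 "- 1" 3]) (simp add: numeral_3_eq_3)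
  show "content A9 = 1" by (rule content_eq_1I[of "- 6" _ 0 0 1 1 2]) (simp add: numeral_2_eq_2)
qed

text \<open>2 has order 5 modulo 31, so \<open>r\<close> is 1 modulo 5. The two analogues below use
  order 7 modulo 127 and order 8 modulo 85.\<close>

lemma exponent_mod_30:
  assumes "62 dvd (2::int) ^ r - 2" "6 dvd int r"
  shows "r mod 30 = 6"
proof -
  have "(31::int) dvd 62" by simp
  then have "31 dvd (2::int) ^ r - 2" using assms(1) by (rule dvd_trans)
  then have "(2::int) ^ r mod 31 = 2" using mod_eq_dvd_iff[of "2 ^ r" 31 "2::int"] by simp
  then have m: "(2::int) ^ (r mod 5) mod 31 = 2" using two_power_mod[of 5 31 r] by simp
  have "r mod 5 < 5" by simp
  then have "r mod 5 = 0 \<or> r mod 5 = 1 \<or> r mod 5 = 2 \<or> r mod 5 = 3 \<or> r mod 5 = 4" by linarith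
  then have "r mod 5 = 1" using m by (elim disjE) simp_all
  moreover have "6 dvd r" using assms(2) by presburger
  ultimately show ?thesis by presburger
qed

lemma exponent_mod_28:
  assumes "127 dvd (2::int) ^ r - 2" "4 dvd int r"
  shows "r mod 28 = 8"
proof -
  have "(2::int) ^ r mod 127 = 2" using assms(1) mod_eq_dvd_iff[of "2 ^ r" 127 "2::int"] by simp
  then have m: "(2::int) ^ (r mod 7) mod 127 = 2" using two_power_mod[of 7 127 r] by simp
  have "r mod 7 < 7" by simp
  then have "r mod 7 = 0 \<or> r mod 7 = 1 \<or> r mod 7 = 2 \<or> r mod 7 = 3 \<or> r mod 7 = 4 \<or> r mod 7 = 5 \<or> r mod 7 = 6" by linarith
  then have "r mod 7 = 1" using m by (elim disjE) simp_all
  moreover have "4 dvd r" using assms(2) by presburger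
  ultimately show ?thesis by presburger
qed

lemma exponent_mod_24:
  assumes "85 dvd (2::int) ^ r - 2" "3 dvd int r"
  shows "r mod 24 = 9"
proof -
  have "(2::int) ^ r mod 85 = 2" using assms(1) mod_eq_dvd_iff[of "2 ^ r" 85 "2::int"] by simp
  then have m: "(2::int) ^ (r mod 8) mod 85 = 2" using two_power_mod[of 8 85 r] by simp
  have "r mod 8 < 8" by simp
  then have "r mod 8 = 0 \<or> r mod 8 = 1 \<or> r mod 8 = 2 \<or> r mod 8 = 3 \<or> r mod 8 = 4 \<or> r mod 8 = 5 \<or> r mod 8 = 6 \<or> r mod 8 = 7" by linarith
  then have "r mod 8 = 1" using m by (elim disjE) simp_all
  moreover have "3 dvd r" using assms(2) by presburger
  ultimately show ?thesis by presburger
qed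

context irreducible_roots
begin

lemma no_common_exponents_6:
  assumes y0: "ys 0 \<noteq> 0" "1 + ys 0 \<noteq> 0" "(ys 0)\<^sup>2 + ys 0 + 1 \<noteq> 0"
    and zero: "zero_exponent 6" "zero_exponent r" and r: "6 < r"
  shows False
proof -
  have "ys 0 * poly (of_int_poly A6) (ys 0) = 0" unfolding Fermat_factor(1)[symmetric] zero(1) by simp
  then have "poly (of_int_poly A6) (ys 0) = 0" using y0(1) by (simp only: mult_eq_0_iff zero_neq_numeral[symmetric] simp_thms)
  then have "G dvd A6" by (rule G_dvd_of_root)
  then have A: "A6 = G \<or> A6 = - G"
    by (rule no_proper_factor[OF _ deg_pos _ content_values(1) Fermat_factor_no_real_root(1) A6_no_quadratic_factor]) simp
  have r2: "2 \<le> r" using r by simp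
  have "poly A6 1 = 62" "lead_coeff A6 = 6" by simp_all
  then have "62 dvd (2::int) ^ r - 2" "6 dvd int r" using exponent_constraints(1,2)[OF A zero(2) r2] by metis+
  then have "r mod 30 = 6" by (rule exponent_mod_30)
  then have cases: "r = 36 \<or> 28 * 6 \<le> 3 * r" using r by presburger
  show False
  proof (rule no_common_exponent_of_factor[OF y0 zero _ r A])
    show "23/20 * lconst \<le> real 6 * (lconst / 10 + ln \<bar>real_of_int (lead_coeff A6 * poly A6 0 * poly A6 (-1))\<bar> / (5 * real (degree A6)))"
      using ln_values_ge(1) by simp
    show "28 * 6 \<le> 3 * r \<or> (\<exists>k b \<beta> g. (k, b, \<beta>) \<in> {(2::nat, 15::real, 10/7), (3, 84, 7/3), (4, 495, 10/3)} \<and> 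
         real g \<le> 3 * real k * real 6 - real r \<and> real g \<le> 2 * real r - 3 * real k * real 6 \<and> \<beta> * real 6 \<le> 23/20 * real g)
         \<or> 3 * 6 \<le> r \<and> 8/11 * real 6 \<le> 23/20 * (5 * real 6 - real r)"
      using cases
    proof (elim disjE)
      assume "r = 36" then show ?thesis
        by (intro disjI2 disjI1 exI[of _ "3::nat"] exI[of _ "84::real"] exI[of _ "7/3::real"] exI[of _ "18::nat"]) simp
    qed simp
  qed simp
qed

lemma no_common_exponents_8:
  assumes y0: "ys 0 \<noteq> 0" "1 + ys 0 \<noteq> 0" "(ys 0)\<^sup>2 + ys 0 + 1 \<noteq> 0"
    and zero: "zero_exponent 8" "zero_exponent r" and r: "8 < r"
  shows False
proof -
  have "2 * ys 0 * poly (of_int_poly A8) (ys 0) = 0" unfolding Fermat_factor(2)[symmetric] zero(1) by simp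
  then have "poly (of_int_poly A8) (ys 0) = 0" using y0(1) by (simp only: mult_eq_0_iff zero_neq_numeral[symmetric] simp_thms)
  then have "G dvd A8" by (rule G_dvd_of_root)
  then have A: "A8 = G \<or> A8 = - G"
    by (rule no_proper_factor[OF _ deg_pos _ content_values(2) Fermat_factor_no_real_root(2) A8_no_quadratic_factor]) simp
  have r2: "2 \<le> r" using r by simp
  have "poly A8 1 = 127" "lead_coeff A8 = 4" by simp_all
  then have "127 dvd (2::int) ^ r - 2" "4 dvd int r" using exponent_constraints(1,2)[OF A zero(2) r2] by metis+
  then have "r mod 28 = 8" by (rule exponent_mod_28)
  then have cases: "r = 36 \<or> r = 64 \<or> 28 * 8 \<le> 3 * r" using r by presburger
  show False
  proof (rule no_common_exponent_of_factor[OF y0 zero _ r A])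
    show "23/20 * lconst \<le> real 8 * (lconst / 10 + ln \<bar>real_of_int (lead_coeff A8 * poly A8 0 * poly A8 (-1))\<bar> / (5 * real (degree A8)))"
      using ln_values_ge(2) by simp
    show "28 * 8 \<le> 3 * r \<or> (\<exists>k b \<beta> g. (k, b, \<beta>) \<in> {(2::nat, 15::real, 10/7), (3, 84, 7/3), (4, 495, 10/3)} \<and> 
         real g \<le> 3 * real k * real 8 - real r \<and> real g \<le> 2 * real r - 3 * real k * real 8 \<and> \<beta> * real 8 \<le> 23/20 * real g)
         \<or> 3 * 8 \<le> r \<and> 8/11 * real 8 \<le> 23/20 * (5 * real 8 - real r)"
      using cases
    proof (elim disjE)
      assume "r = 36" then show ?thesis
        by (intro disjI2 disjI1 exI[of _ "2::nat"] exI[of _ "15::real"] exI[of _ "10/7::real"] exI[of _ "12::nat"]) simp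
    next
      assume "r = 64" then show ?thesis
        by (intro disjI2 disjI1 exI[of _ "4::nat"] exI[of _ "495::real"] exI[of _ "10/3::real"] exI[of _ "32::nat"]) simp
    qed simp
  qed simp
qed

lemma no_common_exponents_9:
  assumes y0: "ys 0 \<noteq> 0" "1 + ys 0 \<noteq> 0" "(ys 0)\<^sup>2 + ys 0 + 1 \<noteq> 0"
    and zero: "zero_exponent 9" "zero_exponent r" and r: "9 < r"
  shows False
proof -
  have "3 * ys 0 * (1 + ys 0) * poly (of_int_poly A9) (ys 0) = 0" unfolding Fermat_factor(3)[symmetric] zero(1) by simp
  then have "poly (of_int_poly A9) (ys 0) = 0" using y0(1,2) by (simp only: mult_eq_0_iff zero_neq_numeral[symmetric] simp_thms)
  then have "G dvd A9" by (rule G_dvd_of_root)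
  then have A: "A9 = G \<or> A9 = - G"
    by (rule no_proper_factor[OF _ deg_pos _ content_values(3) Fermat_factor_no_real_root(3) A9_no_quadratic_factor]) simp
  have r2: "2 \<le> r" using r by simp
  have "poly A9 1 = 85" "lead_coeff A9 = 3" by simp_all
  then have "85 dvd (2::int) ^ r - 2" "3 dvd int r" using exponent_constraints(1,2)[OF A zero(2) r2] by metis+
  then have "r mod 24 = 9" by (rule exponent_mod_24)
  then have cases: "r = 33 \<or> r = 57 \<or> r = 81 \<or> 28 * 9 \<le> 3 * r" using r by presburger
  show False
  proof (rule no_common_exponent_of_factor[OF y0 zero _ r A])
    show "23/20 * lconst \<le> real 9 * (lconst / 10 + ln \<bar>real_of_int (lead_coeff A9 * poly A9 0 * poly A9 (-1))\<bar> / (5 * real (degree A9)))"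
    proof -
      have "5 * lconst \<le> 6 * ln 27" using ln_values_ge(3) lconst_pos by linarith
      then show ?thesis by simp
    qed
    show "28 * 9 \<le> 3 * r \<or> (\<exists>k b \<beta> g. (k, b, \<beta>) \<in> {(2::nat, 15::real, 10/7), (3, 84, 7/3), (4, 495, 10/3)} \<and> 
         real g \<le> 3 * real k * real 9 - real r \<and> real g \<le> 2 * real r - 3 * real k * real 9 \<and> \<beta> * real 9 \<le> 23/20 * real g)
         \<or> 3 * 9 \<le> r \<and> 8/11 * real 9 \<le> 23/20 * (5 * real 9 - real r)"
      using cases
    proof (elim disjE)
      assume "r = 57" then show ?thesis
        by (intro disjI2 disjI1 exI[of _ "3::nat"] exI[of _ "84::real"] exI[of _ "7/3::real"] exI[of _ "24::nat"]) simp
    next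
      assume "r = 81" then show ?thesis
        by (intro disjI2 disjI1 exI[of _ "4::nat"] exI[of _ "495::real"] exI[of _ "10/3::real"] exI[of _ "27::nat"]) simp
    qed simp_all
  qed simp
qed

text \<open>All coefficients of \<open>A10\<close> except the middle one, 252, are divisible by 5.
  Hence 5 divides the leading or the constant coefficient of \<open>G\<close>. This has two effects:
  a gain of at least \<open>ln 5 / 40\<close> in the height, and \<open>5 dvd r\<close>, which thins
  out the exponents to be checked.\<close>

lemma no_common_exponents_10:
  assumes y0: "ys 0 \<noteq> 0" "1 + ys 0 \<noteq> 0" "(ys 0)\<^sup>2 + ys 0 + 1 \<noteq> 0"
    and zero: "zero_exponent 10" "zero_exponent r" and r: "10 < r"
  shows False
proof -
  note xy0 = y0(2,1)
  have "ys 0 * poly (of_int_poly A10) (ys 0) = 0" unfolding Fermat_factor(4)[symmetric] zero(1) by simp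
  then have "poly (of_int_poly A10) (ys 0) = 0" using y0(1) by (simp only: mult_eq_0_iff zero_neq_numeral[symmetric] simp_thms)
  then have GA: "G dvd A10" by (rule G_dvd_of_root)
  then obtain K where K: "A10 = G * K" by blast
  have GF: "G dvd Fpoly r" by (rule G_dvd_of_root) (use zero in \<open>simp add: poly_Fpoly_eq_0\<close>)
  then obtain H where H: "Fpoly r = G * H" by blast
  have r2: "2 \<le> r" using r by simp
  have G0: "poly G 0 \<noteq> 0" 
  proof
    assume "poly G 0 = 0"
    then have "poly A10 0 = 0" unfolding K by simp
    then show False by simp
  qed
  have G1: "poly G (- 1) \<noteq> 0" 
  proof
    assume "poly G (- 1) = 0"
    then have "poly A10 (- 1) = 0" unfolding K by simp
    then show False by simp
  qed
  have "5 dvd lead_coeff G \<or> 5 dvd coeff G 0"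
  proof (rule ccontr)
    assume neg: "\<not> ?thesis"
    have "degree G = 0"
    proof (rule dvd_mult_single_coeff)
      show "prime (5::int)" by simp
      show "\<not> 5 dvd coeff (G * K) i \<longleftrightarrow> i = 4" for i unfolding K[symmetric]
        by (auto simp: coeff_pCons split: nat.splits)
    qed (use neg in auto)
    then show False using deg_pos by simp
  qed
  then have prod: "5 dvd lead_coeff G * poly G 0 * poly G (- 1)" and r5: "5 dvd int r"
  proof (atomize (full), elim disjE)
    assume 5: "5 dvd lead_coeff G"
    have "int r = lead_coeff G * lead_coeff H" using Fpoly_coeffs(4)[OF r2] unfolding H lead_coeff_mult by simp
    with 5 show "5 dvd lead_coeff G * poly G 0 * poly G (- 1) \<and> 5 dvd int r" by simp
  next
    assume 5: "5 dvd coeff G 0"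
    \<comment> \<open>\<open>Fpoly r\<close> has constant coefficient 0 and linear coefficient
      \<open>r\<close>. As \<open>G\<close> does not vanish at 0, the cofactor does, so the constant
      coefficient of \<open>G\<close> divides \<open>r\<close>.\<close>
    have "coeff G 0 * coeff H 0 = 0" using Fpoly_coeffs(1)[OF r2] unfolding H by (simp add: coeff_mult)
    then have "coeff H 0 = 0" using G0 by (simp add: poly_0_coeff_0)
    moreover have "int r = coeff G 0 * coeff H 1 + coeff G 1 * coeff H 0"
      using Fpoly_coeffs(2)[OF r2] unfolding H by (simp add: coeff_mult)
    ultimately show "5 dvd lead_coeff G * poly G 0 * poly G (- 1) \<and> 5 dvd int r" using 5 by (simp add: poly_0_coeff_0)
  qed
  have "A10 \<noteq> 0" by simp
  from dvd_imp_degree_le[OF GA this] have d8: "d \<le> 8" by simp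
  have "lead_coeff G \<noteq> 0" using deg_pos by auto
  then have "lead_coeff G * poly G 0 * poly G (- 1) \<noteq> 0" using G0 G1 by simp
  then have "5 \<le> \<bar>lead_coeff G * poly G 0 * poly G (- 1)\<bar>" using dvd_imp_le_int[OF _ prod] by simp
  then have ge5: "5 \<le> \<bar>real_of_int (lead_coeff G * poly G 0 * poly G (- 1))\<bar>" by linarith
  then have "ln 5 \<le> ln \<bar>real_of_int (lead_coeff G * poly G 0 * poly G (- 1))\<bar>" by (intro ln_mono) (simp_all only:)
  moreover have "ln 5 / (5 * 8) \<le> x / (5 * d)" if "ln 5 \<le> x" for x :: real
  proof -
    have "0 \<le> ln (5::real)" by simp
    with that have "0 \<le> x" by linarith
    with that d8 deg_pos show ?thesis by (intro frac_le) auto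
  qed
  ultimately have "ln 5 / (5 * 8) \<le> ln \<bar>real_of_int (lead_coeff G * poly G 0 * poly G (- 1))\<bar> / (5 * d)" by blast
  \<comment> \<open>1/10 + 4/5 * 1/40 = 3/25, using \<open>degree G <= 8\<close>.\<close>
  then have h: "3/25 * lconst \<le> ht" using ht_ge[OF y0] ln_values_ge(4) by linarith
  have L: "0 < lconst" by (rule lconst_pos)
  have pade: "real g * ht \<le> ln (real ((3 * k) choose k))"
    if "0 < k" "real g \<le> 3 * real k * 10 - real r" "real g \<le> 2 * real r - 3 * real k * 10" for k g
    using ht_le_pade[OF that(1) xy0 zero] that(2,3) by simp
  have contra: False if "g * ht \<le> ln b" "ln b < \<beta> * lconst" "\<beta> \<le> 3/25 * g" "0 \<le> g" for g b \<beta> :: real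
  proof -
    have "g * (3/25 * lconst) \<le> g * ht" using h that(4) by (rule mult_left_mono)
    moreover have "\<beta> * lconst \<le> 3/25 * g * lconst" using that(3) L by (intro mult_right_mono) auto
    ultimately show False using that(1,2) by (simp add: mult_ac)
  qed
  have cubic: False if "30 \<le> r" "r \<le> 43"
    using contra[OF _ ln_values(3), of "50 - real r"] ht_le_cubic_above[OF y0(3) zero] that by simp
  obtain q where q: "r = 5 * q" using r5 by (auto simp: int_dvd_int_iff[of 5 r, simplified])
  then have "3 \<le> q" using r by simp
  then have "q \<le> 5 \<or> q = 6 \<or> q = 7 \<or> q = 8 \<or> 9 \<le> q" "q \<le> 5 \<longrightarrow> q = 3 \<or> q = 4 \<or> q = 5"
    "9 \<le> q \<longrightarrow> q = 9 \<or> q = 10 \<or> q = 11 \<or> q = 12 \<or> q = 13 \<or> 14 \<le> q"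
    "14 \<le> q \<longrightarrow> q = 14 \<or> q = 15 \<or> q = 16 \<or> q = 17 \<or> q = 18 \<or> 19 \<le> q" by linarith+
  then have "q = 3 \<or> q = 4 \<or> q = 5 \<or> q = 6 \<or> q = 7 \<or> q = 8 \<or> q = 9 \<or> q = 10 \<or> q = 11 \<or> q = 12 \<or> q = 13
    \<or> q = 14 \<or> q = 15 \<or> q = 16 \<or> q = 17 \<or> q = 18 \<or> 19 \<le> q" by blast
  then have "r \<in> {15, 20, 25, 45, 50, 55, 60, 65, 70, 75, 80, 85, 90} \<or> 30 \<le> r \<and> r \<le> 43 \<or> 95 \<le> r"
    unfolding q by (elim disjE) simp_all
  then consider "r = 15" | "r = 20" | "r = 25" | "30 \<le> r" "r \<le> 43" | "r = 45" | "r = 50" | "r = 55 \<or> r = 60 \<or> r = 65 \<or> r = 70"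
    | "r = 75 \<or> r = 80 \<or> r = 85 \<or> r = 90" | "95 \<le> r" by blast
  then show False
  proof cases
    case 1
    then have "5 * ht \<le> ln 2" using ht_le_close[OF y0(3), of 5 10] zero by simp
    then show False by (rule contra[OF _ ln_values(1)]) simp_all
  next
    case 2
    then have "10 * ht \<le> ln 3" using pade[of 1 10] binomials_3k(1) by simp
    then show False by (rule contra[OF _ ln_values(2)]) simp_all
  next
    case 3
    then have "5 * ht \<le> ln 3" using pade[of 1 5] binomials_3k(1) by simp
    then show False by (rule contra[OF _ ln_values(2)]) simp_all
  next
    case 4
    then show False by (rule cubic)
  next
    case 5
    then have "15 * ht \<le> ln 15" using pade[of 2 15] binomials_3k(2) by simp
    then show False by (rule contra[OF _ ln_values(4)]) simp_all
  next
    case 6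
    \<comment> \<open>At \<open>r = 50\<close> the Pade factor is only 10 for \<open>k = 2\<close>
      and for \<open>k = 3\<close>, and the cubic factor is 0. The triangle bound with (37/25)^10 >=
      50 lifts the height to 3/20 and suffices for \<open>k = 2\<close>.\<close>
    have "- ln (1 - 1 / (real 37 / real 25)\<^sup>2) / 2 \<le> ht"
      by (rule ht_ge_gap[OF y0 _ _ _ zero]) (use 6 in \<open>simp_all add: power_divide\<close>)
    moreover have "real 3 / real 20 * lconst \<le> - ln (1 - 1 / (real 37 / real 25)\<^sup>2) / 2"
      by (rule gap_value_rational) simp_all
    moreover have "10 * ht \<le> ln 15" using pade[of 2 10] 6 binomials_3k(2) by simp
    ultimately show False using ln_values(4) L by simp
  next
    case 7
    have "20 * ht \<le> ln 84" using pade[of 3 20] 7 binomials_3k(3) by auto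
    then show False by (rule contra[OF _ ln_values(5)]) simp_all
  next
    case 8
    have "30 * ht \<le> ln 495" using pade[of 4 30] 8 binomials_3k(4) by auto
    then show False by (rule contra[OF _ ln_values(6)]) simp_all
  next
    case 9
    have "23/20 * lconst \<le> real 10 * ht" unfolding of_nat_numeral using h L by linarith
    then show False by (rule no_exponent_ge_28_3[OF xy0 zero]) (use 9 in simp_all)
  qed
qed

end

theorem Fermat_polynomials_common_root:
  fixes y :: complex
  assumes s: "6 \<le> s" "s \<noteq> 7" "s < r" and zero: "(1 + y) ^ s = y ^ s + 1" "(1 + y) ^ r = y ^ r + 1"
  shows "y = 0 \<or> 1 + y = 0 \<or> y\<^sup>2 + y + 1 = 0"
proof (rule ccontr)
  assume "\<not> ?thesis"
  then have y: "y \<noteq> 0" "1 + y \<noteq> 0" "y\<^sup>2 + y + 1 \<noteq> 0" by simp_all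
  have "lead_coeff (Fpoly s) \<noteq> 0" using Fpoly_coeffs(4)[of s] s by simp
  then have "Fpoly s \<noteq> 0" by simp
  moreover have "poly (of_int_poly (Fpoly s)) y = 0" using zero(1) by (simp add: poly_Fpoly_eq_0)
  ultimately obtain G where G: "irreducible G" "degree G > 0" "poly (of_int_poly G) y = 0"
    using ex_irreducible_int_poly by blast
  obtain zs where "irreducible_roots G zs" using ex_irreducible_roots[OF G(1,2)] by blast
  then interpret Z: irreducible_roots G zs .
  obtain i where i: "i < degree G" "y = zs i" using Z.range G(3) by blast
  \<comment> \<open>The transposition moves the given root \<open>y\<close> to index 0, where the
    preceding results place their hypotheses.\<close>
  define ys where "ys j = zs (Transposition.transpose 0 i j)" for j
  have bij: "bij_betw (Transposition.transpose 0 i) {..<degree G} {..<degree G}"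
    using i(1) G(2) by (intro permutes_imp_bij permutes_swap_id) auto
  have "inj_on ys {..<degree G}"
    unfolding ys_def using bij Z.inj by (metis bij_betw_def comp_inj_on o_def inj_on_cong)
  moreover have "ys ` {..<degree G} = {z. poly (of_int_poly G) z = 0}"
    using bij Z.range unfolding ys_def bij_betw_def by (metis image_image)
  ultimately interpret irreducible_roots G ys by unfold_locales (use G in auto)
  have y_eq: "ys 0 = y" by (simp add: ys_def i(2))
  note y0 = y[folded y_eq] and zero0 = zero[folded y_eq]
  consider "11 \<le> s" | "s = 6" | "s = 8" | "s = 9" | "s = 10" using s by linarith
  then show False
  proof cases
    case 1 then show False using no_common_exponents_ge_11[OF y0 _ s(3) zero0] by simp
  next
    case 2 then show False using no_common_exponents_6[OF y0] zero0 s(3) by simp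
  next
    case 3 then show False using no_common_exponents_8[OF y0] zero0 s(3) by simp
  next
    case 4 then show False using no_common_exponents_9[OF y0] zero0 s(3) by simp
  next
    case 5 then show False using no_common_exponents_10[OF y0] zero0 s(3) by simp
  qed
qed

section \<open>Solutions modulo a prime\<close>

lemma eq_if_dvd_diff:
  fixes p :: int
  assumes "p dvd x - y" "x \<in> {0..<p}" "y \<in> {0..<p}"
  shows "x = y"
  using assms by (metis atLeastLessThan_iff mod_eq_dvd_iff mod_pos_pos_trivial)

lemma card_roots_mod_prime:
  fixes f :: "int poly" and p :: int
  assumes p: "prime p" and lead: "\<not> p dvd lead_coeff f"
    and S: "S \<subseteq> {0..<p}" "\<And>y. y \<in> S \<Longrightarrow> p dvd poly f y"
  shows "card S \<le> degree f"
  using lead S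
proof (induction "degree f" arbitrary: f S)
  case 0
  then obtain c where c: "f = [:c:]" by (metis degree_eq_zeroE)
  then have "S = {}" using 0 by (cases "c = 0") auto
  then show ?case by simp
next
  case (Suc n)
  show ?case
  proof (cases "S = {}")
    case False
    then obtain a where a: "a \<in> S" by blast
    define g where "g = synthetic_div f a"
    have f: "f = [:- a, 1:] * g + [:poly f a:]" unfolding g_def by (simp only: synthetic_div_correct')
    have dg: "degree g = n" unfolding g_def degree_synthetic_div Suc(2)[symmetric] by simp
    have "g \<noteq> 0" using Suc(2) by (metis g_def synthetic_div_eq_0_iff nat.distinct(1))
    have "lead_coeff f = lead_coeff g"
    proof -
      have "degree ([:- a, 1:] * g) = Suc n" using \<open>g \<noteq> 0\<close> dg by (subst degree_mult_eq) auto
      moreover have "coeff [:poly f a:] (Suc n) = 0" by simp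
      ultimately have "coeff f (Suc n) = lead_coeff ([:- a, 1:] * g)" by (subst f) (simp only: coeff_add)
      also have "\<dots> = lead_coeff g" unfolding lead_coeff_mult by simp
      finally show ?thesis using Suc(2) by simp
    qed
    then have lg: "\<not> p dvd lead_coeff g" using Suc.prems(1) by simp
    have "p dvd poly g y" if y: "y \<in> S - {a}" for y
    proof -
      have "poly f y = (y - a) * poly g y + poly f a" by (subst f) (simp add: algebra_simps)
      then have "(y - a) * poly g y = poly f y - poly f a" by simp
      moreover have "p dvd poly f y - poly f a" using Suc.prems(3) a y by (intro dvd_diff) auto
      ultimately have "p dvd (y - a) * poly g y" by simp
      moreover have "\<not> p dvd y - a" using eq_if_dvd_diff[of p y a] Suc.prems(2) a y by blast
      ultimately show ?thesis using prime_dvd_multD[OF p] by blast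
    qed
    then have "card (S - {a}) \<le> degree g" using Suc.prems(2) by (intro Suc(1)[OF dg[symmetric] lg]) auto
    moreover have "finite S" using Suc.prems(2) finite_subset by blast
    ultimately show ?thesis using a dg Suc(2) by (simp add: card_Diff_singleton)
  qed simp
qed

text \<open>This form gives access to \<open>det_coeff_mat_mult_vander\<close>, hence to evaluation
  of the rows at common roots.\<close>

lemma sylvester_mat_eq_coeff_mat:
  fixes f g :: "'a::idom poly"
  defines "T \<equiv> degree f + degree g"
  shows "sylvester_mat f g =
    coeff_mat T (\<lambda>i. if i < degree g then monom 1 (degree g - 1 - i) * f else monom 1 (T - 1 - i) * g)"
proof (rule eq_matI)
  fix i c assume "i < dim_row (coeff_mat T (\<lambda>i. if i < degree g then monom 1 (degree g - 1 - i) * f else monom 1 (T - 1 - i) * g))"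
    "c < dim_col (coeff_mat T (\<lambda>i. if i < degree g then monom 1 (degree g - 1 - i) * f else monom 1 (T - 1 - i) * g))"
  then have ic: "i < T" "c < T" by (simp_all add: coeff_mat_def)
  show "sylvester_mat f g $$ (i, c) =
    coeff_mat T (\<lambda>i. if i < degree g then monom 1 (degree g - 1 - i) * f else monom 1 (T - 1 - i) * g) $$ (i, c)"
  proof (cases "i < degree g")
    case True
    have e: "T - 1 - c - (degree g - 1 - i) = degree f + i - c" "degree g - 1 - i \<le> T - 1 - c \<longleftrightarrow> c \<le> degree f + i"
      using True ic unfolding T_def by auto
    show ?thesis
      using True ic e unfolding coeff_mat_def T_def
      by (subst sylvester_index_mat) (auto simp: coeff_monom_mult coeff_eq_0)
  next
    case False
    have e: "T - 1 - c - (T - 1 - i) = i - c" "T - 1 - i \<le> T - 1 - c \<longleftrightarrow> c \<le> i" using ic by auto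
    show ?thesis
      using False ic e unfolding coeff_mat_def T_def
      by (subst sylvester_index_mat) (auto simp: coeff_monom_mult coeff_eq_0)
  qed
qed (simp_all add: coeff_mat_def T_def)

text \<open>Multiplying the Sylvester matrix by a Vandermonde matrix at the common roots modulo \<open>p\<close> makes \<open>card S\<close>
  columns divisible by \<open>p\<close>, while the Vandermonde determinant is prime to \<open>p\<close>.\<close>

lemma power_card_dvd_resultant:
  fixes f g :: "int poly" and p :: int
  assumes p: "prime p" and S: "S \<subseteq> {0..<p}" "\<And>y. y \<in> S \<Longrightarrow> p dvd poly f y \<and> p dvd poly g y"
    and c: "card S \<le> degree f + degree g"
  shows "p ^ card S dvd resultant f g"
proof -
  define T where "T = degree f + degree g"
  define P where "P i = (if i < degree g then monom 1 (degree g - 1 - i) * f else monom 1 (T - 1 - i) * g)" for i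
  have fin: "finite S" using S(1) finite_subset by blast
  obtain y where y: "bij_betw y {..<card S} S" using ex_bij_betw_nat_finite[OF fin] by (auto simp: atLeast0LessThan)
  have yS: "y i \<in> S" if "i < card S" for i using y that by (auto simp: bij_betw_def)
  have degP: "degree (P i) < T" if "i < T" for i
  proof (cases "i < degree g")
    case True
    then show ?thesis using degree_mult_le[of "monom 1 (degree g - 1 - i)" f] degree_monom_le[of "1::int" "degree g - 1 - i"]
      by (simp add: P_def T_def)
  next
    case False
    then show ?thesis using degree_mult_le[of "monom 1 (T - 1 - i)" g] degree_monom_le[of "1::int" "T - 1 - i"] that
      by (simp add: P_def T_def)
  qed
  let ?M = "mat T T (\<lambda>(i, c). if c < T - card S then coeff (P i) (T - 1 - c) else poly (P i) (y (c - (T - card S))))"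
  have res: "det (coeff_mat T P) = resultant f g"
    unfolding resultant_def sylvester_mat_eq_coeff_mat T_def P_def ..
  have prod: "det (coeff_mat T P) * det (vander (card S) y) = det ?M"
    by (rule det_coeff_mat_mult_vander) (use degP c in \<open>auto simp: T_def\<close>)
  have "p ^ card S dvd det ?M"
  proof (rule power_dvd_det_of_dvd_cols)
    show "card S \<le> T" using c by (simp add: T_def)
    fix i c assume ic: "i < T" "T - card S \<le> c" "c < T"
    then have "y (c - (T - card S)) \<in> S" using \<open>card S \<le> T\<close> by (intro yS) linarith
    then have "p dvd poly (P i) (y (c - (T - card S)))" using S(2) unfolding P_def by auto
    then show "p dvd ?M $$ (i, c)" using ic by simp
  qed simp
  then have "p ^ card S dvd det (coeff_mat T P) * det (vander (card S) y)" unfolding prod .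
  moreover have cop: "algebraic_semidom_class.coprime (p ^ card S) (det (vander (card S) y))"
  proof -
    have "\<not> p dvd y i - y l" if il: "i < card S" "l < card S" "i \<noteq> l" for i l
    proof
      assume "p dvd y i - y l"
      then have "y i = y l" using eq_if_dvd_diff yS[OF il(1)] yS[OF il(2)] S(1) by blast
      then show False using y il by (auto simp: bij_betw_def inj_on_def)
    qed
    then have "\<not> p dvd det (vander (card S) y)"
      unfolding det_vander using p by (auto simp: prime_dvd_prod_iff)
    then show ?thesis using prime_imp_coprime[OF p] by simp
  qed
  ultimately show ?thesis unfolding coprime_dvd_mult_left_iff[OF cop] res by blast
qed

section \<open>The size of the resultant\<close>

definition coeff_sum :: "int poly \<Rightarrow> int" where
  "coeff_sum f = (\<Sum>i\<le>degree f. \<bar>coeff f i\<bar>)"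

lemma sum_coeff_reindex_le:
  assumes "inj_on h J" "finite J" "h ` J \<subseteq> {..degree f}"
  shows "(\<Sum>j\<in>J. \<bar>coeff f (h j)\<bar>) \<le> coeff_sum f"
proof -
  have "(\<Sum>j\<in>J. \<bar>coeff f (h j)\<bar>) = (\<Sum>i\<in>h ` J. \<bar>coeff f i\<bar>)" using assms(1) by (simp add: sum.reindex)
  also have "\<dots> \<le> coeff_sum f" unfolding coeff_sum_def using assms(3) by (intro sum_mono2) auto
  finally show ?thesis .
qed

text \<open>A row of the Sylvester matrix contains each coefficient of \<open>f\<close> or of
  \<open>g\<close> at most once, so the coefficient sums bound the row sums.\<close>

lemma abs_resultant_le:
  fixes f g :: "int poly"
  shows "\<bar>resultant f g\<bar> \<le> coeff_sum f ^ degree g * coeff_sum g ^ degree f"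
proof -
  define m n where "m = degree f" and "n = degree g"
  let ?R = "\<lambda>i. \<Sum>j<m + n. \<bar>sylvester_mat f g $$ (i, j)\<bar>"
  have r1: "?R i \<le> coeff_sum f" if "i < n" for i
  proof -
    have "?R i = (\<Sum>j<m + n. if i \<le> j \<and> j \<le> m + i then \<bar>coeff f (m + i - j)\<bar> else 0)"
      using that by (intro sum.cong refl, subst sylvester_index_mat) (auto simp: m_def n_def)
    also have "\<dots> = (\<Sum>j\<in>{j. j < m + n \<and> i \<le> j \<and> j \<le> m + i}. \<bar>coeff f (m + i - j)\<bar>)"
      by (intro sum.mono_neutral_cong_right) auto
    also have "\<dots> \<le> coeff_sum f" by (rule sum_coeff_reindex_le) (auto simp: inj_on_def m_def)
    finally show ?thesis .
  qed
  have r2: "?R i \<le> coeff_sum g" if "n \<le> i" "i < m + n" for i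
  proof -
    have "?R i = (\<Sum>j<m + n. if i - n \<le> j \<and> j \<le> i then \<bar>coeff g (i - j)\<bar> else 0)"
      using that by (intro sum.cong refl, subst sylvester_index_mat) (auto simp: m_def n_def)
    also have "\<dots> = (\<Sum>j\<in>{j. j < m + n \<and> i - n \<le> j \<and> j \<le> i}. \<bar>coeff g (i - j)\<bar>)"
      by (intro sum.mono_neutral_cong_right) auto
    also have "\<dots> \<le> coeff_sum g" by (rule sum_coeff_reindex_le) (auto simp: inj_on_def n_def)
    finally show ?thesis .
  qed
  have "\<bar>resultant f g\<bar> \<le> (\<Prod>i<m + n. ?R i)"
    unfolding resultant_def by (rule det_norm_le_prod_sum) (simp add: m_def n_def sylvester_carrier_mat)
  also have "\<dots> \<le> (\<Prod>i<m + n. if i < n then coeff_sum f else coeff_sum g)"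
    using r1 r2 by (intro prod_mono) (auto intro!: sum_nonneg)
  also have "\<dots> = (\<Prod>i\<in>{..<n}. coeff_sum f) * (\<Prod>i\<in>{n..<m + n}. coeff_sum g)"
  proof -
    let ?h = "\<lambda>i. if i < n then coeff_sum f else coeff_sum g"
    have "prod ?h ({..<n} \<union> {n..<m + n}) = prod ?h {..<n} * prod ?h {n..<m + n}" by (rule prod.union_disjoint) auto
    moreover have "{..<n} \<union> {n..<m + n} = {..<m + n}" by auto
    ultimately have "prod ?h {..<m + n} = prod ?h {..<n} * prod ?h {n..<m + n}" by (simp only:)
    then show ?thesis by simp
  qed
  finally show ?thesis by (simp add: m_def n_def)
qed

lemma mahler_measure_le_coeff_sum: "mahler_measure f \<le> real_of_int (coeff_sum f)"
proof (cases "f = 0")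
  case False
  have "mahler_measure f \<le> sqrt (real_of_int (\<Sum>a\<leftarrow>coeffs f. a * a))" by (rule Landau_inequality_mahler_measure)
  also have "(\<Sum>a\<leftarrow>coeffs f. a * a) = (\<Sum>i\<le>degree f. coeff f i * coeff f i)"
    using False by (simp add: coeffs_def o_def sum_list_distinct_conv_sum_set atLeastLessThanSuc_atLeastAtMost atLeast0AtMost del: upt_Suc)
  also have "\<dots> \<le> coeff_sum f ^ 2"
  proof -
    have "(\<Sum>i\<le>degree f. coeff f i * coeff f i) = (\<Sum>i\<le>degree f. \<bar>coeff f i\<bar> * \<bar>coeff f i\<bar>)" by simp
    also have "\<dots> \<le> (\<Sum>i\<le>degree f. \<bar>coeff f i\<bar> * coeff_sum f)"
      unfolding coeff_sum_def by (intro sum_mono mult_left_mono member_le_sum) auto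
    also have "\<dots> = coeff_sum f ^ 2" by (simp add: coeff_sum_def sum_distrib_right power2_eq_square)
    finally show ?thesis .
  qed
  finally have "mahler_measure f \<le> sqrt (real_of_int (coeff_sum f ^ 2))" by simp
  then show ?thesis by (simp add: coeff_sum_def sum_nonneg)
qed (use Landau_inequality_mahler_measure[of 0] in \<open>simp add: coeff_sum_def\<close>)

text \<open>The Mahler measure is multiplicative and at least 1 on the cofactor, so that of
  \<open>g\<close> is controlled by \<open>f\<close>. Mignotte's binomial bounds on the coefficients
  then add up to a power of 2. No information about the removed factors is required.\<close>

lemma coeff_sum_factor_le:
  assumes f: "f \<noteq> 0" and g: "g dvd f"
  shows "coeff_sum g \<le> 2 ^ degree g * coeff_sum f"
proof -
  obtain h where h: "f = g * h" using g by blast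
  have "mahler_measure f = mahler_measure g * mahler_measure h"
    unfolding mahler_measure_def h of_int_poly_hom.hom_mult by (rule measure_eq_prod)
  moreover have "1 \<le> mahler_measure h" using mahler_measure_poly_ge_1 h f by auto
  ultimately have "mahler_measure g \<le> mahler_measure f"
    using mult_left_mono[OF _ mahler_measure_ge_0[of g], of 1 "mahler_measure h"] by simp
  then have Mg: "mahler_measure g \<le> real_of_int (coeff_sum f)" using mahler_measure_le_coeff_sum[of f] by linarith
  have "real_of_int (coeff_sum g) = (\<Sum>k\<le>degree g. real_of_int \<bar>coeff g k\<bar>)" by (simp add: coeff_sum_def)
  also have "\<dots> \<le> (\<Sum>k\<le>degree g. real (degree g choose k) * real_of_int (coeff_sum f))"
  proof (rule sum_mono)
    fix k
    have "real_of_int \<bar>coeff g k\<bar> \<le> real (degree g choose k) * mahler_measure g" by (rule Mignotte_bound)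
    also have "\<dots> \<le> real (degree g choose k) * real_of_int (coeff_sum f)" using Mg by (intro mult_left_mono) auto
    finally show "real_of_int \<bar>coeff g k\<bar> \<le> real (degree g choose k) * real_of_int (coeff_sum f)" .
  qed
  also have "\<dots> = real (\<Sum>k\<le>degree g. degree g choose k) * real_of_int (coeff_sum f)" by (simp add: sum_distrib_right)
  also have "\<dots> = real_of_int (2 ^ degree g * coeff_sum f)" unfolding choose_row_sum by simp
  finally show ?thesis by (simp only: of_int_le_iff)
qed

lemma coeff_sum_Fpoly_le:
  assumes "2 \<le> n"
  shows "coeff_sum (Fpoly n) \<le> 2 ^ n"
proof -
  have "coeff_sum (Fpoly n) \<le> (\<Sum>i\<le>n. int (n choose i))"
    unfolding coeff_sum_def Fpoly_coeffs(3)[OF assms] using assms by (intro sum_le_included[where i = id]) (auto simp: coeff_Fpoly)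
  also have "\<dots> = 2 ^ n" by (simp add: choose_row_sum flip: of_nat_sum)
  finally show ?thesis .
qed

lemma irreducible_cyclotomic3: "irreducible [:1, 1, 1::int:]"
proof (rule irreducibleI)
  let ?q = "[:1, 1, 1::int:]"
  have nr: "poly (of_int_poly ?q) x \<noteq> 0" for x :: real
  proof -
    have "0 < (x + 1/2)\<^sup>2 + 3/4" by (rule add_nonneg_pos) auto
    then show ?thesis by (simp add: power2_eq_square algebra_simps)
  qed
  show "?q \<noteq> 0" by simp
  show "\<not> is_unit ?q" by (simp add: is_unit_poly_iff)
  fix a b assume ab: "?q = a * b"
  have "a \<noteq> 0" "b \<noteq> 0" using ab by auto
  then have "degree a + degree b = degree ?q" unfolding ab by (simp add: degree_mult_eq)
  moreover have "even (degree a)" "even (degree b)" using int_poly_factor_sign(1)[OF _ nr] ab by (metis dvd_triv_left dvd_triv_right)+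
  ultimately have "degree a + degree b = 2" "even (degree a)" "even (degree b)" by simp_all
  then have "degree a = 0 \<or> degree b = 0" by presburger
  moreover have "is_unit c" if cq: "c dvd ?q" and dc: "degree c = 0" for c
  proof -
    obtain k where k: "c = [:k:]" using dc by (metis degree_eq_zeroE)
    then have "k dvd coeff ?q 0" using cq by (metis const_poly_dvd_iff)
    then show ?thesis by (simp add: k is_unit_const_poly_iff)
  qed
  ultimately show "is_unit a \<or> is_unit b" using ab by (metis dvd_triv_left dvd_triv_right)
qed

text \<open>The exceptional roots must go with all multiplicities, hence the induction on the
  degree. Modulo a prime, each root of \<open>f\<close> remains visible as a root of a removed
  factor or of \<open>A\<close>.\<close>

lemma strip_exceptional_roots:
  fixes f :: "int poly"
  assumes "f \<noteq> 0"
  shows "\<exists>A. A dvd f \<and> (\<forall>z::complex. poly (of_int_poly A) z = 0 \<longrightarrow> z \<noteq> 0 \<and> 1 + z \<noteq> 0 \<and> z\<^sup>2 + z + 1 \<noteq> 0) \<and>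
    (\<forall>p y. prime p \<longrightarrow> p dvd poly f y \<longrightarrow> p dvd y \<or> p dvd y + 1 \<or> p dvd y\<^sup>2 + y + 1 \<or> p dvd poly A y)"
  using assms
proof (induction "degree f" arbitrary: f rule: less_induct)
  case less
  show ?case
  proof (cases "\<exists>X\<in>{[:0, 1:], [:1, 1:], [:1, 1, 1:]}. X dvd f")
    case True
    then obtain X where X: "X \<in> {[:0, 1:], [:1, 1:], [:1, 1, 1:]}" "X dvd f" by blast
    then obtain g where g: "f = X * g" by blast
    have "g \<noteq> 0" "X \<noteq> 0" "0 < degree X" using less.prems g X(1) by auto
    then have "degree g < degree f" unfolding g by (simp add: degree_mult_eq)
    from less.hyps[OF this \<open>g \<noteq> 0\<close>] obtain A where A: "A dvd g"
      "\<And>z::complex. poly (of_int_poly A) z = 0 \<Longrightarrow> z \<noteq> 0 \<and> 1 + z \<noteq> 0 \<and> z\<^sup>2 + z + 1 \<noteq> 0"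
      "\<And>p y. prime p \<Longrightarrow> p dvd poly g y \<Longrightarrow> p dvd y \<or> p dvd y + 1 \<or> p dvd y\<^sup>2 + y + 1 \<or> p dvd poly A y"
      by blast
    have "p dvd y \<or> p dvd y + 1 \<or> p dvd y\<^sup>2 + y + 1 \<or> p dvd poly A y" if p: "prime p" "p dvd poly f y" for p y
    proof -
      have "p dvd poly X y \<or> p dvd poly g y" using p prime_dvd_multD unfolding g poly_mult by blast
      moreover have "poly X y \<in> {y, y + 1, y\<^sup>2 + y + 1}" using X(1) by (auto simp: power2_eq_square algebra_simps)
      ultimately show ?thesis using A(3)[OF p(1)] by auto
    qed
    moreover have "A dvd f" using A(1) g by simp
    ultimately show ?thesis using A(2) by blast
  next
    case False
    have "z \<noteq> 0 \<and> 1 + z \<noteq> 0 \<and> z\<^sup>2 + z + 1 \<noteq> 0" if z: "poly (of_int_poly f) z = 0" for z :: complex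
    proof -
      have lin: "[:- c, 1:] dvd f" if "z = of_int c" for c :: int
      proof -
        have "poly f c = 0" using z that by simp
        then show ?thesis by (simp only: poly_eq_0_iff_dvd)
      qed
      have "[:1, 1, 1:] dvd f" if "z\<^sup>2 + z + 1 = 0"
        by (rule irreducible_int_poly_dvd[OF irreducible_cyclotomic3 _ z]) (use that in \<open>auto simp: power2_eq_square algebra_simps\<close>)
      moreover have "[:0, 1:] dvd f" if "z = 0" using lin[of 0] that by simp
      moreover have "[:1, 1:] dvd f" if "1 + z = 0"
      proof -
        have "z = - 1" using that eq_neg_iff_add_eq_0[of z 1] by (simp add: add.commute)
        then show ?thesis using lin[of "- 1"] by simp
      qed
      ultimately show ?thesis using False by blast
    qed
    then show ?thesis using dvd_refl[of f] by blast
  qed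
qed

text \<open>Solutions that are roots of Y^2 + Y + 1 modulo \<open>p\<close> number at most 2. The
  others are common roots of \<open>A\<close> and \<open>Fpoly r\<close>, whose resultant is nonzero
  and at most (4^s)^r * (2^r)^s = 8^(rs); the constant 3 bounds \<open>ln 8\<close>.\<close>

lemma card_common_solutions_le:
  fixes p r s :: nat
  assumes p: "prime p" and s: "6 \<le> s" "s \<noteq> 7" "s < r" "s < p"
    and S: "S \<subseteq> {0..<int p}"
      "\<And>y. y \<in> S \<Longrightarrow> \<not> int p dvd y \<and> \<not> int p dvd y + 1 \<and> int p dvd poly (Fpoly s) y \<and> int p dvd poly (Fpoly r) y"
  shows "real (card S) * ln (real p) \<le> 2 * ln (real p) + 3 * (real r * real s)"
proof -
  have ip: "prime (int p)" using p by simp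
  have s2: "2 \<le> s" "2 \<le> r" using s by auto
  have Fs0: "Fpoly s \<noteq> 0" using Fpoly_coeffs(4)[OF s2(1)] s by auto
  obtain A where A: "A dvd Fpoly s"
    "\<And>z::complex. poly (of_int_poly A) z = 0 \<Longrightarrow> z \<noteq> 0 \<and> 1 + z \<noteq> 0 \<and> z\<^sup>2 + z + 1 \<noteq> 0"
    "\<And>q y. prime q \<Longrightarrow> q dvd poly (Fpoly s) y \<Longrightarrow> q dvd y \<or> q dvd y + 1 \<or> q dvd y\<^sup>2 + y + 1 \<or> q dvd poly A y"
    using strip_exceptional_roots[OF Fs0] by blast
  then obtain B where B: "Fpoly s = A * B" by blast
  have nz: "A \<noteq> 0" "B \<noteq> 0" using Fs0 B by auto
  define S1 where "S1 = {y \<in> S. int p dvd poly [:1, 1, 1:] y}"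
  define S2 where "S2 = {y \<in> S. int p dvd poly A y}"
  have fin: "finite S" using S(1) finite_subset by blast
  have "S \<subseteq> S1 \<union> S2"
  proof
    fix y assume y: "y \<in> S"
    then have "int p dvd y\<^sup>2 + y + 1 \<or> int p dvd poly A y" using A(3)[OF ip] S(2) by blast
    then show "y \<in> S1 \<union> S2" using y by (auto simp: S1_def S2_def power2_eq_square algebra_simps)
  qed
  then have "card S \<le> card (S1 \<union> S2)" using fin by (intro card_mono) (auto simp: S1_def S2_def)
  also have "\<dots> \<le> card S1 + card S2" by (rule card_Un_le)
  also have "card S1 \<le> degree [:1, 1, 1::int:]"
  proof (rule card_roots_mod_prime[OF ip])
    show "\<not> int p dvd lead_coeff [:1, 1, 1::int:]" using prime_gt_1_nat[OF p] by simp
    show "S1 \<subseteq> {0..<int p}" using S(1) by (auto simp: S1_def)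
    show "int p dvd poly [:1, 1, 1:] y" if "y \<in> S1" for y using that unfolding S1_def by blast
  qed
  finally have cS: "card S \<le> 2 + card S2" by simp
  have dA: "degree A \<le> s"
    using dvd_imp_degree_le[OF A(1) Fs0] Fpoly_coeffs(3)[OF s2(1)] by simp
  have "\<not> int p dvd lead_coeff A"
  proof
    assume "int p dvd lead_coeff A"
    then have "int p dvd lead_coeff (Fpoly s)" unfolding B lead_coeff_mult by simp
    then have "int p dvd int s" using Fpoly_coeffs(4)[OF s2(1)] by simp
    then have "p dvd s" by simp
    then show False using s by (auto dest: dvd_imp_le)
  qed
  \<comment> \<open>The resultant argument needs at least \<open>card S2\<close> columns in the
    Sylvester matrix. Lagrange's bound provides them, since the leading coefficient of
    \<open>A\<close> divides \<open>s < p\<close>.\<close>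
  then have cA: "card S2 \<le> degree A" using S(1) by (intro card_roots_mod_prime[OF ip]) (auto simp: S2_def)
  define R where "R = resultant A (Fpoly r)"
  have "R \<noteq> 0"
  proof
    assume "R = 0"
    then have "degree (gcd A (Fpoly r)) \<noteq> 0" by (simp add: R_def resultant_0_gcd)
    then have "\<not> constant (poly (of_int_poly (gcd A (Fpoly r)) :: complex poly))" unfolding constant_degree by simp
    then obtain z where z: "poly (of_int_poly (gcd A (Fpoly r))) z = (0::complex)"
using fundamental_theorem_of_algebra by blast
    have zf: "poly (of_int_poly f) z = 0" if d: "gcd A (Fpoly r) dvd f" for f
    proof -
      obtain k where "f = gcd A (Fpoly r) * k" using d by blast
      then show ?thesis using z by (simp add: of_int_poly_hom.hom_mult)
    qed
    have zA: "poly (of_int_poly A) z = 0" "poly (of_int_poly (Fpoly r)) z = 0" by (rule zf; simp)+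
    have "poly (of_int_poly (Fpoly s)) z = 0" unfolding B using zA(1) by (simp add: of_int_poly_hom.hom_mult)
    then have "z = 0 \<or> 1 + z = 0 \<or> z\<^sup>2 + z + 1 = 0"
      using Fermat_polynomials_common_root[OF s(1-3)] zA(2) by (simp add: poly_Fpoly_eq_0)
    then show False using A(2)[OF zA(1)] by blast
  qed
  have "int p ^ card S2 dvd R"
    unfolding R_def using S cA by (intro power_card_dvd_resultant[OF ip]) (auto simp: S2_def)
  then have "int p ^ card S2 \<le> \<bar>R\<bar>" using \<open>R \<noteq> 0\<close> by (simp add: dvd_imp_le_int zdvd_imp_le)
  also have "\<dots> \<le> coeff_sum A ^ degree (Fpoly r) * coeff_sum (Fpoly r) ^ degree A"
    unfolding R_def by (rule abs_resultant_le)
  also have "\<dots> \<le> (4 ^ s) ^ r * (2 ^ r) ^ s"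
  proof (rule mult_mono)
    have "coeff_sum A \<le> 2 ^ degree A * coeff_sum (Fpoly s)" by (rule coeff_sum_factor_le[OF Fs0 A(1)])
    also have "\<dots> \<le> 2 ^ s * 2 ^ s"
      using dA coeff_sum_Fpoly_le[OF s2(1)] by (intro mult_mono power_increasing) (auto simp: coeff_sum_def intro!: sum_nonneg)
    also have "\<dots> = (4::int) ^ s" by (simp flip: power_mult_distrib)
    finally have "coeff_sum A ^ degree (Fpoly r) \<le> (4 ^ s) ^ degree (Fpoly r)"
      by (intro power_mono) (auto simp: coeff_sum_def intro!: sum_nonneg)
    also have "\<dots> \<le> (4 ^ s) ^ r" using Fpoly_coeffs(3)[OF s2(2)] by (intro power_increasing) auto
    finally show "coeff_sum A ^ degree (Fpoly r) \<le> (4 ^ s) ^ r" .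
    have "coeff_sum (Fpoly r) ^ degree A \<le> (2 ^ r) ^ degree A"
      using coeff_sum_Fpoly_le[OF s2(2)] by (intro power_mono) (auto simp: coeff_sum_def intro!: sum_nonneg)
    also have "\<dots> \<le> (2 ^ r) ^ s" using dA by (intro power_increasing) auto
    finally show "coeff_sum (Fpoly r) ^ degree A \<le> (2 ^ r) ^ s" .
  qed (auto simp: coeff_sum_def intro!: sum_nonneg zero_le_power)
  also have "\<dots> = 8 ^ (r * s)"
    by (simp add: power_mult[symmetric] mult.commute[of s r] flip: power_mult_distrib)
  finally have "real_of_int (int p ^ card S2) \<le> real_of_int (8 ^ (r * s))" by (simp only: of_int_le_iff)
  then have "real p ^ card S2 \<le> 8 ^ (r * s)" by simp
  moreover have p0: "0 < real p" "1 \<le> real p" using p prime_gt_0_nat[of p] by simp_all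
  ultimately have "ln (real p ^ card S2) \<le> ln (8 ^ (r * s))" by (intro ln_mono) auto
  then have "real (card S2) * ln (real p) \<le> real (r * s) * ln 8" using p0 by (simp add: ln_realpow)
  also have "\<dots> \<le> real (r * s) * 3"
  proof (rule mult_left_mono)
    have "ln (8::real) = 3 * ln 2" using ln_realpow[of 2 3] by simp
    then show "ln (8::real) \<le> 3" using ln_2_less_1 by simp
  qed simp
  finally have "real (card S2) * ln (real p) \<le> 3 * (real r * real s)" by (simp add: mult_ac)
  moreover have "real (card S) * ln (real p) \<le> (2 + real (card S2)) * ln (real p)"
    using cS p0 by (intro mult_right_mono) auto
  ultimately show ?thesis by (simp add: algebra_simps)
qed

lemma N_sol_le_card:
  assumes p: "prime p"
  shows "N_sol p r s \<le> card {y \<in> {0..<int p}. \<not> int p dvd y \<and> \<not> int p dvd y + 1 \<and>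
    int p dvd poly (Fpoly s) y \<and> int p dvd poly (Fpoly r) y}" (is "_ \<le> card ?S")
proof -
  interpret residues_prime p "Fp p" by unfold_locales (use p in auto)
  let ?R = "Fp p"
  have dvd: "int p dvd poly (Fpoly n) y"
    if x: "x \<in> carrier ?R" and y: "y \<in> carrier ?R" and eq: "x [^]\<^bsub>?R\<^esub> n = y [^]\<^bsub>?R\<^esub> n \<oplus>\<^bsub>?R\<^esub> \<one>\<^bsub>?R\<^esub>"
      and xy: "x = y \<oplus>\<^bsub>?R\<^esub> \<one>\<^bsub>?R\<^esub>" for x y and n :: nat
  proof -
    have m: "x mod int p = x" "y mod int p = y" using x y by (auto simp: res_carrier_eq)
    have "x ^ n mod int p = (y ^ n mod int p + 1) mod int p"
      using eq pow_cong[of x n] pow_cong[of y n] unfolding m by (simp add: res_add_eq res_one_eq)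
    then have "x ^ n mod int p = (y ^ n + 1) mod int p" by (simp add: mod_add_left_eq)
    moreover have "(x mod int p) = (1 + y) mod int p" using xy unfolding m by (simp add: res_add_eq res_one_eq add.commute)
    ultimately have "(1 + y) ^ n mod int p = (y ^ n + 1) mod int p" by (metis power_mod)
    then have "int p dvd (1 + y) ^ n - (y ^ n + 1)" by (simp only: mod_eq_dvd_iff)
    moreover have "poly (Fpoly n) y = (1 + y) ^ n - (y ^ n + 1)" by (simp add: Fpoly_def poly_monom)
    ultimately show ?thesis by simp
  qed
  have units: "x \<in> carrier ?R \<and> \<not> int p dvd x" if "x \<in> Units ?R" for x
    using that by (auto simp: res_prime_units_eq res_carrier_eq zdvd_not_zless)
  let ?X = "{(x, y). x \<in> Units ?R \<and> y \<in> Units ?R \<and>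
     x [^]\<^bsub>?R\<^esub> r = y [^]\<^bsub>?R\<^esub> r \<oplus>\<^bsub>?R\<^esub> \<one>\<^bsub>?R\<^esub> \<and>
     x [^]\<^bsub>?R\<^esub> s = y [^]\<^bsub>?R\<^esub> s \<oplus>\<^bsub>?R\<^esub> \<one>\<^bsub>?R\<^esub> \<and>
     x = y \<oplus>\<^bsub>?R\<^esub> \<one>\<^bsub>?R\<^esub>}"
  have "inj_on snd ?X" by (auto simp: inj_on_def)
  moreover have "snd ` ?X \<subseteq> ?S"
  proof
    fix y assume "y \<in> snd ` ?X"
    then obtain x where x: "x \<in> Units ?R" "y \<in> Units ?R"
      and e: "x [^]\<^bsub>?R\<^esub> r = y [^]\<^bsub>?R\<^esub> r \<oplus>\<^bsub>?R\<^esub> \<one>\<^bsub>?R\<^esub>"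
      "x [^]\<^bsub>?R\<^esub> s = y [^]\<^bsub>?R\<^esub> s \<oplus>\<^bsub>?R\<^esub> \<one>\<^bsub>?R\<^esub>" "x = y \<oplus>\<^bsub>?R\<^esub> \<one>\<^bsub>?R\<^esub>"
      by auto
    note u = units[OF x(1)] units[OF x(2)]
    have "x = (y + 1) mod int p" using e(3) by (simp add: res_add_eq res_one_eq)
    then have "\<not> int p dvd y + 1" using u(1) by (auto simp: dvd_eq_mod_eq_0)
    then show "y \<in> ?S" using u dvd[OF _ _ e(1,3)] dvd[OF _ _ e(2,3)] by (auto simp: res_carrier_eq)
  qed
  moreover have "finite ?S" by (rule finite_subset[of _ "{0..<int p}"]) auto
  ultimately show ?thesis unfolding N_sol_def by (rule card_inj_on_le)
qed

text \<open>For \<open>s <= 5\<close> the degree \<open>s - 1\<close> of \<open>Fpoly s\<close>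
  suffices. For \<open>s = 7\<close> the degree is 6, but two of the roots are 0 and
  \<open>p - 1\<close>, the representative of -1, neither of which is counted.\<close>

lemma card_solutions_le_4:
  fixes p s :: nat
  assumes p: "prime p" and s: "2 \<le> s" "s \<le> 5 \<or> s = 7" "s < p"
    and S: "S \<subseteq> {0..<int p}" "\<And>y. y \<in> S \<Longrightarrow> \<not> int p dvd y \<and> \<not> int p dvd y + 1 \<and> int p dvd poly (Fpoly s) y"
  shows "card S \<le> 4"
proof -
  have p1: "1 < int p" using prime_gt_1_nat[OF p] by simp
  have fin: "finite S" using S(1) finite_subset by blast
  have bound: "card T \<le> s - 1" if T: "T \<subseteq> {0..<int p}" "\<And>y. y \<in> T \<Longrightarrow> int p dvd poly (Fpoly s) y" for T
  proof -
    have "\<not> p dvd s" using s by (auto dest: dvd_imp_le)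
    then have "\<not> int p dvd lead_coeff (Fpoly s)" using Fpoly_coeffs(4)[OF s(1)] by simp
    then have "card T \<le> degree (Fpoly s)" using p T by (intro card_roots_mod_prime[of "int p"]) auto
    then show ?thesis using Fpoly_coeffs(3)[OF s(1)] by simp
  qed
  show ?thesis
  proof (cases "s = 7")
    case False
    then show ?thesis using bound[of S] S s by fastforce
  next
    case True
    have d0: "int p dvd poly (Fpoly 7) 0" by (simp add: Fpoly_def poly_monom)
    have "[(int p - 1) ^ 7 = (0 - 1) ^ 7] (mod int p)" by (intro cong_pow cong_diff) (simp_all add: cong_def)
    then have m: "int p dvd (int p - 1) ^ 7 - (0 - 1) ^ 7" by (simp only: cong_iff_dvd_diff)
    have "int p dvd int p ^ 7 - ((int p - 1) ^ 7 - (0 - 1) ^ 7)" by (rule dvd_diff[OF _ m]) simp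
    moreover have "int p ^ 7 - ((int p - 1) ^ 7 - (0 - 1) ^ 7) = poly (Fpoly 7) (int p - 1)"
      by (simp add: Fpoly_def poly_monom)
    ultimately have d1: "int p dvd poly (Fpoly 7) (int p - 1)" by (simp only:)
    have "card (insert 0 (insert (int p - 1) S)) \<le> s - 1"
    proof (rule bound)
      show "insert 0 (insert (int p - 1) S) \<subseteq> {0..<int p}" using S(1) p1 by auto
      fix y assume "y \<in> insert 0 (insert (int p - 1) S)"
      then show "int p dvd poly (Fpoly s) y" using d0 d1 S(2) True by blast
    qed
    moreover have "int p - 1 \<notin> S" using S(2)[of "int p - 1"] by auto
    moreover have "0 \<notin> S" using S(2)[of 0] by auto
    ultimately show ?thesis using fin p1 True by simp
  qed
qed

theorem theorem1p4:
  shows "\<exists>c::real. \<forall>p r s :: nat. prime p \<longrightarrow> 1 < s \<longrightarrow> s < r \<longrightarrow>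
    real (N_sol p r s) \<le> c * (real r * real s / ln (real p)) + 4"
proof (intro exI[of _ 3] allI impI)
  fix p r s :: nat assume p: "prime p" and s: "1 < s" "s < r"
  define S where "S = {y \<in> {0..<int p}. \<not> int p dvd y \<and> \<not> int p dvd y + 1 \<and>
    int p dvd poly (Fpoly s) y \<and> int p dvd poly (Fpoly r) y}"
  have S: "S \<subseteq> {0..<int p}" "\<And>y. y \<in> S \<Longrightarrow> \<not> int p dvd y \<and> \<not> int p dvd y + 1 \<and> int p dvd poly (Fpoly s) y \<and> int p dvd poly (Fpoly r) y"
    by (auto simp: S_def)
  have lnp: "0 < ln (real p)" using prime_gt_1_nat[OF p] by simp
  have "real (card S) \<le> 3 * (real r * real s / ln (real p)) + 4"
  proof -
    \<comment> \<open>For \<open>p <= s\<close> the leading coefficient may vanish modulo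
      \<open>p\<close>, but the trivial count works: \<open>card S <= p\<close> and
      \<open>ln p <= p\<close>, while \<open>p\<close> is at most both \<open>s\<close> and
      \<open>r\<close>.\<close>
    consider "p \<le> s" | "s < p" "s \<le> 5 \<or> s = 7" | "s < p" "6 \<le> s" "s \<noteq> 7" by linarith
    then show ?thesis
    proof cases
      case 1
      have "card S \<le> p" using card_mono[OF _ S(1)] by simp
      then have "real (card S) * ln (real p) \<le> real p * real p"
        using lnp ln_le_minus_one[of "real p"] prime_gt_0_nat[OF p] by (intro mult_mono) auto
      also have "\<dots> \<le> real r * real s" using 1 s by (intro mult_mono) auto
      finally have "real (card S) \<le> real r * real s / ln (real p)" using lnp by (simp add: pos_le_divide_eq)
      moreover have "0 \<le> real r * real s / ln (real p)" using lnp by simp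
      ultimately show ?thesis by linarith
    next
      case 2
      have "card S \<le> 4" by (rule card_solutions_le_4[OF p _ 2(2,1) S(1)]) (use s S(2) in auto)
      moreover have "0 \<le> real r * real s / ln (real p)" using lnp by simp
      ultimately show ?thesis by simp
    next
      case 3
      have "real (card S) * ln (real p) \<le> 2 * ln (real p) + 3 * (real r * real s)"
        by (rule card_common_solutions_le[OF p 3(2,3) s(2) 3(1) S])
      then have "(real (card S) - 2) * ln (real p) \<le> 3 * (real r * real s)" by (simp add: algebra_simps)
      then have "real (card S) - 2 \<le> 3 * (real r * real s) / ln (real p)" using lnp by (simp add: pos_le_divide_eq)
      then show ?thesis by simp
    qed
  qed
  moreover have "N_sol p r s \<le> card S" unfolding S_def by (rule N_sol_le_card[OF p])
  ultimately show "real (N_sol p r s) \<le> 3 * (real r * real s / ln (real p)) + 4" by linarith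
qed

end
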